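(* Consider a Pólya urn that is tenable and balanced with balance constant $b>0$, with deterministic initial state $X_0$, and with $\lambda_1=b$. Let $p\ge 2$ and suppose that $\mathbb E|\xi_{ij}|^p<\infty$ for all $i,j\in\{1,\dots,q\}$. Then there exists a constant $C_p$, not depending on $n$ (but possibly depending on $p$ and on the urn), such that for every $n\ge 2$, $$\|X_n-\mathbb E X_n\|_p\le \begin{cases} C_p\, n^{1/2}, & \operatorname{Re}\lambda_2<\lambda_1/2,\\ C_p\, n^{1/2}(\log n)^{\nu_2+\frac12}, & \operatorname{Re}\lambda_2=\lambda_1/2,\\ C_p\, n^{\operatorname{Re}\lambda_2/\lambda_1}(\log n)^{\nu_2}, & \operatorname{Re}\lambda_2>\lambda_1/2.\end{cases}$$
   Context: Pólya urn. Fix an integer $q\ge2$ (number of colours), activities $a_1,\dots,a_q\ge0$ (zero allowed), $a=(a_1,\dots,a_q)'$, and random vectors $\xi_i=(\xi_{i1},\dots,\xi_{iq})'$ in $\mathbb R^q$, $i=1,\dots,q$ (replacement vectors; entries real, possibly negative). The urn is a Markov process $X_n=(X_{n1},\dots,X_{nq})'\in[0,\infty)^q$, $n\ge0$, with deterministic initial state $X_0$. At each step $n+1\ge1$, a colour $I_{n+1}\in\{1,\dots,q\}$ is drawn which, conditionally on the past, equals $i$ with probability $a_iX_{ni}/\sum_j a_jX_{nj}$; given the past and $I_{n+1}=i$, the increment $\Delta X_n:=X_{n+1}-X_n$ has the same distribution as $\xi_i$ and is independent of the past. The urn is tenable if for every $n\ge0$, almost surely all $X_{ni}\ge0$ and $\sum_i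 a_iX_{ni}>0$. It is balanced if there is a constant $b>0$ with $\sum_j a_j\xi_{ij}=b$ a.s. for every $i$. Intensity matrix: $A$ is the $q\times q$ matrix with entries $(A)_{ij}=a_j\,\mathbb E\,\xi_{ji}$. Its set of eigenvalues is $\sigma(A)$. For $\lambda\in\sigma(A)$, $\nu_\lambda\ge0$ is the integer such that the largest Jordan block of $A$ with eigenvalue $\lambda$ has size $\nu_\lambda+1$. The eigenvalues, repeated according to algebraic multiplicity, are listed as $\lambda_1,\dots,\lambda_q$ in order of decreasing real part and, among those with equal real parts, in order of decreasing $\nu_j:=\nu_{\lambda_j}$. In a balanced urn $b$ is always an eigenvalue of $A$ (with left eigenvector $a'$); the hypothesis $\lambda_1=b$ says that $b$ can be taken as the first eigenvalue in this list. For a random vector $X$, $\|X\|_p:=(\mathbb E|X|^p)^{1/p}$ with $|\cdot|$ the Euclidean norm. *)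

theory Defs
  imports "HOL-Probability.Probability" "Jordan_Normal_Form.Jordan_Normal_Form"
begin

no_notation vec_index (infixl "$" 100)

text \<open>The sigma-algebra generated by \<open>X 0, \<dots>, X n\<close> and \<open>J 1, \<dots>, J m\<close>. With \<open>m = n\<close> this is the
  past at time \<open>n\<close>; with \<open>m = Suc n\<close> it is the past together with the next colour drawn.\<close>

definition urn_history ::
    "'w measure \<Rightarrow> (nat \<Rightarrow> 'w \<Rightarrow> real ^ 'q::finite) \<Rightarrow> (nat \<Rightarrow> 'w \<Rightarrow> 'q) \<Rightarrow> nat \<Rightarrow> nat \<Rightarrow> 'w measure"
  where "urn_history M X J n m = sigma (space M)
    ({X k -` B \<inter> space M | k B. k \<le> n \<and> B \<in> sets borel} \<union>
     {J k -` S \<inter> space M | k S. 1 \<le> k \<and> k \<le> m})"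

text \<open>The colours are the elements of the finite type \<open>'q\<close>. Only the law of each replacement vector
  \<open>\<xi> i\<close> matters, so these live on a probability space \<open>N\<close> of their own, which need not be related
  to the space \<open>M\<close> carrying the urn process \<open>X\<close> and the drawn colours \<open>J 1, J 2, \<dots>\<close> (\<open>J 0\<close> is
  unused). The condition \<open>increment_law\<close> is the regular-conditional-law form of: given the past and
  \<open>J (Suc n) = i\<close>, the increment is distributed as \<open>\<xi> i\<close> and is independent of the past.\<close>

locale polya_urn = prob_space M + N: prob_space N
  for a :: "real ^ 'q::finite"
    and N :: "'v measure" and \<xi> :: "'q \<Rightarrow> 'v \<Rightarrow> real ^ 'q"
    and x0 :: "real ^ 'q"
    and M :: "'w measure" and X :: "nat \<Rightarrow> 'w \<Rightarrow> real ^ 'q" and J :: "nat \<Rightarrow> 'w \<Rightarrow> 'q" +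
  assumes activity_nonneg: "0 \<le> a $ i"
    and replacement_measurable: "\<xi> i \<in> borel_measurable N"
    and state_measurable: "X n \<in> borel_measurable M"
    and colour_measurable: "J n \<in> measurable M (count_space UNIV)"
    and initial_state: "AE w in M. X 0 w = x0"
    and draw_law:
      "AE w in M. real_cond_exp M (urn_history M X J n n)
          (indicator {w \<in> space M. J (Suc n) w = i}) w
        = a $ i * X n w $ i / (\<Sum>j\<in>UNIV. a $ j * X n w $ j)"
    and increment_law: "B \<in> sets borel \<Longrightarrow>
      AE w in M. real_cond_exp M (urn_history M X J n (Suc n))
          (indicator {w \<in> space M. X (Suc n) w - X n w \<in> B}) w
        = measure N {v \<in> space N. \<xi> (J (Suc n) w) v \<in> B}"

definition tenable :: "real ^ 'q::finite \<Rightarrow> 'w measure \<Rightarrow> (nat \<Rightarrow> 'w \<Rightarrow> real ^ 'q) \<Rightarrow> bool" where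
  "tenable a M X \<longleftrightarrow>
    (\<forall>n. AE w in M. (\<forall>i. 0 \<le> X n w $ i) \<and> 0 < (\<Sum>i\<in>UNIV. a $ i * X n w $ i))"

definition balanced ::
    "real ^ 'q::finite \<Rightarrow> 'v measure \<Rightarrow> ('q \<Rightarrow> 'v \<Rightarrow> real ^ 'q) \<Rightarrow> real \<Rightarrow> bool" where
  "balanced a N \<xi> b \<longleftrightarrow> 0 < b \<and> (\<forall>i. AE v in N. (\<Sum>j\<in>UNIV. a $ j * \<xi> i v $ j) = b)"

definition intensity_matrix ::
    "real ^ 'q::finite \<Rightarrow> 'v measure \<Rightarrow> ('q \<Rightarrow> 'v \<Rightarrow> real ^ 'q) \<Rightarrow> real ^ 'q ^ 'q" where
  "intensity_matrix a N \<xi> = (\<chi> i j. a $ j * (\<integral>v. \<xi> j v $ i \<partial>N))"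

text \<open>The same matrix over the complex numbers and with rows and columns numbered \<open>0, \<dots>, q - 1\<close>, as
  required by the Jordan normal form library. On a finite type \<open>from_nat_into UNIV\<close> is a bijection
  from \<open>{..<CARD('q)}\<close>; its choice only affects the matrix by simultaneous permutation of rows and columns,
  hence neither the characteristic polynomial nor the Jordan blocks.\<close>

definition complex_mat_of :: "real ^ 'q ^ 'q::finite \<Rightarrow> complex Matrix.mat" where
  "complex_mat_of A = Matrix.mat CARD('q) CARD('q)
    (\<lambda>(i, j). complex_of_real (A $ from_nat_into UNIV i $ from_nat_into UNIV j))"

text \<open>One less than the size of the largest Jordan block with eigenvalue \<open>z\<close>. All Jordan normal forms
  of a matrix have the same blocks, so ranging over all of them is harmless.\<close>

definition jordan_nu :: "complex Matrix.mat \<Rightarrow> complex \<Rightarrow> nat" where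
  "jordan_nu A z = Max {n. \<exists>blocks. jordan_nf A blocks \<and> (n, z) \<in> set blocks} - 1"

text \<open>The list consists of the eigenvalues repeated according to algebraic multiplicity, in order of
  decreasing real part and, among equal real parts, of decreasing \<^const>\<open>jordan_nu\<close>.\<close>

definition eigenvalue_listing :: "complex Matrix.mat \<Rightarrow> complex list \<Rightarrow> bool" where
  "eigenvalue_listing A ls \<longleftrightarrow>
    char_poly A = (\<Prod>z\<leftarrow>ls. [:- z, 1:]) \<and>
    sorted_wrt (\<lambda>y z. Re z < Re y \<or> Re z = Re y \<and> jordan_nu A z \<le> jordan_nu A y) ls"

text \<open>The value is \<open>\<infinity>\<close> if the \<open>p\<close>-th moment is infinite, so a finite upper bound
  includes the claim that the moment is finite.\<close>

definition Lp_norm :: "'w measure \<Rightarrow> real \<Rightarrow> ('w \<Rightarrow> 'b::real_normed_vector) \<Rightarrow> ennreal" where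
  "Lp_norm M p Y = (let m = \<integral>\<^sup>+ w. ennreal (norm (Y w) powr p) \<partial>M
     in if m = \<infinity> then \<infinity> else ennreal (enn2real m powr (1 / p)))"

end

theory Submission
  imports Defs "Jordan_Normal_Form.Jordan_Normal_Form_Existence"
begin

text \<open>Fix a Jordan basis of the intensity matrix and write \<open>Z\<close> for a coordinate of \<open>X n - E (X n)\<close> in it,
  with eigenvalue \<open>z\<close>, and \<open>Z'\<close> for the next coordinate of the same Jordan block (\<open>0\<close> at the end of the
  block). With \<open>w n\<close> the deterministic total activity at time \<open>n\<close>,
  \<open>Z (n + 1) = (1 + z / w n) Z n + Z' n / w n + D n\<close> for martingale differences \<open>D n\<close> bounded in \<open>L\<^sup>p\<close>.
  A pointwise inequality for \<open>|x + y|\<^sup>p\<close> bounds the norm of a sum \<open>V + D\<close>, with \<open>D\<close> conditionally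
  centred, by \<open>sqrt (\<parallel>V\<parallel>\<^sup>2 + K \<parallel>D\<parallel>\<^sup>2)\<close>, so the norms of \<open>Z n\<close> obey a scalar recursion that is solved from the
  last coordinate of each block upwards: every step up costs one factor \<open>log n\<close>, and the noise
  contributes \<open>sqrt (log n)\<close> when \<open>Re z = b / 2\<close>. If the eigenvalue \<open>b\<close> is simple, its coordinate functional
  is a multiple of the left eigenvector \<open>a\<close>, so that coordinate vanishes; if it is not simple, then \<open>b\<close>
  occurs in the list again and is dominated by \<open>\<lambda>\<^sub>2\<close> like every other eigenvalue.\<close>

text \<open>Adding the norms of the increments would give order n. The square-root form of the bound
  for \<open>V + D\<close> preserves the cancellation, and as it only asks \<open>D\<close> to be
  conditionally centred, the drift \<open>Z' n / w n\<close> can first be merged into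
  \<open>V\<close> by the triangle inequality. Vanishing activities are an obstacle: they leave
  coordinates of \<open>X n\<close> that \<open>w n\<close> does not control. The noise is still
  bounded in \<open>L\<^sup>p\<close> uniformly in \<open>n\<close>, because the conditional mean of
  an increment is an average of the mean replacements with weights
  \<open>a $ i * X n w $ i / w n\<close>, which form a probability vector. Logarithms come only from
  equality of exponents. With \<gamma> the maximum of 1/2 and Re \<lambda>_2 / b, a coordinate whose
  eigenvalue has real part strictly below \<gamma> b is of order n^\<gamma> whatever the size of its
  block: the room in the exponent absorbs the forcing by the next coordinate. Hence \<nu>_2 is the
  only block size in the result. For a simple eigenvalue b the recursion alone would give order n,
  so its coordinate has to be eliminated rather than estimated.\<close>

no_notation scalar_prod (infix "\<bullet>" 70)

section \<open>Martingale steps in \<open>L\<^sup>p\<close>\<close>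

lemma exp_le_quadratic:
  fixes u :: real
  assumes "\<bar>u\<bar> \<le> 1"
  shows "exp u \<le> 1 + u + u\<^sup>2"
proof (cases "0 \<le> u")
  case True
  then show ?thesis using exp_bound[of u] assms by simp
next
  case False
  define v where "v = - u"
  have v: "0 \<le> v" using False by (simp add: v_def)
  have q: "1 + v + v\<^sup>2 / 2 \<le> exp v"
    using exp_lower_Taylor_quadratic[OF v] .
  \<comment> \<open>For negative \<open>u\<close> the claim compares
    \<open>1 - v + v\<^sup>2\<close> with \<open>1 / exp v\<close>. It suffices that its product
    with a lower Taylor bound of \<open>exp v\<close> is at least 1.\<close>
  have "(1 + v + v\<^sup>2 / 2) * (1 - v + v\<^sup>2) = 1 + v\<^sup>2 / 2 + v^3 / 2 + v^4 / 2"
    by (simp add: field_simps power2_eq_square power3_eq_cube power4_eq_xxxx)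
  then have "1 \<le> (1 + v + v\<^sup>2 / 2) * (1 - v + v\<^sup>2)"
    using v by simp
  also have "\<dots> \<le> exp v * (1 - v + v\<^sup>2)"
  proof (rule mult_right_mono[OF q])
    have "0 \<le> (1 - v)\<^sup>2 + v" using v by simp
    then show "0 \<le> 1 - v + v\<^sup>2" by (simp add: power2_diff)
  qed
  finally have "exp (- v) \<le> 1 - v + v\<^sup>2"
    by (simp add: exp_minus field_simps)
  then show ?thesis by (simp add: v_def)
qed

text \<open>Factoring out \<open>norm x\<close> turns the claim into a second-order bound for
  \<open>(1 + t) powr (p / 2)\<close>, which is at most \<open>exp (p / 2 * t)\<close>. The
  smallness of \<open>y\<close> keeps this exponent in [-1, 1], where the quadratic bound of
  \<open>exp\<close> applies.\<close>

lemma norm_add_powr_le_small: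
  fixes x y :: "'a::real_inner"
  assumes p: "2 \<le> p" and xy: "2 * p * norm y \<le> norm x"
  shows "norm (x + y) powr p \<le> norm x powr p + p * norm x powr (p - 2) * (x \<bullet> y)
    + 3 * p\<^sup>2 * norm x powr (p - 2) * (norm y)\<^sup>2"
proof (cases "x = 0")
  case True
  then show ?thesis using xy p by (simp add: mult_le_0_iff)
next
  case False
  then have X: "0 < norm x" by simp
  define \<epsilon> where "\<epsilon> = norm y / norm x"
  define t where "t = (2 * (x \<bullet> y) + (norm y)\<^sup>2) / (norm x)\<^sup>2"
  have e0: "0 \<le> \<epsilon>" by (simp add: \<epsilon>_def)
  have e1: "\<epsilon> \<le> 1 / (2 * p)" using xy X p by (simp add: \<epsilon>_def field_simps)
  have e14: "\<epsilon> \<le> 1/4" using e1 p by (smt (verit) frac_le)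
  have ny: "norm y = \<epsilon> * norm x" using X by (simp add: \<epsilon>_def)
  have cs: "\<bar>x \<bullet> y\<bar> \<le> \<epsilon> * (norm x)\<^sup>2"
    using Cauchy_Schwarz_ineq2[of x y] by (simp add: ny power2_eq_square algebra_simps)
  have t_eq: "t = 2 * (x \<bullet> y) / (norm x)\<^sup>2 + \<epsilon>\<^sup>2"
    using X by (simp add: t_def ny add_divide_distrib power_mult_distrib)
  have "\<bar>2 * (x \<bullet> y) / (norm x)\<^sup>2\<bar> \<le> 2 * \<epsilon>"
    using cs X by (simp add: field_simps)
  moreover have "\<epsilon>\<^sup>2 \<le> \<epsilon> * (1/4)" unfolding power2_eq_square using e14 e0 by (intro mult_left_mono)
  \<comment> \<open>The factor 9/4 is 2 from the inner product plus 1/4 from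
    \<open>\<epsilon>\<^sup>2 \<le> \<epsilon> / 4\<close>.\<close>
  ultimately have t: "\<bar>t\<bar> \<le> 9/4 * \<epsilon>" unfolding t_eq using e0 zero_le_power2[of \<epsilon>]
    by linarith
  have u1: "\<bar>p / 2 * t\<bar> \<le> p / 2 * (9/4 * \<epsilon>)"
    using t p by (simp add: abs_mult)
  also have "\<dots> \<le> p / 2 * (9/4 * (1 / (2 * p)))"
    using e1 p by (intro mult_left_mono) auto
  also have "\<dots> \<le> 1" using p by simp
  finally have u: "\<bar>p / 2 * t\<bar> \<le> 1" .
  have t1: "0 < 1 + t" using t e14 by linarith
  have sq: "(norm (x + y))\<^sup>2 = (norm x)\<^sup>2 * (1 + t)"
    using X by (simp add: t_def power2_norm_eq_inner inner_add inner_commute field_simps)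
  have "norm (x + y) = norm x * sqrt (1 + t)"
    using sq X t1 by (metis norm_ge_zero real_sqrt_mult real_sqrt_unique)
  then have "norm (x + y) powr p = norm x powr p * (1 + t) powr (p / 2)"
    using X t1 by (simp add: powr_mult powr_half_sqrt[symmetric] powr_powr)
  also have "\<dots> \<le> norm x powr p * (1 + p / 2 * t + (p / 2 * (9/4 * \<epsilon>))\<^sup>2)"
  proof (rule mult_left_mono)
    have "(1 + t) powr (p / 2) \<le> exp (p / 2 * t)"
      using t1 p ln_add_one_self_le_self2[of t] by (simp add: powr_def)
    also have "\<dots> \<le> 1 + p / 2 * t + (p / 2 * t)\<^sup>2"
      by (rule exp_le_quadratic[OF u])
    also have "(p / 2 * t)\<^sup>2 \<le> (p / 2 * (9/4 * \<epsilon>))\<^sup>2"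
      using power_mono[OF u1 abs_ge_zero, of 2] by (simp only: power2_abs)
    finally show "(1 + t) powr (p / 2) \<le> 1 + p / 2 * t + (p / 2 * (9/4 * \<epsilon>))\<^sup>2"
      by simp
  qed simp
  \<comment> \<open>The linear part of \<open>t\<close> yields the term in
    \<open>x \<bullet> y\<close>. The square of \<open>y\<close> appears twice: with
    \<open>p / 2\<close> from \<open>t\<close> itself, and with 81/64 times \<open>p\<^sup>2\<close>
    from the quadratic remainder.\<close>
  also have "norm x powr p * (1 + p / 2 * t + (p / 2 * (9/4 * \<epsilon>))\<^sup>2)
     = norm x powr p + p * norm x powr (p - 2) * (x \<bullet> y)
       + (p / 2 + p\<^sup>2 * (81/64)) * norm x powr (p - 2) * (norm y)\<^sup>2"
  proof -
    have "norm x powr p = norm x powr (p - 2) * (norm x)\<^sup>2"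
      using X by (simp add: powr_diff)
    then show ?thesis using X
      by (simp add: t_def ny power_mult_distrib field_simps)
  qed
  also have "\<dots> \<le> norm x powr p + p * norm x powr (p - 2) * (x \<bullet> y)
       + 3 * p\<^sup>2 * norm x powr (p - 2) * (norm y)\<^sup>2"
  proof -
    have "p * 1 \<le> p * p" using p by (intro mult_left_mono) auto
    moreover have "0 \<le> p * p" by simp
    ultimately have "p / 2 + p\<^sup>2 * (81/64) \<le> 3 * p\<^sup>2" unfolding power2_eq_square by linarith
    then show ?thesis by (intro add_left_mono mult_right_mono) auto
  qed
  finally show ?thesis .
qed

text \<open>If \<open>y\<close> is not small against \<open>x\<close>, no expansion is required,
  since every term is at most a constant times \<open>norm y powr p\<close>. The three summands of
  \<open>C\<close> pay for the expansion with small \<open>y\<close>, for the size of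
  \<open>x + y\<close>, and for the linear term, which may be negative.\<close>

lemma norm_add_powr_le:
  fixes p :: real
  assumes p: "2 \<le> p"
  obtains C where "0 < C"
    and "\<And>x y :: 'a::real_inner. norm (x + y) powr p \<le> norm x powr p
      + p * norm x powr (p - 2) * (x \<bullet> y) + C * (norm x powr (p - 2) * (norm y)\<^sup>2 + norm y powr p)"
proof -
  define C where "C = 3 * p\<^sup>2 + (2 * p + 1) powr p + p * (2 * p) powr (p - 1)"
  have C: "0 < C" using p by (auto simp: C_def intro!: add_pos_nonneg)
  have "norm (x + y) powr p \<le> norm x powr p
      + p * norm x powr (p - 2) * (x \<bullet> y) + C * (norm x powr (p - 2) * (norm y)\<^sup>2 + norm y powr p)"
    for x y :: 'a
  proof (cases "2 * p * norm y \<le> norm x")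
    case True
    have "3 * p\<^sup>2 * norm x powr (p - 2) * (norm y)\<^sup>2
      \<le> C * (norm x powr (p - 2) * (norm y)\<^sup>2)"
      unfolding mult.assoc[symmetric, of C] mult.assoc[symmetric, of "3 * p\<^sup>2"]
      using p by (intro mult_right_mono) (auto simp: C_def)
    also have "\<dots> \<le> C * (norm x powr (p - 2) * (norm y)\<^sup>2 + norm y powr p)"
      using C by (intro mult_left_mono) auto
    finally show ?thesis using norm_add_powr_le_small[OF p True] by linarith
  next
    case False
    then have xy: "norm x \<le> 2 * p * norm y" by simp
    have y: "0 < norm y" using False by auto
    have "norm (x + y) \<le> (2 * p + 1) * norm y"
      using norm_triangle_ineq[of x y] xy by (simp add: algebra_simps)
    then have 1: "norm (x + y) powr p \<le> (2 * p + 1) powr p * norm y powr p"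
      using p by (subst powr_mult[symmetric]) (auto intro: powr_mono2)
    have 2: "- (norm x powr (p - 2) * (x \<bullet> y)) \<le> (2 * p) powr (p - 1) * norm y powr p"
    proof (cases "x = 0")
      case False
      have "- (norm x powr (p - 2) * (x \<bullet> y)) \<le> norm x powr (p - 2) * (norm x * norm y)"
        using Cauchy_Schwarz_ineq2[of x y] mult_left_mono[of "- (x \<bullet> y)" "norm x * norm y" "norm x powr (p - 2)"]
        by simp
      also have "\<dots> = norm x powr (p - 1) * norm y"
        using False by (simp add: powr_diff field_simps power2_eq_square)
      also have "\<dots> \<le> (2 * p * norm y) powr (p - 1) * norm y"
        using xy p by (intro mult_right_mono powr_mono2) auto
      also have "\<dots> = (2 * p) powr (p - 1) * norm y powr p"
        using y p by (simp add: powr_mult powr_diff)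
      finally show ?thesis .
    qed simp
    have "norm (x + y) powr p \<le> ((2 * p + 1) powr p + p * (2 * p) powr (p - 1)) * norm y powr p
        + p * norm x powr (p - 2) * (x \<bullet> y)"
      using 1 mult_left_mono[OF 2, of p] p by (simp add: algebra_simps)
    also have "((2 * p + 1) powr p + p * (2 * p) powr (p - 1)) * norm y powr p \<le> C * norm y powr p"
      by (intro mult_right_mono) (auto simp: C_def)
    also have "C * norm y powr p \<le> norm x powr p
      + C * (norm x powr (p - 2) * (norm y)\<^sup>2 + norm y powr p)"
      using C by (simp add: distrib_left)
    finally show ?thesis by simp
  qed
  with C show thesis by (rule that)
qed

section \<open>Calculus of bounds for p-th moments\<close>

text \<open>Integrability is part of the predicate because the Bochner integral of a non-integrable
  function is 0, so the inequality alone would not bound anything.\<close>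

definition Lp_le :: "'w measure \<Rightarrow> real \<Rightarrow> ('w \<Rightarrow> 'b::euclidean_space) \<Rightarrow> real \<Rightarrow> bool" where
  "Lp_le M p U u \<longleftrightarrow> U \<in> borel_measurable M \<and> integrable M (\<lambda>w. norm (U w) powr p) \<and>
     (\<integral>w. norm (U w) powr p \<partial>M) \<le> u powr p"

lemma Lp_leD:
  assumes "Lp_le M p U u"
  shows "U \<in> borel_measurable M" "integrable M (\<lambda>w. norm (U w) powr p)"
    "(\<integral>w. norm (U w) powr p \<partial>M) \<le> u powr p"
  using assms by (auto simp: Lp_le_def)

lemma Lp_le_bound:
  assumes U: "Lp_le M p U u" and V: "V \<in> borel_measurable M" and p: "0 \<le> p" and c: "0 \<le> c" "0 \<le> u"
    and le: "AE w in M. norm (V w) \<le> c * norm (U w)" and v: "c * u \<le> v"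
  shows "Lp_le M p V v"
proof -
  note U' = Lp_leD[OF U]
  have [measurable]: "U \<in> borel_measurable M" "V \<in> borel_measurable M" by fact+
  have le': "AE w in M. norm (V w) powr p \<le> c powr p * norm (U w) powr p"
    using le
  proof eventually_elim
    case (elim w)
    then have "norm (V w) powr p \<le> (c * norm (U w)) powr p"
      using p by (intro powr_mono2) auto
    then show ?case using c by (simp add: powr_mult)
  qed
  have i: "integrable M (\<lambda>w. c powr p * norm (U w) powr p)" using U'(2) by simp
  have iV: "integrable M (\<lambda>w. norm (V w) powr p)"
    by (rule Bochner_Integration.integrable_bound[OF i]) (use le' in auto)
  have "(\<integral>w. norm (V w) powr p \<partial>M) \<le> (\<integral>w. c powr p * norm (U w) powr p \<partial>M)"
    by (rule integral_mono_AE[OF iV i le'])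
  also have "\<dots> \<le> c powr p * u powr p" using U'(3) by (simp add: mult_left_mono)
  also have "\<dots> \<le> v powr p" using c v p by (simp add: powr_mult[symmetric] powr_mono2)
  finally show ?thesis using iV by (simp add: Lp_le_def)
qed

lemma Lp_le_mono:
  assumes "Lp_le M p U u" "0 \<le> p" "0 \<le> u" "u \<le> v"
  shows "Lp_le M p U v"
  using Lp_le_bound[OF assms(1) Lp_leD(1)[OF assms(1)], of 1] assms by simp

lemma Lp_le_cong_AE:
  assumes U: "Lp_le M p U u" and "V \<in> borel_measurable M" "AE w in M. V w = U w"
  shows "Lp_le M p V u"
proof -
  have [measurable]: "U \<in> borel_measurable M" "V \<in> borel_measurable M"
    using assms Lp_leD by auto
  have ae: "AE w in M. norm (U w) powr p = norm (V w) powr p"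
    using assms(3) by eventually_elim simp
  have "integrable M (\<lambda>w. norm (V w) powr p)"
    by (rule integrable_cong_AE_imp[OF Lp_leD(2)[OF U]]) (use ae in auto)
  moreover have "(\<integral>w. norm (V w) powr p \<partial>M) = (\<integral>w. norm (U w) powr p \<partial>M)"
    by (rule integral_cong_AE) (use ae in auto)
  ultimately show ?thesis using Lp_leD(3)[OF U] by (simp add: Lp_le_def)
qed

lemma (in prob_space) Lp_le_const:
  assumes "norm c \<le> u" "0 \<le> p"
  shows "Lp_le M p (\<lambda>_. c) u"
  using assms by (simp add: Lp_le_def prob_space powr_mono2)

text \<open>Convexity on the open half line covers positive arguments. If one argument is 0, the
  claim reduces to r^p \<le> r for r in [0, 1].\<close>

lemma powr_convex_two:
  fixes s t x y p :: real
  assumes "1 \<le> p" "0 \<le> s" "0 \<le> t" "s + t = 1" "0 \<le> x" "0 \<le> y"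
  shows "(s * x + t * y) powr p \<le> s * x powr p + t * y powr p"
proof (cases "x = 0 \<or> y = 0")
  case False
  have "convex_on {0<..} (\<lambda>x::real. x powr p)"
    using assms by (intro powr_convex)
  from convex_onD[OF this, of t x y] show ?thesis
    using assms False by (simp add: eq_diff_eq[symmetric])
next
  case True
  have *: "(r * z) powr p \<le> r * z powr p" if "0 \<le> r" "r \<le> 1" "0 \<le> z" for r z :: real
  proof -
    have "r powr p \<le> r powr 1" using that assms by (intro powr_mono') auto
    then show ?thesis using that by (simp add: powr_mult mult_right_mono)
  qed
  from True show ?thesis
  proof
    assume "x = 0"
    then show ?thesis using *[of t y] assms by simp
  next
    assume "y = 0"
    then show ?thesis using *[of s x] assms by simp
  qed
qed

lemma powr_ge_tangent:
  fixes a y r :: real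
  assumes a: "0 < a" "a \<le> y" and r: "1 \<le> r"
  shows "a powr r + r * a powr (r - 1) * (y - a) \<le> y powr r"
proof (cases "a = y")
  case False
  have "\<exists>z. a < z \<and> z < y \<and> y powr r - a powr r = (y - a) * (r * z powr (r - 1))"
    using a False by (intro MVT2) (auto intro!: derivative_eq_intros simp: powr_diff)
  then obtain z where z: "a < z" "y powr r - a powr r = (y - a) * (r * z powr (r - 1))" by blast
  have "(y - a) * (r * a powr (r - 1)) \<le> (y - a) * (r * z powr (r - 1))"
    using a r z by (intro mult_left_mono powr_mono2) auto
  then show ?thesis using z(2) by (simp add: algebra_simps)
qed simp

text \<open>Minkowski's inequality by convexity: \<open>U + V\<close> is \<open>u + v\<close> times
  the convex combination of \<open>U / u\<close> and \<open>V / v\<close> with weights proportional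
  to \<open>u\<close> and \<open>v\<close>. The division is the reason for asking positive
  bounds.\<close>

lemma Lp_le_add:
  assumes U: "Lp_le M p U u" and V: "Lp_le M p V v" and p: "1 \<le> p" and uv: "0 < u" "0 < v"
  shows "Lp_le M p (\<lambda>w. U w + V w) (u + v)"
proof -
  note U' = Lp_leD[OF U] and V' = Lp_leD[OF V]
  have [measurable]: "U \<in> borel_measurable M" "V \<in> borel_measurable M" by fact+
  define s where "s = u / (u + v)"
  define t where "t = v / (u + v)"
  have st: "0 \<le> s" "0 \<le> t" "s + t = 1" using uv by (auto simp: s_def t_def add_divide_distrib[symmetric])
  define F where "F w = (u + v) powr p * (s / u powr p * norm (U w) powr p + t / v powr p * norm (V w) powr p)" for w
  have le: "norm (U w + V w) powr p \<le> F w" for w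
  proof -
    have "norm (U w + V w) \<le> (u + v) * (s * (norm (U w) / u) + t * (norm (V w) / v))"
    proof -
      have "(u + v) * (s * (norm (U w) / u) + t * (norm (V w) / v)) = norm (U w) + norm (V w)"
        using uv by (simp add: s_def t_def distrib_left)
      then show ?thesis using norm_triangle_ineq[of "U w" "V w"] by simp
    qed
    then have "norm (U w + V w) powr p \<le> ((u + v) * (s * (norm (U w) / u) + t * (norm (V w) / v))) powr p"
      using p by (intro powr_mono2) auto
    also have "\<dots> = (u + v) powr p * (s * (norm (U w) / u) + t * (norm (V w) / v)) powr p"
      using uv st by (simp add: powr_mult)
    also have "\<dots> \<le> (u + v) powr p * (s * (norm (U w) / u) powr p + t * (norm (V w) / v) powr p)"
      using p st uv by (intro mult_left_mono powr_convex_two) auto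
    also have "\<dots> = F w" using uv by (simp add: F_def powr_divide)
    finally show ?thesis .
  qed
  have iF: "integrable M F" unfolding F_def
    by (intro integrable_mult_right Bochner_Integration.integrable_add U'(2) V'(2))
  have iS: "integrable M (\<lambda>w. norm (U w + V w) powr p)"
    by (rule Bochner_Integration.integrable_bound[OF iF])
      (use le in \<open>auto intro!: AE_I2 order_trans[OF _ abs_ge_self]\<close>)
  have "(\<integral>w. norm (U w + V w) powr p \<partial>M) \<le> (\<integral>w. F w \<partial>M)"
    by (rule integral_mono[OF iS iF le])
  also have "\<dots> = (u + v) powr p * (s / u powr p * (\<integral>w. norm (U w) powr p \<partial>M)
      + t / v powr p * (\<integral>w. norm (V w) powr p \<partial>M))"
    unfolding F_def using U'(2) V'(2) by simp
  also have "\<dots> \<le> (u + v) powr p * (s / u powr p * u powr p + t / v powr p * v powr p)"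
    using U'(3) V'(3) st by (intro mult_left_mono add_mono) auto
  also have "\<dots> = (u + v) powr p" using uv st by simp
  finally show ?thesis using iS by (simp add: Lp_le_def)
qed

text \<open>The slack \<open>e\<close> is the bound of the empty sum, which has to be positive for
  the additions that follow.\<close>

lemma (in prob_space) Lp_le_sum:
  assumes "finite I" "\<And>i. i \<in> I \<Longrightarrow> Lp_le M p (U i) (u i)" "1 \<le> p" "\<And>i. i \<in> I \<Longrightarrow> 0 < u i"
    and "0 < e"
  shows "Lp_le M p (\<lambda>w. \<Sum>i\<in>I. U i w) (e + (\<Sum>i\<in>I. u i))"
  using assms(1,2,4)
proof (induction I rule: finite_induct)
  case empty
  show ?case using assms(3,5) Lp_le_const[of 0 e p] by simp
next
  case (insert i I)
  have "Lp_le M p (\<lambda>w. U i w + (\<Sum>i\<in>I. U i w)) (u i + (e + (\<Sum>i\<in>I. u i)))"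
  proof (rule Lp_le_add)
    have "0 \<le> sum u I" using insert by (intro sum_nonneg less_imp_le) auto
    then show "0 < e + sum u I" using assms(5) by linarith
  qed (use insert assms(3) in auto)
  then show ?case using insert by (simp add: algebra_simps)
qed

lemma (in prob_space) Lp_le_integrable:
  assumes U: "Lp_le M p U u" and p: "1 \<le> p"
  shows "integrable M U"
proof -
  have [measurable]: "U \<in> borel_measurable M" using Lp_leD(1)[OF U] .
  have i: "integrable M (\<lambda>w. 1 + norm (U w) powr p)" using Lp_leD(2)[OF U] by simp
  have "norm (U w) \<le> norm (1 + norm (U w) powr p)" for w
  proof (cases "norm (U w) \<le> 1")
    case False
    then have "norm (U w) powr 1 \<le> norm (U w) powr p" using p by (intro powr_mono) auto
    then show ?thesis by simp
  qed (simp add: add_increasing2)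
  then show ?thesis by (intro Bochner_Integration.integrable_bound[OF i]) auto
qed

text \<open>Stands in for the Hoelder inequality: it is applied to functions normalised in \<open>L\<^sup>p\<close>.\<close>

lemma powr_mult_powr_le_add:
  fixes u v :: real
  assumes "0 \<le> u" "0 \<le> v" "0 \<le> s" "0 \<le> t"
  shows "u powr s * v powr t \<le> u powr (s + t) + v powr (s + t)"
proof (cases "u \<le> v")
  case True
  then have "u powr s * v powr t \<le> v powr s * v powr t"
    using assms by (intro mult_right_mono powr_mono2) auto
  then show ?thesis by (simp add: powr_add add_increasing)
next
  case False
  then have "u powr s * v powr t \<le> u powr s * u powr t"
    using assms by (intro mult_left_mono powr_mono2) auto
  then show ?thesis by (simp add: powr_add add_increasing2)
qed

text \<open>This is the average of two lower bounds, the tangent at \<open>a\<close> and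
  superadditivity. Both parts are used later: the first absorbs a mixed term of V and D, the second
  a pure power of D.\<close>

lemma powr_add_ge_half:
  fixes a c r :: real
  assumes a: "0 < a" and c: "0 \<le> c" and r: "1 \<le> r"
  shows "a powr r + r / 2 * a powr (r - 1) * c + 1 / 2 * c powr r \<le> (a + c) powr r"
proof -
  have 1: "a powr r + r * a powr (r - 1) * c \<le> (a + c) powr r"
    using powr_ge_tangent[of a "a + c" r] a c r by simp
  have 2: "a powr r + c powr r \<le> (a + c) powr r"
  proof -
    have "a powr r \<le> a * (a + c) powr (r - 1)"
      using a c r powr_mono2[of "r - 1" a "a + c"] mult_left_mono[of "a powr (r-1)" "(a+c) powr (r-1)" a]
      by (simp add: powr_diff)
    moreover have "c powr r \<le> c * (a + c) powr (r - 1)"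
    proof (cases "c = 0")
      case False
      then show ?thesis using a c r powr_mono2[of "r - 1" c "a + c"]
          mult_left_mono[of "c powr (r-1)" "(a+c) powr (r-1)" c] by (simp add: powr_diff)
    qed simp
    moreover have "(a + c) powr r = a * (a + c) powr (r - 1) + c * (a + c) powr (r - 1)"
      using a c by (simp add: powr_diff add_divide_distrib[symmetric] distrib_right[symmetric])
    ultimately show ?thesis by simp
  qed
  from 1 2 show ?thesis by (simp add: field_simps)
qed

text \<open>That a Bochner integral is 0 expresses orthogonality only if the integrand is
  integrable. Cauchy-Schwarz leaves exponents \<open>p - 1\<close> and 1, whose product is dominated
  by the sum of the p-th powers.\<close>

lemma Lp_le_orthogonal_integrable:
  assumes V: "Lp_le M p V m" and D: "Lp_le M p D d" and p: "2 \<le> p"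
  shows "integrable M (\<lambda>w. norm (V w) powr (p - 2) * (V w \<bullet> D w))"
proof -
  have [measurable]: "V \<in> borel_measurable M" "D \<in> borel_measurable M" using V D Lp_leD by auto
  have i: "integrable M (\<lambda>w. norm (V w) powr p + norm (D w) powr p)"
    using Lp_leD(2)[OF V] Lp_leD(2)[OF D] by simp
  have "\<bar>norm (V w) powr (p - 2) * (V w \<bullet> D w)\<bar> \<le> norm (V w) powr p + norm (D w) powr p" for w
  proof -
    have "\<bar>norm (V w) powr (p - 2) * (V w \<bullet> D w)\<bar> \<le> norm (V w) powr (p - 2) * (norm (V w) * norm (D w))"
      by (simp add: abs_mult mult_left_mono Cauchy_Schwarz_ineq2)
    also have "\<dots> = norm (V w) powr (p - 1) * norm (D w) powr 1"
      by (simp add: powr_diff power2_eq_square divide_simps)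
    also have "\<dots> \<le> norm (V w) powr p + norm (D w) powr p"
      using powr_mult_powr_le_add[of "norm (V w)" "norm (D w)" "p - 1" 1] p by simp
    finally show ?thesis .
  qed
  then show ?thesis by (intro Bochner_Integration.integrable_bound[OF i]) (auto intro!: AE_I2 order_trans[OF _ abs_ge_self])
qed

text \<open>A weak form of the 2-uniform smoothness of \<open>L\<^sup>p\<close>. Iterated over the
  increments of a martingale it replaces the Burkholder inequality.\<close>

lemma Lp_le_orthogonal_add:
  assumes p: "2 \<le> p"
  obtains K where "0 < K"
    and "\<And>(M :: 'w measure) (V :: 'w \<Rightarrow> 'b::euclidean_space) D m d. \<lbrakk>Lp_le M p V m; Lp_le M p D d; 0 < m; 0 < d;
      (\<integral>w. norm (V w) powr (p - 2) * (V w \<bullet> D w) \<partial>M) = 0\<rbrakk>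
      \<Longrightarrow> Lp_le M p (\<lambda>w. V w + D w) (sqrt (m\<^sup>2 + K * d\<^sup>2))"
proof -
  obtain C where C: "0 < C"
    and ineq: "\<And>x y :: 'b. norm (x + y) powr p \<le> norm x powr p
      + p * norm x powr (p - 2) * (x \<bullet> y) + C * (norm x powr (p - 2) * (norm y)\<^sup>2 + norm y powr p)"
    using norm_add_powr_le[OF p] by blast
  \<comment> \<open>\<open>4 * C \<le> K\<close> makes the coefficient \<open>p / 4 * K\<close> of
    the mixed term at least \<open>2 * C\<close>. \<open>1 \<le> K\<close> gives
    \<open>K \<le> K powr (p / 2)\<close>, which then covers the pure power of
    \<open>D\<close>.\<close>
  define K where "K = max 1 (4 * C)"
  have K: "0 < K" "1 \<le> K" "4 * C \<le> K" by (auto simp: K_def)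
  have "Lp_le M p (\<lambda>w. V w + D w) (sqrt (m\<^sup>2 + K * d\<^sup>2))"
    if V: "Lp_le M p V m" and D: "Lp_le M p D d" and m: "0 < m" and d: "0 < d"
      and orth: "(\<integral>w. norm (V w) powr (p - 2) * (V w \<bullet> D w) \<partial>M) = 0"
    for M :: "'w measure" and V D :: "'w \<Rightarrow> 'b" and m d
  proof -
    have [measurable]: "V \<in> borel_measurable M" "D \<in> borel_measurable M" using V D Lp_leD by auto
    note V' = Lp_leD[OF V] and D' = Lp_leD[OF D]
    \<comment> \<open>After division by \<open>m\<close> and \<open>d\<close> both functions have
      p-th moment at most 1, so the mixed term costs at most
      \<open>2 * m powr (p - 2) * d\<^sup>2\<close> in expectation.\<close>
    define E where "E w = m powr (p - 2) * d\<^sup>2 * (norm (V w) powr p / m powr p + norm (D w) powr p / d powr p)" for w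
    have young: "norm (V w) powr (p - 2) * (norm (D w))\<^sup>2 \<le> E w" for w
    proof -
      have "(norm (V w) / m) powr (p - 2) * (norm (D w) / d) powr 2
          \<le> (norm (V w) / m) powr p + (norm (D w) / d) powr p"
        using powr_mult_powr_le_add[of "norm (V w) / m" "norm (D w) / d" "p - 2" 2] p m d by simp
      then have "m powr (p - 2) * d\<^sup>2 * ((norm (V w) / m) powr (p - 2) * (norm (D w) / d) powr 2) \<le> E w"
        unfolding E_def using m d by (intro mult_left_mono) (auto simp: powr_divide)
      then show ?thesis using m d by (simp add: powr_divide power_divide)
    qed
    define G where "G w = norm (V w) powr p + p * (norm (V w) powr (p - 2) * (V w \<bullet> D w))
        + C * (E w + norm (D w) powr p)" for w
    have le: "norm (V w + D w) powr p \<le> G w" for w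
    proof -
      have "C * (norm (V w) powr (p - 2) * (norm (D w))\<^sup>2 + norm (D w) powr p) \<le> C * (E w + norm (D w) powr p)"
        using young[of w] C by (intro mult_left_mono add_mono) auto
      then show ?thesis using ineq[of "V w" "D w"] by (simp add: G_def mult.assoc)
    qed
    note iO = Lp_le_orthogonal_integrable[OF V D p]
    have iE: "integrable M E" unfolding E_def using V'(2) D'(2) by simp
    have iG: "integrable M G" unfolding G_def using iO iE V'(2) D'(2) by simp
    have iS: "integrable M (\<lambda>w. norm (V w + D w) powr p)"
      by (rule Bochner_Integration.integrable_bound[OF iG])
        (use le in \<open>auto intro!: AE_I2 order_trans[OF _ abs_ge_self]\<close>)
    have E_le: "(\<integral>w. E w \<partial>M) \<le> m powr (p - 2) * d\<^sup>2 * 2"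
    proof -
      have "(\<integral>w. E w \<partial>M) = m powr (p - 2) * d\<^sup>2 *
          ((\<integral>w. norm (V w) powr p \<partial>M) / m powr p + (\<integral>w. norm (D w) powr p \<partial>M) / d powr p)"
        unfolding E_def using V'(2) D'(2) by simp
      also have "\<dots> \<le> m powr (p - 2) * d\<^sup>2 * (1 + 1)"
        using V'(3) D'(3) m d by (intro mult_left_mono add_mono) auto
      finally show ?thesis by simp
    qed
    have "(\<integral>w. norm (V w + D w) powr p \<partial>M) \<le> (\<integral>w. G w \<partial>M)"
      by (rule integral_mono[OF iS iG le])
    also have "\<dots> = (\<integral>w. norm (V w) powr p \<partial>M) + C * ((\<integral>w. E w \<partial>M) + (\<integral>w. norm (D w) powr p \<partial>M))"
      unfolding G_def using iO iE V'(2) D'(2) orth by simp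
    also have "\<dots> \<le> m powr p + C * (m powr (p - 2) * d\<^sup>2 * 2 + d powr p)"
      using V'(3) D'(3) E_le C by (intro add_mono mult_left_mono) auto
    \<comment> \<open>In terms of the squares and the exponent \<open>p / 2\<close> the right side
      becomes the left side of \<open>powr_add_ge_half\<close>; this produces the sum of squares
      under the root.\<close>
    also have "\<dots> \<le> (m\<^sup>2) powr (p/2) + (p/2) / 2 * (m\<^sup>2) powr (p/2 - 1) * (K * d\<^sup>2) + 1/2 * (K * d\<^sup>2) powr (p/2)"
    proof -
      have e1: "(m\<^sup>2) powr (p/2) = m powr p" "(m\<^sup>2) powr (p/2 - 1) = m powr (p - 2)" "(d\<^sup>2) powr (p/2) = d powr p"
      proof -
        have "x\<^sup>2 = x powr 2" if "0 < x" for x :: real using that by simp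
        then show "(m\<^sup>2) powr (p/2) = m powr p" "(m\<^sup>2) powr (p/2 - 1) = m powr (p - 2)"
          "(d\<^sup>2) powr (p/2) = d powr p"
          using m d by (simp_all only: powr_powr) (simp_all add: right_diff_distrib)
      qed
      have "K powr 1 \<le> K powr (p/2)" using K p by (intro powr_mono) auto
      then have "2 * C \<le> K powr (p/2)" using K C by simp
      then have a: "C * d powr p \<le> 1/2 * (K * d\<^sup>2) powr (p/2)"
        using K d mult_right_mono[of "2 * C" "K powr (p/2)" "d powr p"] by (simp add: powr_mult e1)
      have "2 * C \<le> p/2/2 * K" using K p C mult_mono[of 1 "p/2" "4 * C" K] by simp
      then have "2 * C * (m powr (p - 2) * d\<^sup>2) \<le> p/2/2 * K * (m powr (p - 2) * d\<^sup>2)"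
        by (intro mult_right_mono) auto
      with a show ?thesis by (simp add: e1 algebra_simps)
    qed
    also have "\<dots> \<le> (m\<^sup>2 + K * d\<^sup>2) powr (p/2)"
      using m K p by (intro powr_add_ge_half) auto
    also have "\<dots> = (sqrt (m\<^sup>2 + K * d\<^sup>2)) powr p"
      using K by (simp add: powr_half_sqrt[symmetric] powr_powr)
    finally show ?thesis using iS by (simp add: Lp_le_def)
  qed
  with K(1) show thesis by (rule that)
qed

section \<open>The scalar recursion\<close>

lemma sum_powr_le:
  fixes s :: real
  assumes s: "0 < s"
  obtains R where "0 < R" "\<And>n. (\<Sum>k<n. real (Suc k) powr (s - 1)) \<le> R * real (Suc n) powr s"
proof -
  \<comment> \<open>The sum is compared with the telescoping sum of the increments of x^s. The mean
    value point z lies between x and 2 x, so z^(s-1) is at least x^(s-1) if s \<ge> 1 and at least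
    (2 x)^(s-1) otherwise; the minimum serves both cases.\<close>
  define c where "c = s * min 1 (2 powr (s - 1))"
  have c: "0 < c" using s by (simp add: c_def)
  have diff: "c * real (Suc k) powr (s - 1) \<le> real (Suc (Suc k)) powr s - real (Suc k) powr s" for k
  proof -
    define x where "x = real (Suc k)"
    have x: "1 \<le> x" by (simp add: x_def)
    have "\<exists>z. x < z \<and> z < x + 1 \<and> (x + 1) powr s - x powr s = ((x + 1) - x) * (s * z powr (s - 1))"
      using x by (intro MVT2) (auto intro!: derivative_eq_intros simp: powr_diff)
    then obtain z where z: "x < z" "z < x + 1" "(x + 1) powr s - x powr s = s * z powr (s - 1)" by auto
    have "min 1 (2 powr (s - 1)) * x powr (s - 1) \<le> z powr (s - 1)"
    proof (cases "1 \<le> s")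
      case True
      have "min 1 (2 powr (s - 1)) * x powr (s - 1) \<le> 1 * x powr (s - 1)"
        by (intro mult_right_mono) auto
      also have "\<dots> \<le> z powr (s - 1)" using True z x by (simp add: powr_mono2)
      finally show ?thesis .
    next
      case False
      have "min 1 (2 powr (s - 1)) * x powr (s - 1) \<le> 2 powr (s - 1) * x powr (s - 1)"
        by (intro mult_right_mono) auto
      also have "\<dots> = (2 * x) powr (s - 1)" using x by (simp add: powr_mult)
      also have "\<dots> \<le> z powr (s - 1)" using False z x by (intro powr_mono2') auto
      finally show ?thesis .
    qed
    then have "c * x powr (s - 1) \<le> s * z powr (s - 1)"
      using s by (simp add: c_def mult.assoc mult_left_mono)
    then show ?thesis using z(3) by (simp add: x_def add.commute)
  qed
  have "c * (\<Sum>k<n. real (Suc k) powr (s - 1)) \<le> real (Suc n) powr s" for n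
  proof -
    have "c * (\<Sum>k<n. real (Suc k) powr (s - 1)) \<le> (\<Sum>k<n. real (Suc (Suc k)) powr s - real (Suc k) powr s)"
      unfolding sum_distrib_left by (intro sum_mono diff)
    also have "\<dots> = real (Suc n) powr s - 1"
      by (subst sum_lessThan_telescope[of "\<lambda>k. real (Suc k) powr s"]) simp
    finally show ?thesis by simp
  qed
  then show thesis using c by (intro that[of "1 / c"]) (auto simp: field_simps)
qed

text \<open>The induction treats \<open>Suc n\<close> terms, so that it starts from an equality. Its
  step is the inequality 1/x \<le> ln x - ln (x - 1).\<close>

lemma sum_inverse_le_ln: "(\<Sum>k<n. 1 / real (Suc k)) \<le> 1 + ln (real (Suc n))"
proof -
  have "(\<Sum>k<Suc n. 1 / real (Suc k)) \<le> 1 + ln (real (Suc n))"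
  proof (induction n)
    case (Suc n)
    define x where "x = real (Suc (Suc n))"
    have x: "1 < x" by (simp add: x_def)
    have "ln (1 - 1 / x) \<le> - (1 / x)" using ln_le_minus_one[of "1 - 1 / x"] x by simp
    moreover have "1 - 1 / x = real (Suc n) / x" by (simp add: x_def field_simps)
    ultimately have "1 / x \<le> ln x - ln (real (Suc n))" using x by (simp add: ln_div)
    then show ?case using Suc by (simp add: x_def)
  qed simp
  moreover have "(\<Sum>k<n. 1 / real (Suc k)) \<le> (\<Sum>k<Suc n. 1 / real (Suc k))" by simp
  ultimately show ?thesis by linarith
qed

lemma sum_powr_bounded:
  fixes s :: real
  assumes "1 < s"
  obtains R where "0 < R" "\<And>n. (\<Sum>k<n. real (Suc k) powr (- s)) \<le> R"
proof -
  have sm: "summable (\<lambda>k. real (Suc k) powr (- s))"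
    using summable_real_powr_iff[of "- s"] assms by (subst summable_Suc_iff[of "\<lambda>k. real k powr (- s)"]) simp
  have "(\<Sum>k<n. real (Suc k) powr (- s)) \<le> 1 + (\<Sum>k. real (Suc k) powr (- s))" for n
    using sum_le_suminf[OF sm, of "{..<n}"] by simp
  moreover have "0 < 1 + (\<Sum>k. real (Suc k) powr (- s))"
    using suminf_nonneg[OF sm] by simp
  ultimately show thesis by (intro that) auto
qed

text \<open>To first order in 1/w the modulus depends on \<open>Re z\<close> alone, and there
  \<open>\<alpha> * b / w\<close> agrees with \<alpha> ln (1 + b/w). All second-order errors are
  collected in the exponential, to be summed over w of order n.\<close>

lemma norm_one_plus_div_le:
  fixes z :: complex and w b \<alpha> :: real
  assumes w: "0 < w" and b: "0 < b" and \<alpha>: "0 \<le> \<alpha>" and z: "Re z \<le> \<alpha> * b"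
  shows "norm (1 + z / of_real w) \<le> ((w + b) / w) powr \<alpha> * exp (((norm z)\<^sup>2 / 2 + \<alpha> * b\<^sup>2) / w\<^sup>2)"
proof -
  define u where "u = 2 * \<alpha> * (b / w) + (norm z)\<^sup>2 / w\<^sup>2"
  have "(norm (1 + z / of_real w))\<^sup>2 = 1 + 2 * (Re z / w) + (norm z)\<^sup>2 / w\<^sup>2"
  proof -
    have "1 + z / of_real w = Complex (1 + Re z / w) (Im z / w)" by (simp add: complex_eq_iff)
    then have "(norm (1 + z / of_real w))\<^sup>2 = (1 + Re z / w)\<^sup>2 + (Im z / w)\<^sup>2"
      by (simp add: cmod_power2)
    also have "\<dots> = 1 + 2 * (Re z / w) + (norm z)\<^sup>2 / w\<^sup>2"
      unfolding cmod_power2 by (simp add: power2_sum power_divide add_divide_distrib)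
    finally show ?thesis .
  qed
  also have "\<dots> \<le> 1 + u"
  proof -
    have "Re z / w \<le> \<alpha> * b / w" using z w by (intro divide_right_mono) auto
    then show ?thesis by (simp add: u_def)
  qed
  also have "\<dots> \<le> exp u" by (rule exp_ge_add_one_self)
  also have "\<dots> = (exp (u / 2))\<^sup>2" by (simp add: exp_double[symmetric])
  finally have 1: "norm (1 + z / of_real w) \<le> exp (u / 2)"
    by (rule power2_le_imp_le) simp
  \<comment> \<open>For b/w > 1 the left side is negative and the right side is not.\<close>
  have ln: "b / w - (b / w)\<^sup>2 \<le> ln (1 + b / w)"
  proof (cases "b / w \<le> 1")
    case True
    then show ?thesis using ln_one_plus_pos_lower_bound[of "b / w"] w b by simp
  next
    case False
    then have "b / w * 1 \<le> b / w * (b / w)" using w b by (intro mult_left_mono) auto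
    moreover have "0 \<le> ln (1 + b / w)" using w b by simp
    ultimately show ?thesis by (simp only: power2_eq_square)
  qed
  have "u / 2 \<le> \<alpha> * ln (1 + b / w) + ((norm z)\<^sup>2 / 2 + \<alpha> * b\<^sup>2) / w\<^sup>2"
  proof -
    have "\<alpha> * (b / w) \<le> \<alpha> * ln (1 + b / w) + \<alpha> * (b / w)\<^sup>2"
      using mult_left_mono[OF ln \<alpha>] by (simp add: right_diff_distrib)
    moreover have "u / 2 = \<alpha> * (b / w) + (norm z)\<^sup>2 / 2 / w\<^sup>2" by (simp add: u_def add_divide_distrib)
    ultimately show ?thesis by (simp add: power_divide add_divide_distrib)
  qed
  then have "exp (u / 2) \<le> exp (\<alpha> * ln (1 + b / w)) * exp (((norm z)\<^sup>2 / 2 + \<alpha> * b\<^sup>2) / w\<^sup>2)"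
    by (simp add: exp_add[symmetric])
  also have "exp (\<alpha> * ln (1 + b / w)) = ((w + b) / w) powr \<alpha>"
    using w b by (simp add: powr_def add_divide_distrib) (smt (verit) divide_pos_pos)
  finally show ?thesis using 1 by linarith
qed

text \<open>\<open>h n\<close> is \<open>(w n / w0) powr \<alpha>\<close> times a convergent correction: \<open>1 + b / w\<close> matches \<open>exp (b / w)\<close> up to
  \<open>exp (O(1 / w\<^sup>2))\<close>.\<close>

lemma growth_sequence:
  fixes z :: complex and w0 b \<alpha> :: real
  assumes w0: "0 < w0" and b: "0 < b" and \<alpha>: "0 \<le> \<alpha>" and z: "Re z \<le> \<alpha> * b"
  obtains h :: "nat \<Rightarrow> real" and c1 c2 where "0 < c1" "0 < c2" "h 0 = 1"
    "\<And>n. c1 * real (Suc n) powr \<alpha> \<le> h n" "\<And>n. h n \<le> c2 * real (Suc n) powr \<alpha>"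
    "\<And>n. norm (1 + z / of_real (w0 + real n * b)) \<le> h (Suc n) / h n"
proof -
  define w where "w n = w0 + real n * b" for n :: nat
  have w: "0 < w n" for n using w0 b by (simp add: w_def add_pos_nonneg)
  define c where "c = (norm z)\<^sup>2 / 2 + \<alpha> * b\<^sup>2"
  have c: "0 \<le> c" using \<alpha> by (simp add: c_def)
  \<comment> \<open>Since \<open>w (Suc n) = w n + b\<close>, the quotient
    \<open>h (Suc n) / h n\<close> is exactly the bound of the preceding lemma.\<close>
  define h where "h n = (w n / w0) powr \<alpha> * exp (c * (\<Sum>j<n. 1 / (w j)\<^sup>2))" for n
  have hpos: "0 < h n" for n using w[of n] w0 by (simp add: h_def)
  \<comment> \<open>The minimum and maximum of \<open>w0\<close> and \<open>b\<close> compare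
    \<open>w n\<close> with \<open>Suc n\<close> for all \<open>n\<close>, including 0.\<close>
  define lo where "lo = min w0 b"
  define hi where "hi = max w0 b"
  have lh: "0 < lo" "0 < hi" using w0 b by (auto simp: lo_def hi_def)
  have wlo: "lo * real (Suc n) \<le> w n" for n
  proof -
    have "lo * real n \<le> b * real n" by (intro mult_right_mono) (auto simp: lo_def)
    moreover have "lo \<le> w0" by (simp add: lo_def)
    ultimately show ?thesis by (simp add: w_def algebra_simps)
  qed
  have whi: "w n \<le> hi * real (Suc n)" for n
  proof -
    have "b * real n \<le> hi * real n" by (intro mult_right_mono) (auto simp: hi_def)
    moreover have "w0 \<le> hi" by (simp add: hi_def)
    ultimately show ?thesis by (simp add: w_def algebra_simps)
  qed
  obtain R where R: "0 < R" "\<And>n. (\<Sum>k<n. real (Suc k) powr (- 2)) \<le> R"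
    using sum_powr_bounded[of 2] by auto
  have sum_le: "(\<Sum>j<n. 1 / (w j)\<^sup>2) \<le> R / lo\<^sup>2" for n
  proof -
    have "(\<Sum>j<n. 1 / (w j)\<^sup>2) \<le> (\<Sum>j<n. 1 / lo\<^sup>2 * real (Suc j) powr (- 2))"
    proof (rule sum_mono)
      fix j
      have "(lo * real (Suc j))\<^sup>2 \<le> (w j)\<^sup>2" using wlo[of j] lh by (intro power_mono) auto
      then have "1 / (w j)\<^sup>2 \<le> 1 / (lo * real (Suc j))\<^sup>2"
        using lh by (intro divide_left_mono) (auto intro!: mult_pos_pos simp: w)
      also have "\<dots> = 1 / lo\<^sup>2 * real (Suc j) powr (- 2)"
        by (simp add: powr_minus_divide power_mult_distrib)
      finally show "1 / (w j)\<^sup>2 \<le> 1 / lo\<^sup>2 * real (Suc j) powr (- 2)" .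
    qed
    also have "\<dots> \<le> 1 / lo\<^sup>2 * R"
      unfolding sum_distrib_left[symmetric] using R(2)[of n] by (intro mult_left_mono) auto
    finally show ?thesis by simp
  qed
  show thesis
  proof (rule that[of "(lo / w0) powr \<alpha>" "(hi / w0) powr \<alpha> * exp (c * (R / lo\<^sup>2))" h])
    show "0 < (lo / w0) powr \<alpha>" "0 < (hi / w0) powr \<alpha> * exp (c * (R / lo\<^sup>2))"
      using lh w0 by auto
    show "h 0 = 1" using w0 by (simp add: h_def w_def)
    fix n
    have "(lo / w0) powr \<alpha> * real (Suc n) powr \<alpha> = (lo * real (Suc n) / w0) powr \<alpha>"
      using lh w0 by (simp add: powr_mult[symmetric])
    also have "\<dots> \<le> (w n / w0) powr \<alpha>"
      using wlo[of n] lh w0 \<alpha> by (intro powr_mono2 divide_right_mono) auto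
    also have "\<dots> * 1 \<le> h n"
      unfolding h_def using c by (intro mult_left_mono) (auto intro!: mult_nonneg_nonneg sum_nonneg)
    finally show "(lo / w0) powr \<alpha> * real (Suc n) powr \<alpha> \<le> h n" by simp
    have "h n \<le> (hi * real (Suc n) / w0) powr \<alpha> * exp (c * (R / lo\<^sup>2))"
      unfolding h_def
    proof (rule mult_mono)
      show "(w n / w0) powr \<alpha> \<le> (hi * real (Suc n) / w0) powr \<alpha>"
        using whi[of n] w[of n] w0 \<alpha> by (intro powr_mono2 divide_right_mono) auto
      show "exp (c * (\<Sum>j<n. 1 / (w j)\<^sup>2)) \<le> exp (c * (R / lo\<^sup>2))"
        unfolding exp_le_cancel_iff by (rule mult_left_mono[OF sum_le c])
    qed auto
    also have "(hi * real (Suc n) / w0) powr \<alpha> = (hi / w0) powr \<alpha> * real (Suc n) powr \<alpha>"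
      using lh w0 by (simp add: powr_mult[symmetric])
    finally show "h n \<le> (hi / w0) powr \<alpha> * exp (c * (R / lo\<^sup>2)) * real (Suc n) powr \<alpha>"
      by (simp add: mult_ac)
    have "w (Suc n) = w n + b" by (simp add: w_def algebra_simps)
    then have "h (Suc n) / h n = ((w n + b) / w n) powr \<alpha> * exp (c / (w n)\<^sup>2)"
      using w[of n] w0 b by (simp add: h_def powr_divide exp_add distrib_left)
    then show "norm (1 + z / of_real (w0 + real n * b)) \<le> h (Suc n) / h n"
      using norm_one_plus_div_le[OF w[of n] b \<alpha> z] by (simp add: w_def c_def)
  qed
qed

text \<open>\<open>P n m\<close> is to be read as: the norm of the \<open>n\<close>-th term is at most \<open>m\<close>.\<close>

locale norm_recursion =
  fixes P :: "nat \<Rightarrow> real \<Rightarrow> bool" and z :: complex and w0 b \<kappa> :: real and \<rho> :: "nat \<Rightarrow> real"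
  assumes w0: "0 < w0" and b: "0 < b" and \<kappa>: "0 \<le> \<kappa>" and \<rho>: "\<And>n. 0 < \<rho> n"
    and zero: "\<And>m. 0 < m \<Longrightarrow> P 0 m"
    and mono: "\<And>n m m'. P n m \<Longrightarrow> 0 < m \<Longrightarrow> m \<le> m' \<Longrightarrow> P n m'"
    and step: "\<And>n m. P n m \<Longrightarrow> 0 < m \<Longrightarrow>
      P (Suc n) (sqrt ((norm (1 + z / of_real (w0 + real n * b)) * m + \<rho> n)\<^sup>2 + \<kappa>))"
begin

text \<open>Divided by \<open>h\<close>, the recursion has multiplier at most 1. The forcing
  \<open>\<rho>\<close> then adds up linearly and the noise \<open>\<kappa>\<close> in squares, so
  that 1 plus the sum \<open>S\<close> plus the root of the sum \<open>Q\<close> bounds the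
  quotient. The factor \<open>G\<close> is a common majorant of the three parts.\<close>

lemma growth:
  fixes \<alpha> R :: real and G :: "nat \<Rightarrow> real"
  assumes \<alpha>: "0 \<le> \<alpha>" and z: "Re z \<le> \<alpha> * b" and R: "0 < R"
    and G: "\<And>n. (\<Sum>k<n. \<rho> k / real (Suc k) powr \<alpha>) \<le> R * G n"
      "\<And>n. sqrt (\<Sum>k<n. real (Suc k) powr (- 2 * \<alpha>)) \<le> R * G n" "\<And>n. 1 \<le> R * G n"
  shows "\<exists>C>0. \<forall>n. P n (C * (real (Suc n) powr \<alpha> * G n))"
proof -
  obtain h :: "nat \<Rightarrow> real" and c1 c2 where c: "0 < c1" "0 < c2" and h0: "h 0 = 1"
    and lo: "\<And>n. c1 * real (Suc n) powr \<alpha> \<le> h n" and hi: "\<And>n. h n \<le> c2 * real (Suc n) powr \<alpha>"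
    and ratio: "\<And>n. norm (1 + z / of_real (w0 + real n * b)) \<le> h (Suc n) / h n"
    using growth_sequence[OF w0 b \<alpha> z] by metis
  have hpos: "0 < h n" for n
    using lo[of n] c(1) by (smt (verit) mult_pos_pos powr_gt_zero of_nat_0_less_iff zero_less_Suc)
  define S where "S n = (\<Sum>k<n. \<rho> k / h (Suc k))" for n
  define Q where "Q n = (\<Sum>k<n. \<kappa> / (h (Suc k))\<^sup>2)" for n
  have S: "0 \<le> S n" for n unfolding S_def using \<rho> hpos by (intro sum_nonneg divide_nonneg_nonneg) (auto intro: less_imp_le)
  have Q: "0 \<le> Q n" for n unfolding Q_def using \<kappa> by (intro sum_nonneg) auto
  \<comment> \<open>The summand 1 is a positive starting value: the 0-th term satisfies every
    positive bound.\<close>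
  have main: "P n (h n * (1 + S n + sqrt (Q n)))" for n
  proof (induction n)
    case 0
    show ?case using zero[of 1] by (simp add: h0 S_def Q_def)
  next
    case (Suc n)
    define x where "x = 1 + S n"
    define r where "r = \<rho> n / h (Suc n)"
    define q where "q = \<kappa> / (h (Suc n))\<^sup>2"
    have pos: "0 < x" "0 < r" "0 \<le> q" using S[of n] \<rho>[of n] hpos[of "Suc n"] \<kappa>
      by (auto simp: x_def r_def q_def)
    have m: "0 < h n * (x + sqrt (Q n))" using hpos[of n] pos Q[of n]
      by (intro mult_pos_pos add_pos_nonneg) auto
    have "norm (1 + z / of_real (w0 + real n * b)) * (h n * (x + sqrt (Q n))) + \<rho> n
      \<le> h (Suc n) / h n * (h n * (x + sqrt (Q n))) + \<rho> n"
      using m by (intro add_right_mono mult_right_mono ratio) auto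
    also have "\<dots> = h (Suc n) * (x + r + sqrt (Q n))"
      using hpos[of n] hpos[of "Suc n"] by (simp add: r_def field_simps)
    finally have "(norm (1 + z / of_real (w0 + real n * b)) * (h n * (x + sqrt (Q n))) + \<rho> n)\<^sup>2
        \<le> (h (Suc n) * (x + r + sqrt (Q n)))\<^sup>2"
      using less_imp_le[OF m] \<rho>[of n] by (intro power_mono add_nonneg_nonneg mult_nonneg_nonneg[of "norm _"]) auto
    then have "(norm (1 + z / of_real (w0 + real n * b)) * (h n * (x + sqrt (Q n))) + \<rho> n)\<^sup>2 + \<kappa>
        \<le> (h (Suc n))\<^sup>2 * ((x + r + sqrt (Q n))\<^sup>2 + q)"
      using hpos[of "Suc n"] unfolding power_mult_distrib by (simp add: q_def distrib_left[of "(h (Suc n))\<^sup>2"])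
    \<comment> \<open>Replacing \<open>Q n\<close> by \<open>Q n + q\<close> under the root
      increases the square of the root by exactly \<open>q\<close> and does not decrease the cross
      term.\<close>
    also have "\<dots> \<le> (h (Suc n))\<^sup>2 * (x + r + sqrt (Q n + q))\<^sup>2"
    proof (rule mult_left_mono)
      have "sqrt (Q n) \<le> sqrt (Q n + q)" using pos by simp
      then have "(x + r) * sqrt (Q n) \<le> (x + r) * sqrt (Q n + q)" using pos by (intro mult_left_mono) auto
      then show "(x + r + sqrt (Q n))\<^sup>2 + q \<le> (x + r + sqrt (Q n + q))\<^sup>2"
        using pos Q[of n] by (simp add: power2_sum[of "x + r"])
    qed simp
    also have "\<dots> = (h (Suc n) * (1 + S (Suc n) + sqrt (Q (Suc n))))\<^sup>2"
      by (simp add: S_def Q_def x_def r_def q_def power_mult_distrib add_ac)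
    finally have "sqrt ((norm (1 + z / of_real (w0 + real n * b)) * (h n * (x + sqrt (Q n))) + \<rho> n)\<^sup>2 + \<kappa>)
        \<le> h (Suc n) * (1 + S (Suc n) + sqrt (Q (Suc n)))"
      using hpos[of "Suc n"] S[of "Suc n"] Q[of "Suc n"]
      by (intro real_le_lsqrt) (auto intro!: mult_nonneg_nonneg)
    moreover have "P (Suc n) (sqrt ((norm (1 + z / of_real (w0 + real n * b)) * (h n * (x + sqrt (Q n))) + \<rho> n)\<^sup>2 + \<kappa>))"
      using Suc m by (intro step) (auto simp: x_def)
    moreover have "0 < sqrt ((norm (1 + z / of_real (w0 + real n * b)) * (h n * (x + sqrt (Q n))) + \<rho> n)\<^sup>2 + \<kappa>)"
    proof -
      have "0 < norm (1 + z / of_real (w0 + real n * b)) * (h n * (x + sqrt (Q n))) + \<rho> n"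
        using m \<rho>[of n] by (intro add_nonneg_pos) auto
      then show ?thesis using \<kappa> by (simp add: add_pos_nonneg)
    qed
    ultimately show ?case using mono by blast
  qed
  have hk: "c1 * real (Suc k) powr \<alpha> \<le> h (Suc k)" for k
  proof -
    have "c1 * real (Suc k) powr \<alpha> \<le> c1 * real (Suc (Suc k)) powr \<alpha>"
      using c \<alpha> by (intro mult_left_mono powr_mono2) auto
    also have "\<dots> \<le> h (Suc k)" by (rule lo)
    finally show ?thesis .
  qed
  have S_le: "S n \<le> R / c1 * G n" for n
  proof -
    have "S n \<le> (\<Sum>k<n. 1 / c1 * (\<rho> k / real (Suc k) powr \<alpha>))"
      unfolding S_def
    proof (rule sum_mono)
      fix k
      have "\<rho> k / h (Suc k) \<le> \<rho> k / (c1 * real (Suc k) powr \<alpha>)"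
        using \<rho>[of k] hk[of k] c hpos[of "Suc k"] by (intro divide_left_mono) auto
      then show "\<rho> k / h (Suc k) \<le> 1 / c1 * (\<rho> k / real (Suc k) powr \<alpha>)" by simp
    qed
    also have "\<dots> \<le> 1 / c1 * (R * G n)"
      unfolding sum_distrib_left[symmetric] using c by (intro mult_left_mono G) auto
    finally show ?thesis by simp
  qed
  have Q_le: "sqrt (Q n) \<le> sqrt \<kappa> / c1 * (R * G n)" for n
  proof -
    have "Q n \<le> (\<Sum>k<n. \<kappa> / c1\<^sup>2 * real (Suc k) powr (- 2 * \<alpha>))"
      unfolding Q_def
    proof (rule sum_mono)
      fix k
      have "(c1 * real (Suc k) powr \<alpha>)\<^sup>2 \<le> (h (Suc k))\<^sup>2"
        using hk[of k] c by (intro power_mono) auto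
      then have "\<kappa> / (h (Suc k))\<^sup>2 \<le> \<kappa> / (c1 * real (Suc k) powr \<alpha>)\<^sup>2"
        using \<kappa> c hpos[of "Suc k"] by (intro divide_left_mono) auto
      also have "\<dots> = \<kappa> / c1\<^sup>2 * real (Suc k) powr (- 2 * \<alpha>)"
        by (simp add: power_mult_distrib power2_eq_square powr_add[symmetric] powr_minus_divide)
      finally show "\<kappa> / (h (Suc k))\<^sup>2 \<le> \<kappa> / c1\<^sup>2 * real (Suc k) powr (- 2 * \<alpha>)" .
    qed
    then have "sqrt (Q n) \<le> sqrt (\<kappa> / c1\<^sup>2 * (\<Sum>k<n. real (Suc k) powr (- 2 * \<alpha>)))"
      unfolding sum_distrib_left[symmetric] by simp
    also have "\<dots> = sqrt \<kappa> / c1 * sqrt (\<Sum>k<n. real (Suc k) powr (- 2 * \<alpha>))"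
      using c by (simp add: real_sqrt_mult real_sqrt_divide)
    also have "\<dots> \<le> sqrt \<kappa> / c1 * (R * G n)"
      using c \<kappa> by (intro mult_left_mono G) auto
    finally show ?thesis .
  qed
  have Gpos: "0 < G n" for n using G(3)[of n] R by (smt (verit) mult_nonneg_nonpos)
  define C where "C = c2 * (R + R / c1 + sqrt \<kappa> / c1 * R)"
  have "0 < C" unfolding C_def using c R \<kappa> by (intro mult_pos_pos add_pos_nonneg) auto
  moreover have "P n (C * (real (Suc n) powr \<alpha> * G n))" for n
  proof (rule mono[OF main])
    show "0 < h n * (1 + S n + sqrt (Q n))"
      using hpos[of n] S[of n] Q[of n] by (intro mult_pos_pos add_pos_nonneg) auto
    have "h n * (1 + S n + sqrt (Q n)) \<le> c2 * real (Suc n) powr \<alpha> * (R * G n + R / c1 * G n + sqrt \<kappa> / c1 * (R * G n))"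
      using hi[of n] G(3)[of n] S_le[of n] Q_le[of n] S[of n] Q[of n] c
      by (intro mult_mono add_mono) auto
    also have "\<dots> = C * (real (Suc n) powr \<alpha> * G n)" by (simp add: C_def algebra_simps)
    finally show "h n * (1 + S n + sqrt (Q n)) \<le> C * (real (Suc n) powr \<alpha> * G n)" .
  qed
  ultimately show ?thesis by blast
qed

text \<open>Forcing of order k^(\<gamma>-1), divided by k^\<alpha> with \<alpha> < \<gamma>, has
  partial sums of order n^(\<gamma>-\<alpha>). Multiplying by n^\<alpha> gives n^\<gamma> again, so
  a step up the block costs no logarithm.\<close>

lemma growth_subdominant:
  fixes \<gamma> R :: real
  assumes \<gamma>: "1/2 \<le> \<gamma>" "Re z < \<gamma> * b" and R: "0 < R"
    and \<rho>_le: "\<And>k. \<rho> k \<le> R * real (Suc k) powr (\<gamma> - 1)"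
  shows "\<exists>C>0. \<forall>n. P n (C * real (Suc n) powr \<gamma>)"
proof -
  \<comment> \<open>Eigenvalues with negative real part are treated with exponent 0, as the growth
    estimate requires a nonnegative one.\<close>
  define \<alpha> where "\<alpha> = max 0 (Re z / b)"
  have \<alpha>: "0 \<le> \<alpha>" "\<alpha> < \<gamma>" "Re z \<le> \<alpha> * b"
    using \<gamma> b by (auto simp: \<alpha>_def max_def field_simps)
  define s where "s = \<gamma> - \<alpha>"
  have s: "0 < s" using \<alpha> by (simp add: s_def)
  obtain R1 where R1: "0 < R1" "\<And>n. (\<Sum>k<n. real (Suc k) powr (s - 1)) \<le> R1 * real (Suc n) powr s"
    using sum_powr_le[OF s] by blast
  obtain R2 where R2: "0 < R2" "\<And>n. (\<Sum>k<n. real (Suc k) powr (2 * s - 1)) \<le> R2 * real (Suc n) powr (2 * s)"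
    using sum_powr_le[of "2 * s"] s by auto
  define K where "K = R * R1 + sqrt R2 + 1"
  have K: "0 < K" "R * R1 \<le> K" "sqrt R2 \<le> K" "1 \<le> K"
    using R R1(1) R2(1) by (auto simp: K_def add_nonneg_pos)
  have "\<exists>C>0. \<forall>n. P n (C * (real (Suc n) powr \<alpha> * real (Suc n) powr s))"
  proof (rule growth[OF \<alpha>(1,3) K(1)])
    fix n
    have "(\<Sum>k<n. \<rho> k / real (Suc k) powr \<alpha>) \<le> (\<Sum>k<n. R * real (Suc k) powr (s - 1))"
    proof (rule sum_mono)
      fix k
      have "\<rho> k / real (Suc k) powr \<alpha> \<le> R * real (Suc k) powr (\<gamma> - 1) / real (Suc k) powr \<alpha>"
        using \<rho>_le by (intro divide_right_mono) auto
      also have "\<dots> = R * real (Suc k) powr (s - 1)"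
        by (simp only: times_divide_eq_right[symmetric] powr_diff[symmetric]) (simp add: s_def algebra_simps)
      finally show "\<rho> k / real (Suc k) powr \<alpha> \<le> R * real (Suc k) powr (s - 1)" .
    qed
    also have "\<dots> \<le> R * (R1 * real (Suc n) powr s)"
      unfolding sum_distrib_left[symmetric] using R R1(2) by (intro mult_left_mono) auto
    also have "\<dots> \<le> K * real (Suc n) powr s"
      unfolding mult.assoc[symmetric] using K by (intro mult_right_mono) auto
    finally show "(\<Sum>k<n. \<rho> k / real (Suc k) powr \<alpha>) \<le> K * real (Suc n) powr s" .
    \<comment> \<open>The comparison of exponents, \<open>- 2 * \<alpha> \<le> 2 * s - 1\<close>, is
      the hypothesis \<open>1/2 \<le> \<gamma>\<close>: the noise by itself already forces order
      n^(1/2).\<close>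
    have "(\<Sum>k<n. real (Suc k) powr (- 2 * \<alpha>)) \<le> (\<Sum>k<n. real (Suc k) powr (2 * s - 1))"
      using \<gamma> by (intro sum_mono powr_mono) (auto simp: s_def)
    also have "\<dots> \<le> R2 * real (Suc n) powr (2 * s)" by (rule R2(2))
    finally have "sqrt (\<Sum>k<n. real (Suc k) powr (- 2 * \<alpha>)) \<le> sqrt (R2 * real (Suc n) powr (2 * s))"
      by simp
    also have "\<dots> = sqrt R2 * real (Suc n) powr s"
      by (simp add: real_sqrt_mult powr_half_sqrt[symmetric] powr_powr del: of_nat_Suc)
    also have "\<dots> \<le> K * real (Suc n) powr s" using K by (intro mult_right_mono) auto
    finally show "sqrt (\<Sum>k<n. real (Suc k) powr (- 2 * \<alpha>)) \<le> K * real (Suc n) powr s" .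
    have "1 * 1 \<le> K * real (Suc n) powr s"
      using K s by (intro mult_mono ge_one_powr_ge_zero) auto
    then show "1 \<le> K * real (Suc n) powr s" by simp
  qed
  then show ?thesis by (simp add: powr_add[symmetric] s_def)
qed

text \<open>Here the exponent of the result is that of the homogeneous recursion, and only partial
  sums are left. Those of k^(-2\<alpha>) are bounded if \<alpha> > 1/2 and logarithmic if \<alpha> =
  1/2; the root of the latter is the reason for \<open>1/2 \<le> \<eta>\<close>. The base
  \<open>1 + ln (real (Suc n))\<close> is at least 1, so its powers increase with the
  exponent.\<close>

lemma growth_dominant:
  fixes \<alpha> \<eta> R :: real
  assumes \<alpha>: "1/2 \<le> \<alpha>" "Re z \<le> \<alpha> * b" and \<eta>: "0 \<le> \<eta>" "\<alpha> = 1/2 \<Longrightarrow> 1/2 \<le> \<eta>" and R: "0 < R"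
    and \<rho>_le: "\<And>n. (\<Sum>k<n. \<rho> k / real (Suc k) powr \<alpha>) \<le> R * (1 + ln (real (Suc n))) powr \<eta>"
  shows "\<exists>C>0. \<forall>n. P n (C * (real (Suc n) powr \<alpha> * (1 + ln (real (Suc n))) powr \<eta>))"
proof -
  have L: "1 \<le> 1 + ln (real (Suc n))" for n by simp
  have L\<eta>: "1 \<le> (1 + ln (real (Suc n))) powr \<eta>" for n
    using L \<eta>(1) by (intro ge_one_powr_ge_zero) auto
  obtain R2 where R2: "0 < R2"
    "\<And>n. sqrt (\<Sum>k<n. real (Suc k) powr (- 2 * \<alpha>)) \<le> R2 * (1 + ln (real (Suc n))) powr \<eta>"
  proof (cases "\<alpha> = 1/2")
    case True
    have "sqrt (\<Sum>k<n. real (Suc k) powr (- 2 * \<alpha>)) \<le> 1 * (1 + ln (real (Suc n))) powr \<eta>" for n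
    proof -
      have "sqrt (\<Sum>k<n. real (Suc k) powr (- 2 * \<alpha>)) \<le> sqrt (1 + ln (real (Suc n)))"
        using sum_inverse_le_ln[of n] by (simp add: True powr_minus_divide)
      also have "\<dots> = (1 + ln (real (Suc n))) powr (1/2)" by (simp add: powr_half_sqrt)
      also have "\<dots> \<le> (1 + ln (real (Suc n))) powr \<eta>" using \<eta>(2) True L by (intro powr_mono) auto
      finally show ?thesis by simp
    qed
    then show thesis by (intro that[of 1]) auto
  next
    case False
    obtain R' where R': "0 < R'" "\<And>n. (\<Sum>k<n. real (Suc k) powr (- (2 * \<alpha>))) \<le> R'"
      using sum_powr_bounded[of "2 * \<alpha>"] \<alpha>(1) False by auto
    have "sqrt (\<Sum>k<n. real (Suc k) powr (- 2 * \<alpha>)) \<le> sqrt R' * (1 + ln (real (Suc n))) powr \<eta>" for n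
    proof -
      have "sqrt (\<Sum>k<n. real (Suc k) powr (- 2 * \<alpha>)) \<le> sqrt R' * 1" using R'(2)[of n] by simp
      also have "\<dots> \<le> sqrt R' * (1 + ln (real (Suc n))) powr \<eta>" using L\<eta> R' by (intro mult_left_mono) auto
      finally show ?thesis .
    qed
    with R' show thesis by (intro that[of "sqrt R'"]) auto
  qed
  define K where "K = R + R2 + 1"
  have K: "0 < K" "R \<le> K" "R2 \<le> K" "1 \<le> K" using R R2(1) by (auto simp: K_def)
  show ?thesis
  proof (rule growth[OF _ \<alpha>(2) K(1)])
    fix n
    show "(\<Sum>k<n. \<rho> k / real (Suc k) powr \<alpha>) \<le> K * (1 + ln (real (Suc n))) powr \<eta>"
      using \<rho>_le by (rule order_trans) (use K in \<open>intro mult_right_mono, auto\<close>)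
    show "sqrt (\<Sum>k<n. real (Suc k) powr (- 2 * \<alpha>)) \<le> K * (1 + ln (real (Suc n))) powr \<eta>"
      using R2(2) by (rule order_trans) (use K in \<open>intro mult_right_mono, auto\<close>)
    have "1 * 1 \<le> K * (1 + ln (real (Suc n))) powr \<eta>" using K L\<eta> by (intro mult_mono) auto
    then show "1 \<le> K * (1 + ln (real (Suc n))) powr \<eta>" by simp
  qed (use \<alpha> in auto)
qed

text \<open>For the last coordinate of a block. Nothing forces it, but the recursion carries a
  positive forcing term; one of order k^(\<alpha>-2) has a bounded effect because the quotients
  k^(-2) are summable.\<close>

lemma growth_dominant_base:
  fixes \<alpha> \<eta> R :: real
  assumes "1/2 \<le> \<alpha>" "Re z \<le> \<alpha> * b" "0 \<le> \<eta>" "\<alpha> = 1/2 \<Longrightarrow> 1/2 \<le> \<eta>"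
    and \<rho>_le: "\<And>k. \<rho> k \<le> real (Suc k) powr (\<alpha> - 2)"
  shows "\<exists>C>0. \<forall>n. P n (C * (real (Suc n) powr \<alpha> * (1 + ln (real (Suc n))) powr \<eta>))"
proof -
  obtain R where R: "0 < R" "\<And>n. (\<Sum>k<n. real (Suc k) powr (- 2)) \<le> R"
    using sum_powr_bounded[of 2] by auto
  show ?thesis
  proof (rule growth_dominant[OF assms(1-4) R(1)])
    fix n
    have "(\<Sum>k<n. \<rho> k / real (Suc k) powr \<alpha>) \<le> (\<Sum>k<n. real (Suc k) powr (- 2))"
    proof (rule sum_mono)
      fix k
      have "\<rho> k / real (Suc k) powr \<alpha> \<le> real (Suc k) powr (\<alpha> - 2) / real (Suc k) powr \<alpha>"
        using \<rho>_le by (intro divide_right_mono) auto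
      also have "\<dots> = real (Suc k) powr (- 2)" unfolding powr_diff[symmetric] by simp
      finally show "\<rho> k / real (Suc k) powr \<alpha> \<le> real (Suc k) powr (- 2)" .
    qed
    also have "\<dots> \<le> R * 1" using R(2) by simp
    also have "\<dots> \<le> R * (1 + ln (real (Suc n))) powr \<eta>"
      using R assms(3) by (intro mult_left_mono ge_one_powr_ge_zero) auto
    finally show "(\<Sum>k<n. \<rho> k / real (Suc k) powr \<alpha>) \<le> R * (1 + ln (real (Suc n))) powr \<eta>" .
  qed auto
qed

text \<open>Forcing by a coordinate of the same order n^\<alpha> leaves the harmonic series after
  division. Its logarithmic factors are bounded by their final value, and the series supplies one
  more.\<close>

lemma growth_dominant_step:
  fixes \<alpha> \<eta> R :: real
  assumes "1/2 \<le> \<alpha>" "Re z \<le> \<alpha> * b" and \<eta>: "0 \<le> \<eta>" and R: "0 < R"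
    and \<rho>_le: "\<And>k. \<rho> k \<le> R * real (Suc k) powr (\<alpha> - 1) * (1 + ln (real (Suc k))) powr \<eta>"
  shows "\<exists>C>0. \<forall>n. P n (C * (real (Suc n) powr \<alpha> * (1 + ln (real (Suc n))) powr (\<eta> + 1)))"
proof (rule growth_dominant[OF assms(1,2) _ _ R])
  fix n
  have "(\<Sum>k<n. \<rho> k / real (Suc k) powr \<alpha>) \<le> (\<Sum>k<n. R * (1 + ln (real (Suc n))) powr \<eta> * (1 / real (Suc k)))"
  proof (rule sum_mono)
    fix k assume "k \<in> {..<n}"
    then have "(1 + ln (real (Suc k))) powr \<eta> \<le> (1 + ln (real (Suc n))) powr \<eta>"
      using \<eta> by (intro powr_mono2) auto
    then have "\<rho> k \<le> R * real (Suc k) powr (\<alpha> - 1) * (1 + ln (real (Suc n))) powr \<eta>"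
      using R by (intro order_trans[OF \<rho>_le] mult_left_mono) auto
    then have "\<rho> k / real (Suc k) powr \<alpha> \<le> R * real (Suc k) powr (\<alpha> - 1) * (1 + ln (real (Suc n))) powr \<eta> / real (Suc k) powr \<alpha>"
      by (intro divide_right_mono) auto
    also have "\<dots> = R * (1 + ln (real (Suc n))) powr \<eta> * (1 / real (Suc k))"
      by (simp add: powr_diff)
    finally show "\<rho> k / real (Suc k) powr \<alpha> \<le> R * (1 + ln (real (Suc n))) powr \<eta> * (1 / real (Suc k))" .
  qed
  also have "\<dots> \<le> R * (1 + ln (real (Suc n))) powr \<eta> * (1 + ln (real (Suc n)))"
    unfolding sum_distrib_left[symmetric] using R by (intro mult_left_mono sum_inverse_le_ln) auto
  also have "\<dots> = R * (1 + ln (real (Suc n))) powr (\<eta> + 1)"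
    by (simp add: powr_add add_nonneg_eq_0_iff)
  finally show "(\<Sum>k<n. \<rho> k / real (Suc k) powr \<alpha>) \<le> R * (1 + ln (real (Suc n))) powr (\<eta> + 1)" .
qed (use \<eta> in auto)

end

section \<open>Jordan coordinates\<close>

text \<open>Describes the block matrix by two functions of the index: the eigenvalue of the block
  containing it and its distance to the end of that block. The last clause is for comparing the
  number of indices of an eigenvalue with its algebraic multiplicity.\<close>

lemma jordan_matrix_entries:
  fixes n_as :: "(nat \<times> 'a::{zero,one}) list"
  obtains lam :: "nat \<Rightarrow> 'a" and d :: "nat \<Rightarrow> nat" where
    "\<And>i. i < sum_list (map fst n_as) \<Longrightarrow> \<exists>m. (m, lam i) \<in> set n_as \<and> d i < m"
    "\<And>i j. i < sum_list (map fst n_as) \<Longrightarrow> j < sum_list (map fst n_as) \<Longrightarrow>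
      jordan_matrix n_as $$ (i, j) = (if i = j then lam i else if j = Suc i \<and> 0 < d i then 1 else 0)"
    "\<And>i. i < sum_list (map fst n_as) \<Longrightarrow> 0 < d i \<Longrightarrow>
      Suc i < sum_list (map fst n_as) \<and> lam (Suc i) = lam i \<and> d i = Suc (d (Suc i))"
    "\<And>z. card {i. i < sum_list (map fst n_as) \<and> lam i = z} = sum_list (map fst (filter (\<lambda>na. snd na = z) n_as))"
proof -
  let ?N = "\<lambda>n_as. sum_list (map fst n_as)"
  let ?R = "\<lambda>n_as lam d. (\<forall>i < ?N n_as. \<exists>m. (m, lam i) \<in> set n_as \<and> d i < m) \<and>
      (\<forall>i < ?N n_as. \<forall>j < ?N n_as.
        jordan_matrix n_as $$ (i, j) = (if i = j then lam i else if j = Suc i \<and> 0 < d i then 1 else 0)) \<and>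
      (\<forall>i < ?N n_as. 0 < d i \<longrightarrow> Suc i < ?N n_as \<and> lam (Suc i) = lam i \<and> d i = Suc (d (Suc i))) \<and>
      (\<forall>z. card {i. i < ?N n_as \<and> lam i = z} = sum_list (map fst (filter (\<lambda>na. snd na = z) n_as)))"
  have "\<exists>lam d. ?R n_as lam d"
  proof (induction n_as)
    case (Cons na n_as)
    obtain n z where na: "na = (n, z)" by force
    from Cons obtain lam d where R: "?R n_as lam d" by (elim exE)
    have IH: "\<And>i. i < ?N n_as \<Longrightarrow> \<exists>m. (m, lam i) \<in> set n_as \<and> d i < m"
      "\<And>i j. i < ?N n_as \<Longrightarrow> j < ?N n_as \<Longrightarrow>
        jordan_matrix n_as $$ (i, j) = (if i = j then lam i else if j = Suc i \<and> 0 < d i then 1 else 0)"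
      "\<And>i. i < ?N n_as \<Longrightarrow> 0 < d i \<Longrightarrow> Suc i < ?N n_as \<and> lam (Suc i) = lam i \<and> d i = Suc (d (Suc i))"
      "\<And>z. card {i. i < ?N n_as \<and> lam i = z} = sum_list (map fst (filter (\<lambda>na. snd na = z) n_as))"
      using R by simp_all
    define lam' where "lam' i = (if i < n then z else lam (i - n))" for i
    \<comment> \<open>The new block occupies the first \<open>n\<close> indices and ends at
      \<open>n - 1\<close>; the old indices are shifted by \<open>n\<close>.\<close>
    define d' where "d' i = (if i < n then n - Suc i else d (i - n))" for i
    have N: "?N (na # n_as) = n + ?N n_as" by (simp add: na)
    have "\<exists>m. (m, lam' i) \<in> set (na # n_as) \<and> d' i < m" if "i < ?N (na # n_as)" for i
    proof (cases "i < n")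
      case True
      then show ?thesis by (auto simp: lam'_def d'_def na)
    next
      case False
      then have "i - n < ?N n_as" using that N by simp
      from IH(1)[OF this] show ?thesis using False by (auto simp: lam'_def d'_def)
    qed
    moreover have "jordan_matrix (na # n_as) $$ (i, j)
        = (if i = j then lam' i else if j = Suc i \<and> 0 < d' i then 1 else 0)"
      if "i < ?N (na # n_as)" "j < ?N (na # n_as)" for i j
    proof -
      have "jordan_matrix (na # n_as) $$ (i, j) =
        (if i < n then if j < n then jordan_block n z $$ (i, j) else 0
          else if j < n then 0 else jordan_matrix n_as $$ (i - n, j - n))"
        using that unfolding na jordan_matrix_Cons by (subst index_mat_four_block) auto
      also have "\<dots> = (if i = j then lam' i else if j = Suc i \<and> 0 < d' i then 1 else 0)"
      proof (cases "i < n")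
        case True
        then show ?thesis by (auto simp: lam'_def d'_def)
      next
        case False
        show ?thesis
        proof (cases "j < n")
          case True
          then show ?thesis using False by auto
        next
          case jn: False
          have "i - n < ?N n_as" "j - n < ?N n_as" using that N False jn by auto
          moreover have "i - n = j - n \<longleftrightarrow> i = j" "j - n = Suc (i - n) \<longleftrightarrow> j = Suc i"
            using False jn by auto
          ultimately show ?thesis using False jn IH(2)[of "i - n" "j - n"] by (simp add: lam'_def d'_def)
        qed
      qed
      finally show ?thesis .
    qed
    moreover have "Suc i < ?N (na # n_as) \<and> lam' (Suc i) = lam' i \<and> d' i = Suc (d' (Suc i))"
      if "i < ?N (na # n_as)" "0 < d' i" for i
    proof (cases "i < n")
      case True
      then show ?thesis using that N by (auto simp: lam'_def d'_def)
    next
      case False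
      then have "i - n < ?N n_as" "0 < d (i - n)" using that N by (auto simp: d'_def)
      from IH(3)[OF this] False N show ?thesis by (auto simp: lam'_def d'_def Suc_diff_le)
    qed
    moreover have "card {i. i < ?N (na # n_as) \<and> lam' i = y}
        = sum_list (map fst (filter (\<lambda>na. snd na = y) (na # n_as)))" for y
    proof -
      have "{i. i < ?N (na # n_as) \<and> lam' i = y} = (if z = y then {..<n} else {})
          \<union> (\<lambda>i. i + n) ` {i. i < ?N n_as \<and> lam i = y}" (is "?L = ?A \<union> ?B")
      proof (rule subset_antisym; rule subsetI)
        fix i assume i: "i \<in> ?L"
        show "i \<in> ?A \<union> ?B"
        proof (cases "i < n")
          case False
          then have "i = (i - n) + n" "i - n \<in> {i. i < ?N n_as \<and> lam i = y}"
            using i N by (auto simp: lam'_def)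
          then show ?thesis by blast
        qed (use i in \<open>auto simp: lam'_def\<close>)
      qed (auto simp: lam'_def na split: if_splits)
      moreover have "card (?A \<union> ?B) = card ?A + card ?B"
        by (intro card_Un_disjoint) (auto split: if_splits)
      moreover have "card ?B = card {i. i < ?N n_as \<and> lam i = y}"
        by (intro card_image) (auto simp: inj_on_def)
      ultimately show ?thesis using IH(4)[of y] by (simp add: na)
    qed
    ultimately have "?R (na # n_as) lam' d'" by blast
    then show ?case by (intro exI)
  qed simp
  then obtain lam d where R: "?R n_as lam d" by (elim exE)
  show thesis by (rule that[of lam d]) (use R in simp_all)
qed

text \<open>Block sizes are bounded by the order of the root of the characteristic polynomial, so
  the set in \<open>jordan_nu\<close> is finite and its \<open>Max\<close> is a genuine
  maximum.\<close>

lemma jordan_nf_block_le_nu: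
  assumes nf: "jordan_nf A n_as" and m: "(m, z) \<in> set n_as"
  shows "m - 1 \<le> jordan_nu A z"
proof -
  have "finite {n. \<exists>blocks. jordan_nf A blocks \<and> (n, z) \<in> set blocks}"
    by (rule finite_subset[of _ "{..order z (char_poly A)}"])
      (auto dest: jordan_nf_block_size_order_bound)
  then have "m \<le> Max {n. \<exists>blocks. jordan_nf A blocks \<and> (n, z) \<in> set blocks}"
    using nf m by (intro Max_ge) auto
  then show ?thesis by (simp add: jordan_nu_def)
qed

text \<open>The tail is taken by position: a repeated first eigenvalue lies in it and is then
  compared with the second entry like all others.\<close>

lemma eigenvalue_listing_le_second:
  assumes ls: "eigenvalue_listing A ls" and z: "z \<in> set (tl ls)"
  shows "Re z < Re (ls ! 1) \<or> Re z = Re (ls ! 1) \<and> jordan_nu A z \<le> jordan_nu A (ls ! 1)"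
proof -
  obtain m where m: "m < length (tl ls)" "z = tl ls ! m" using z by (auto simp: in_set_conv_nth)
  have sorted: "sorted_wrt (\<lambda>y z. Re z < Re y \<or> Re z = Re y \<and> jordan_nu A z \<le> jordan_nu A y) ls"
    using ls by (simp add: eigenvalue_listing_def)
  have zm: "z = ls ! Suc m" using m by (simp add: nth_tl)
  show ?thesis
  proof (cases m)
    case (Suc k)
    have "Suc 0 < Suc m" "Suc m < length ls" using m Suc by auto
    from sorted_wrt_nth_less[OF sorted this] show ?thesis using zm by simp
  qed (simp add: zm)
qed

definition lin :: "('q::finite \<Rightarrow> complex) \<Rightarrow> real ^ 'q \<Rightarrow> complex" where
  "lin c x = (\<Sum>j\<in>UNIV. c j * of_real (x $ j))"

text \<open>The coordinates of a vector with respect to a Jordan basis of \<open>A\<close>. Here \<open>d i\<close> is the number of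
  coordinates after the \<open>i\<close>-th one in the same Jordan block.\<close>

lemma jordan_coordinates:
  fixes A :: "real ^ 'q ^ 'q::finite" and a :: "real ^ 'q" and b :: real
  assumes ls: "eigenvalue_listing (complex_mat_of A) ls" and ls0: "ls ! 0 = complex_of_real b"
    and a: "a \<noteq> 0" and eigen: "\<And>j. (\<Sum>i\<in>UNIV. a $ i * A $ i $ j) = b * a $ j"
  obtains c :: "nat \<Rightarrow> 'q \<Rightarrow> complex" and lam :: "nat \<Rightarrow> complex" and d :: "nat \<Rightarrow> nat" and K :: real
  where "\<And>i x. i < CARD('q) \<Longrightarrow>
      lin (c i) (A *v x) = lam i * lin (c i) x + (if 0 < d i then lin (c (Suc i)) x else 0)"
    and "\<And>i. i < CARD('q) \<Longrightarrow> 0 < d i \<Longrightarrow> Suc i < CARD('q) \<and> lam (Suc i) = lam i \<and> d i = Suc (d (Suc i))"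
    and "0 < K" and "\<And>x. norm x \<le> (\<Sum>i<CARD('q). K * norm (lin (c i) x))"
    and "\<And>i. i < CARD('q) \<Longrightarrow> (\<exists>r. \<forall>j. c i j = r * of_real (a $ j)) \<or> Re (lam i) < Re (ls ! 1) \<or>
      Re (lam i) = Re (ls ! 1) \<and> d i \<le> jordan_nu (complex_mat_of A) (ls ! 1)"
proof -
  define n where "n = CARD('q)"
  define e :: "nat \<Rightarrow> 'q" where "e = from_nat_into UNIV"
  have e: "bij_betw e {..<n} UNIV"
    unfolding e_def n_def by (rule bij_betw_from_nat_into_finite) simp
  have sum_e: "(\<Sum>j\<in>UNIV. f j) = (\<Sum>j<n. f (e j))" for f :: "'q \<Rightarrow> 'c::comm_monoid_add"
    by (rule sum.reindex_bij_betw[OF e, symmetric])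
  define B where "B = complex_mat_of A"
  have B: "B \<in> carrier_mat n n" by (simp add: B_def complex_mat_of_def n_def)
  have Bij: "B $$ (i, j) = of_real (A $ e i $ e j)" if "i < n" "j < n" for i j
    using that by (simp add: B_def complex_mat_of_def n_def e_def)
  have cp: "char_poly B = (\<Prod>z\<leftarrow>ls. [:- z, 1:])" using ls by (simp add: eigenvalue_listing_def B_def)
  obtain n_as where nf: "jordan_nf B n_as" using jordan_nf_exists[OF B cp] by blast
  then obtain P Q where wit: "similar_mat_wit B (jordan_matrix n_as) P Q"
    by (auto simp: jordan_nf_def similar_mat_def)
  define Jm where "Jm = jordan_matrix n_as"
  note w = similar_mat_witD2[OF B wit, folded Jm_def]
  have N: "sum_list (map fst n_as) = n" using w(5) by (auto simp: Jm_def)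
  obtain lam d where blk: "\<And>i. i < n \<Longrightarrow> \<exists>m. (m, lam i) \<in> set n_as \<and> d i < m"
    and J: "\<And>i j. i < n \<Longrightarrow> j < n \<Longrightarrow>
      Jm $$ (i, j) = (if i = j then lam i else if j = Suc i \<and> 0 < d i then 1 else 0)"
    and d: "\<And>i. i < n \<Longrightarrow> 0 < d i \<Longrightarrow> Suc i < n \<and> lam (Suc i) = lam i \<and> d i = Suc (d (Suc i))"
    and card: "\<And>z. card {i. i < n \<and> lam i = z} = sum_list (map fst (filter (\<lambda>na. snd na = z) n_as))"
    by (rule jordan_matrix_entries[of n_as, unfolded N, folded Jm_def]) (rule that)
  have mult: "(U * V) $$ (i, j) = (\<Sum>k<n. U $$ (i, k) * V $$ (k, j))"
    if "U \<in> carrier_mat n n" "V \<in> carrier_mat n n" "i < n" "j < n" for U V :: "complex Matrix.mat" and i j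
    using that by (auto simp: scalar_prod_def atLeast0LessThan intro!: sum.cong)
  \<comment> \<open>The functionals are the rows of \<open>Q\<close>, the inverse of the basis
    matrix, with columns relabelled by colours.\<close>
  define c where "c i j = Q $$ (i, the_inv_into {..<n} e j)" for i j
  have c: "c i (e j) = Q $$ (i, j)" if "j < n" for i j
    using that e by (simp add: c_def the_inv_into_f_f bij_betw_def)
  define l where "l i = lin (c i)" for i
  have l: "l i x = (\<Sum>j<n. Q $$ (i, j) * of_real (x $ e j))" for i x
    unfolding l_def lin_def sum_e by (intro sum.cong) (auto simp: c)
  \<comment> \<open>Row by row this says that the rows of \<open>Q\<close> form chains of
    generalized left eigenvectors, which is the coordinate recursion.\<close>
  have QB: "Q * B = Jm * Q"
  proof -
    have "Q * B = Q * (P * (Jm * Q))" using w by (simp add: assoc_mult_mat[of P n n Jm n Q n])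
    also have "\<dots> = (Q * P) * (Jm * Q)" using w by (intro assoc_mult_mat[symmetric]) auto
    also have "\<dots> = Jm * Q" using w by auto
    finally show ?thesis .
  qed
  have BP: "B * P = P * Jm"
  proof -
    have "B * P = (P * Jm * Q) * P" using w(3) by simp
    also have "\<dots> = (P * Jm) * (Q * P)" using w by (intro assoc_mult_mat) auto
    also have "\<dots> = P * Jm" using w by auto
    finally show ?thesis .
  qed
  have JQ: "(\<Sum>k<n. Q $$ (i, k) * B $$ (k, j)) = lam i * Q $$ (i, j) + (if 0 < d i then Q $$ (Suc i, j) else 0)"
    if i: "i < n" and j: "j < n" for i j
  proof -
    have "(\<Sum>k<n. Q $$ (i, k) * B $$ (k, j)) = (\<Sum>k<n. Jm $$ (i, k) * Q $$ (k, j))"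
      using mult[of Q B i j, symmetric] mult[of Jm Q i j, symmetric] w(4-7) i j
      by (simp only: QB)
    also have "\<dots> = (\<Sum>k<n. (if k = i then lam i * Q $$ (i, j) else 0)
        + (if k = Suc i then (if 0 < d i then Q $$ (Suc i, j) else 0) else 0))"
      using i by (intro sum.cong) (auto simp: J)
    also have "\<dots> = lam i * Q $$ (i, j) + (if 0 < d i then Q $$ (Suc i, j) else 0)"
      using i d[of i] by (auto simp: sum.distrib)
    finally show ?thesis .
  qed
  have main: "l i (A *v x) = lam i * l i x + (if 0 < d i then l (Suc i) x else 0)" if i: "i < n" for i x
  proof -
    have "l i (A *v x) = (\<Sum>k<n. Q $$ (i, k) * (\<Sum>j<n. B $$ (k, j) * of_real (x $ e j)))"
      unfolding l by (intro sum.cong) (auto simp: matrix_vector_mult_def sum_e Bij)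
    also have "\<dots> = (\<Sum>j<n. (\<Sum>k<n. Q $$ (i, k) * B $$ (k, j)) * of_real (x $ e j))"
      unfolding sum_distrib_left sum_distrib_right by (subst sum.swap) (simp add: mult_ac)
    also have "\<dots> = (\<Sum>j<n. lam i * (Q $$ (i, j) * of_real (x $ e j))
        + (if 0 < d i then Q $$ (Suc i, j) * of_real (x $ e j) else 0))"
    proof (intro sum.cong refl)
      fix j assume "j \<in> {..<n}"
      then have "j < n" by simp
      show "(\<Sum>k<n. Q $$ (i, k) * B $$ (k, j)) * of_real (x $ e j) = lam i * (Q $$ (i, j) * of_real (x $ e j))
        + (if 0 < d i then Q $$ (Suc i, j) * of_real (x $ e j) else 0)"
        unfolding JQ[OF i \<open>j < n\<close>] by (simp add: distrib_right)
    qed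
    also have "\<dots> = lam i * l i x + (if 0 < d i then l (Suc i) x else 0)"
      by (simp add: sum.distrib l sum_distrib_left)
    finally show ?thesis .
  qed
  define K where "K = 1 + (\<Sum>j<n. \<Sum>i<n. norm (P $$ (j, i)))"
  have K: "0 < K" unfolding K_def by (intro add_pos_nonneg sum_nonneg) auto
  \<comment> \<open>As \<open>P * Q\<close> is the identity, the columns of \<open>P\<close> rebuild
    the vector from its coordinates; this gives the norm bound.\<close>
  have recon: "of_real (x $ e j) = (\<Sum>i<n. P $$ (j, i) * l i x)" if j: "j < n" for j and x :: "real ^ 'q"
  proof -
    have "(\<Sum>i<n. P $$ (j, i) * l i x) = (\<Sum>k<n. (\<Sum>i<n. P $$ (j, i) * Q $$ (i, k)) * of_real (x $ e k))"
      unfolding l sum_distrib_left sum_distrib_right by (subst sum.swap) (simp add: mult_ac)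
    also have "\<dots> = (\<Sum>k<n. if k = j then of_real (x $ e k) else 0)"
    proof (intro sum.cong refl)
      fix k assume "k \<in> {..<n}"
      then have "(\<Sum>i<n. P $$ (j, i) * Q $$ (i, k)) = (if k = j then 1 else 0)"
        using mult[of P Q j k] w j by auto
      then show "(\<Sum>i<n. P $$ (j, i) * Q $$ (i, k)) * of_real (x $ e k) = (if k = j then of_real (x $ e k) else 0)"
        by simp
    qed
    also have "\<dots> = of_real (x $ e j)" using j by simp
    finally show ?thesis by simp
  qed
  have norm_le: "norm x \<le> (\<Sum>i<n. K * norm (l i x))" for x
  proof -
    have "norm x \<le> (\<Sum>j<n. \<bar>x $ e j\<bar>)" using norm_le_l1_cart[of x] by (simp add: sum_e)
    also have "\<dots> \<le> (\<Sum>j<n. \<Sum>i<n. norm (P $$ (j, i)) * norm (l i x))"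
    proof (rule sum_mono)
      fix j assume "j \<in> {..<n}"
      then have "\<bar>x $ e j\<bar> = norm (\<Sum>i<n. P $$ (j, i) * l i x)"
        using recon[of j x] by (metis lessThan_iff norm_of_real)
      also have "\<dots> \<le> (\<Sum>i<n. norm (P $$ (j, i)) * norm (l i x))"
        by (rule order_trans[OF norm_sum]) (simp add: norm_mult)
      finally show "\<bar>x $ e j\<bar> \<le> (\<Sum>i<n. norm (P $$ (j, i)) * norm (l i x))" .
    qed
    also have "\<dots> = (\<Sum>i<n. (\<Sum>j<n. norm (P $$ (j, i))) * norm (l i x))"
      by (subst sum.swap) (simp add: sum_distrib_right)
    also have "\<dots> \<le> (\<Sum>i<n. K * norm (l i x))"
    proof (intro sum_mono mult_right_mono)
      fix i assume "i \<in> {..<n}"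
      then have "(\<Sum>j<n. norm (P $$ (j, i))) \<le> (\<Sum>j<n. \<Sum>i<n. norm (P $$ (j, i)))"
        by (intro sum_mono member_le_sum) auto
      then show "(\<Sum>j<n. norm (P $$ (j, i))) \<le> K" by (simp add: K_def)
    qed simp
    finally show ?thesis .
  qed
  have kinds: "(\<exists>r. \<forall>j. c i j = r * of_real (a $ j)) \<or> Re (lam i) < Re (ls ! 1) \<or>
      Re (lam i) = Re (ls ! 1) \<and> d i \<le> jordan_nu B (ls ! 1)" if i: "i < n" for i
  \<comment> \<open>The tail of the list separates the eigenvalues dominated by the second entry
    from a simple first one.\<close>
  proof (cases "lam i \<in> set (tl ls)")
    case True
    obtain m where m: "(m, lam i) \<in> set n_as" "d i < m" using blk[OF i] by blast
    have "d i \<le> jordan_nu B (lam i)" using jordan_nf_block_le_nu[OF nf m(1)] m(2) by simp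
    then show ?thesis using eigenvalue_listing_le_second[OF ls[folded B_def] True] by auto
  next
    case False
    have ne: "ls \<noteq> []"
    proof
      assume "ls = []"
      then have "degree (char_poly B) = 0" using cp by simp
      then show False using degree_monic_char_poly[OF B] i by simp
    qed
    then have ls_eq: "ls = of_real b # tl ls" using ls0 by (cases ls) auto
    \<comment> \<open>Outside the tail only the linear factor of b can vanish at
      \<open>lam i\<close>. Hence \<open>lam i\<close> is b with multiplicity 1, and
      \<open>i\<close> is the only index that carries it.\<close>
    have order_eq: "order z (char_poly B) = card {i. i < n \<and> lam i = z}" for z
      by (simp add: card jordan_nf_order[OF nf])
    have cp': "char_poly B = [:- of_real b, 1:] * (\<Prod>z\<leftarrow>tl ls. [:- z, 1:])"
      using cp ls_eq by (metis (no_types, lifting) list.simps(9) prod_list.Cons)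
    have nz: "(\<Prod>z\<leftarrow>tl ls. [:- z, 1:]) \<noteq> 0" by (auto simp: prod_list_zero_iff)
    have "poly (\<Prod>z\<leftarrow>tl ls. [:- z, 1:]) (lam i) \<noteq> 0"
      using False by (auto simp: poly_prod_list prod_list_zero_iff)
    then have "order (lam i) (\<Prod>z\<leftarrow>tl ls. [:- z, 1:]) = 0" using order_root by blast
    moreover have "order (lam i) (char_poly B)
        = order (lam i) [:- of_real b, 1:] + order (lam i) (\<Prod>z\<leftarrow>tl ls. [:- z, 1:])"
      unfolding cp' by (rule order_mult) (metis nz mult_eq_0_iff pCons_eq_0_iff zero_neq_one)
    moreover have "order (lam i) [:- of_real b, 1:] = (if lam i = of_real b then 1 else 0)"
      using order_linear_power[of "lam i" "- of_real b" 1] by auto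
    moreover have "0 < card {k. k < n \<and> lam k = lam i}" using i by (subst card_gt_0_iff) auto
    ultimately have lam_i: "lam i = of_real b" and "card {k. k < n \<and> lam k = lam i} = 1"
      using order_eq[of "lam i"] by (auto split: if_splits)
    then have uniq: "k = i" if "k < n" "lam k = of_real b" for k
      using that i by (metis (mono_tags, lifting) card_1_singletonE mem_Collect_eq singletonD)
    \<comment> \<open>\<open>r\<close> holds the coefficients of \<open>a\<close> as a combination
      of the rows of \<open>Q\<close>. Since \<open>a\<close> is a left eigenvector,
      \<open>r\<close> is a left eigenvector of the Jordan matrix for b.\<close>
    define r where "r k = (\<Sum>j<n. of_real (a $ e j) * P $$ (j, k))" for k
    have aB: "(\<Sum>k<n. of_real (a $ e k) * B $$ (k, j)) = of_real b * of_real (a $ e j)" if "j < n" for j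
    proof -
      have "(\<Sum>k<n. of_real (a $ e k) * B $$ (k, j)) = of_real (\<Sum>k<n. a $ e k * A $ e k $ e j)"
        using that by (simp add: Bij)
      also have "(\<Sum>k<n. a $ e k * A $ e k $ e j) = b * a $ e j"
        using eigen[of "e j"] by (simp only: sum_e)
      finally show ?thesis by simp
    qed
    have rJ: "(\<Sum>i<n. r i * Jm $$ (i, k)) = of_real b * r k" if k: "k < n" for k
    proof -
      have "(\<Sum>i<n. r i * Jm $$ (i, k)) = (\<Sum>j<n. of_real (a $ e j) * (\<Sum>i<n. P $$ (j, i) * Jm $$ (i, k)))"
        unfolding r_def sum_distrib_left sum_distrib_right by (subst sum.swap) (simp add: mult_ac)
      also have "\<dots> = (\<Sum>j<n. of_real (a $ e j) * (\<Sum>i<n. B $$ (j, i) * P $$ (i, k)))"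
      proof (intro sum.cong refl)
        fix j assume "j \<in> {..<n}"
        then show "of_real (a $ e j) * (\<Sum>i<n. P $$ (j, i) * Jm $$ (i, k))
            = of_real (a $ e j) * (\<Sum>i<n. B $$ (j, i) * P $$ (i, k))"
          using mult[of P Jm j k, symmetric] mult[of B P j k, symmetric] w(4-7) k
          by (simp only: BP lessThan_iff)
      qed
      also have "\<dots> = (\<Sum>i<n. (\<Sum>j<n. of_real (a $ e j) * B $$ (j, i)) * P $$ (i, k))"
        unfolding sum_distrib_left sum_distrib_right by (subst sum.swap) (simp add: mult_ac)
      also have "\<dots> = (\<Sum>i<n. of_real b * of_real (a $ e i) * P $$ (i, k))"
        by (intro sum.cong) (simp_all only: aB lessThan_iff)
      also have "\<dots> = of_real b * r k" by (simp add: r_def sum_distrib_left mult_ac)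
      finally show ?thesis .
    qed
    \<comment> \<open>Column \<open>Suc k\<close> of the Jordan matrix has at most one entry off the
      diagonal, in row \<open>k\<close> and within the same block. There \<open>lam k\<close> also
      differs from b, so \<open>r k\<close> vanishes by induction and the diagonal entry
      decides.\<close>
    have r0: "r k = 0" if "k < n" "lam k \<noteq> of_real b" for k
      using that
    proof (induction k)
      case (Suc k)
      have "(\<Sum>i<n. r i * Jm $$ (i, Suc k)) = (\<Sum>i<n. if i = Suc k then r i * lam i else 0)"
      proof (intro sum.cong refl)
        fix i assume i: "i \<in> {..<n}"
        have "r k = 0" if "0 < d k" using d[of k] that Suc by auto
        then show "r i * Jm $$ (i, Suc k) = (if i = Suc k then r i * lam i else 0)"
          using i Suc.prems by (auto simp: J)
      qed
      then have "r (Suc k) * lam (Suc k) = of_real b * r (Suc k)" using rJ[of "Suc k"] Suc.prems by simp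
      then show ?case using Suc.prems by (simp add: mult.commute)
    next
      case 0
      have "(\<Sum>i<n. r i * Jm $$ (i, 0)) = (\<Sum>i<n. if i = 0 then r i * lam i else 0)"
        using 0 by (intro sum.cong) (auto simp: J)
      then have "r 0 * lam 0 = of_real b * r 0" using rJ[of 0] 0 by simp
      then show ?case using 0 by (simp add: mult.commute)
    qed
    \<comment> \<open>Only the coefficient at \<open>i\<close> survives, so \<open>a\<close> is a
      multiple of row \<open>i\<close>; the multiple is nonzero because \<open>a\<close> is, and can
      be inverted.\<close>
    have aQ: "of_real (a $ e j) = r i * Q $$ (i, j)" if j: "j < n" for j
    proof -
      have "(\<Sum>k<n. r k * Q $$ (k, j)) = (\<Sum>m<n. of_real (a $ e m) * (\<Sum>k<n. P $$ (m, k) * Q $$ (k, j)))"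
        unfolding r_def sum_distrib_left sum_distrib_right by (subst sum.swap) (simp add: mult_ac)
      also have "\<dots> = (\<Sum>m<n. if m = j then of_real (a $ e m) else 0)"
      proof (intro sum.cong refl)
        fix m assume "m \<in> {..<n}"
        then have "(\<Sum>k<n. P $$ (m, k) * Q $$ (k, j)) = (if m = j then 1 else 0)"
          using mult[of P Q m j] w j by auto
        then show "of_real (a $ e m) * (\<Sum>k<n. P $$ (m, k) * Q $$ (k, j)) = (if m = j then of_real (a $ e m) else 0)"
          by simp
      qed
      also have "\<dots> = of_real (a $ e j)" using j by simp
      finally have "of_real (a $ e j) = (\<Sum>k<n. r k * Q $$ (k, j))" ..
      also have "\<dots> = (\<Sum>k<n. if k = i then r k * Q $$ (k, j) else 0)"
        using r0 uniq by (intro sum.cong) auto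
      also have "\<dots> = r i * Q $$ (i, j)" using i by simp
      finally show ?thesis .
    qed
    have "r i \<noteq> 0"
    proof
      assume "r i = 0"
      then have a0: "a $ e j = 0" if "j < n" for j using aQ[OF that] by simp
      have "a $ k = 0" for k
      proof -
        obtain j where "j < n" "k = e j" using e by (metis UNIV_I bij_betw_imp_surj_on imageE lessThan_iff)
        then show ?thesis using a0 by simp
      qed
      then show False using a by (simp add: Finite_Cartesian_Product.vec_eq_iff)
    qed
    have "c i k = 1 / r i * of_real (a $ k)" for k
    proof -
      obtain j where "j < n" "k = e j" using e by (metis UNIV_I bij_betw_imp_surj_on imageE lessThan_iff)
      then show ?thesis using aQ[of j] c[of j i] \<open>r i \<noteq> 0\<close> by simp
    qed
    then show ?thesis by blast
  qed
  show thesis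
    by (rule that[of c lam d K]) (use main d K norm_le kinds in \<open>simp_all add: n_def l_def B_def\<close>)
qed

section \<open>Conditional laws and moments of the urn\<close>

lemma (in prob_space) Lp_le_exI:
  assumes "U \<in> borel_measurable M" "integrable M (\<lambda>w. norm (U w) powr p)" "0 < p"
  obtains u where "0 < u" "Lp_le M p U u"
proof -
  define I where "I = (\<integral>w. norm (U w) powr p \<partial>M)"
  have I: "0 \<le> I" by (simp add: I_def)
  have "I \<le> ((1 + I) powr (1 / p)) powr p" using I assms(3) by (simp add: powr_powr)
  then have "Lp_le M p U ((1 + I) powr (1 / p))" using assms by (simp add: Lp_le_def I_def)
  then show thesis using I by (intro that[of "(1 + I) powr (1 / p)"]) auto
qed

lemma (in prob_space) Lp_le_vec:
  fixes U :: "'a \<Rightarrow> real ^ 'q::finite"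
  assumes U: "U \<in> borel_measurable M" and i: "\<And>j. integrable M (\<lambda>w. \<bar>U w $ j\<bar> powr p)" and p: "1 \<le> p"
  obtains u where "0 < u" "Lp_le M p U u"
proof -
  have [measurable]: "U \<in> borel_measurable M" by fact
  have comp: "(\<lambda>w. U w $ j) \<in> borel_measurable M" for j
    unfolding cart_eq_inner_axis by measurable
  have "\<exists>u>0. Lp_le M p (\<lambda>w. \<bar>U w $ j\<bar>) u" for j
    by (rule Lp_le_exI[of "\<lambda>w. \<bar>U w $ j\<bar>" p]) (use i[of j] p comp[of j] in auto)
  then obtain u where u: "\<And>j. 0 < u j" "\<And>j. Lp_le M p (\<lambda>w. \<bar>U w $ j\<bar>) (u j)" by metis
  have L: "Lp_le M p (\<lambda>w. \<Sum>j\<in>UNIV. \<bar>U w $ j\<bar>) (1 + (\<Sum>j\<in>UNIV. u j))"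
    using u p by (intro Lp_le_sum) auto
  have pos: "0 < 1 + (\<Sum>j\<in>UNIV. u j)" using u(1) by (intro add_pos_nonneg sum_nonneg) (auto intro: less_imp_le)
  have "Lp_le M p U (1 + (\<Sum>j\<in>UNIV. u j))"
    by (rule Lp_le_bound[OF L U, of 1])
      (use p pos in \<open>auto intro!: AE_I2 order_trans[OF norm_le_l1_cart]\<close>)
  with pos show thesis by (rule that)
qed

context polya_urn
begin

section \<open>The filtration of the urn and the conditional law of an increment\<close>

lemma X_measurable [measurable]: "X n \<in> borel_measurable M"
  by (rule state_measurable)

lemma J_measurable [measurable]: "J n \<in> measurable M (count_space UNIV)"
  by (rule colour_measurable)

lemma \<xi>_measurable [measurable]: "\<xi> i \<in> borel_measurable N"
  by (rule replacement_measurable)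

lemma generators_subset: "{X k -` B \<inter> space M | k B. k \<le> n \<and> B \<in> sets borel} \<union>
     {J k -` S \<inter> space M | k S. 1 \<le> k \<and> k \<le> m} \<subseteq> sets M"
proof safe
  fix k and B :: "(real ^ 'q) set" assume "B \<in> sets borel"
  then show "X k -` B \<inter> space M \<in> sets M" by (rule measurable_sets[OF state_measurable])
next
  fix k and S :: "'q set"
  show "J k -` S \<inter> space M \<in> sets M" by (rule measurable_sets[OF colour_measurable]) simp
qed

lemma sets_history: "sets (urn_history M X J n m) = sigma_sets (space M)
    ({X k -` B \<inter> space M | k B. k \<le> n \<and> B \<in> sets borel} \<union>
     {J k -` S \<inter> space M | k S. 1 \<le> k \<and> k \<le> m})"
  unfolding urn_history_def using generators_subset[of n m] sets.sets_into_space
  by (intro sets_measure_of) blast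

lemma space_history [simp]: "space (urn_history M X J n m) = space M"
  unfolding urn_history_def by (rule space_measure_of_conv)

lemma subalgebra_history: "subalgebra M (urn_history M X J n m)"
  unfolding subalgebra_def sets_history using sets.sigma_sets_subset[OF generators_subset] by simp

lemma history_mono:
  assumes "m \<le> m'"
  shows "subalgebra (urn_history M X J n m') (urn_history M X J n m)"
proof -
  have "{X k -` B \<inter> space M | k B. k \<le> n \<and> B \<in> sets borel} \<union>
      {J k -` S \<inter> space M | k S. 1 \<le> k \<and> k \<le> m}
    \<subseteq> {X k -` B \<inter> space M | k B. k \<le> n \<and> B \<in> sets borel} \<union>
      {J k -` S \<inter> space M | k S. 1 \<le> k \<and> k \<le> m'}"
    using assms by (intro Un_mono Collect_mono order_refl) force
  then show ?thesis
    unfolding subalgebra_def sets_history by (simp add: sigma_sets_mono')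
qed

lemma X_history: "X n \<in> borel_measurable (urn_history M X J n m)"
proof (rule measurableI)
  fix B :: "(real ^ 'q) set" assume "B \<in> sets borel"
  then show "X n -` B \<inter> space (urn_history M X J n m) \<in> sets (urn_history M X J n m)"
    unfolding sets_history space_history by (intro sigma_sets.Basic UnI1) blast
qed simp

lemma J_history: "{w \<in> space M. J (Suc n) w = i} \<in> sets (urn_history M X J n (Suc n))"
proof -
  have "{w \<in> space M. J (Suc n) w = i} = J (Suc n) -` {i} \<inter> space M" by auto
  moreover have "J (Suc n) -` {i} \<inter> space M \<in> sets (urn_history M X J n (Suc n))"
    unfolding sets_history by (intro sigma_sets.Basic UnI2 CollectI exI[of _ "Suc n"] exI[of _ "{i}"]) simp
  ultimately show ?thesis by simp
qed

lemma sigma_finite_history: "sigma_finite_subalgebra M (urn_history M X J n m)"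
  using subalgebra_history finite_measure_axioms
  by (intro finite_measure_subalgebra_is_sigma_finite) (simp add: finite_measure_subalgebra_def finite_measure_subalgebra_axioms_def)

text \<open>On an event of the enlarged past that fixes the colour, the conditional probability in
  \<open>increment_law\<close> is constant. Integrating it over the event identifies the restricted
  law of the increment as a multiple of the law of the replacement vector, and so transfers every
  integral and not only probabilities.\<close>

lemma increment_distr:
  assumes A: "A \<in> sets (urn_history M X J n (Suc n))" and i: "\<And>w. w \<in> A \<Longrightarrow> J (Suc n) w = i"
  shows "distr (density M (\<lambda>w. ennreal (indicator A w))) borel (\<lambda>w. X (Suc n) w - X n w)
    = density (distr N borel (\<xi> i)) (\<lambda>_. ennreal (measure M A))" (is "?L = ?R")
proof (rule measure_eqI)
  interpret F: sigma_finite_subalgebra M "urn_history M X J n (Suc n)" by (rule sigma_finite_history)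
  have AM [measurable]: "A \<in> sets M" using A subalgebra_history by (auto simp: subalgebra_def)
  show "sets ?L = sets ?R" by simp
  fix B assume "B \<in> sets ?L"
  then have B [measurable]: "B \<in> sets borel" by simp
  define E where "E = {w \<in> space M. X (Suc n) w - X n w \<in> B}"
  have E [measurable]: "E \<in> sets M" unfolding E_def by measurable
  have "measure M (A \<inter> E) = (\<integral>w\<in>A. indicator E w \<partial>M)"
    by (simp add: set_lebesgue_integral_def indicator_inter_arith[symmetric])
  also have "\<dots> = (\<integral>w\<in>A. real_cond_exp M (urn_history M X J n (Suc n)) (indicator E) w \<partial>M)"
    by (rule F.real_cond_exp_intA[OF _ A]) (simp add: integrable_indicator_iff less_top[symmetric])
  also have "\<dots> = (\<integral>w\<in>A. measure N {v \<in> space N. \<xi> i v \<in> B} \<partial>M)"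
  proof (rule set_lebesgue_integral_cong_AE)
    show "AE w\<in>A in M. real_cond_exp M (urn_history M X J n (Suc n)) (indicator E) w
        = measure N {v \<in> space N. \<xi> i v \<in> B}"
      using increment_law[OF B, of n] unfolding E_def[symmetric]
      by eventually_elim (use i in auto)
  qed auto
  also have "\<dots> = measure M A * measure N {v \<in> space N. \<xi> i v \<in> B}"
    by (simp add: set_lebesgue_integral_def)
  finally have "measure M (A \<inter> E) = measure M A * measure N {v \<in> space N. \<xi> i v \<in> B}" .
  moreover have "emeasure ?L B = ennreal (measure M (A \<inter> E))"
  proof -
    have "emeasure ?L B = emeasure (density M (indicator A)) E"
      by (subst emeasure_distr) (auto simp: E_def vimage_def Int_def conj_commute ennreal_indicator)
    also have "\<dots> = emeasure M (A \<inter> E)" by (rule emeasure_restricted) auto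
    finally show ?thesis by (simp add: emeasure_eq_measure)
  qed
  moreover have "emeasure ?R B = ennreal (measure M A * measure N {v \<in> space N. \<xi> i v \<in> B})"
    by (simp add: emeasure_density_const emeasure_distr N.emeasure_eq_measure ennreal_mult vimage_def Int_def conj_commute)
  ultimately show "emeasure ?L B = emeasure ?R B" by simp
qed

end

context polya_urn
begin

lemma increment_integral_on:
  fixes f :: "real ^ 'q \<Rightarrow> real"
  assumes A: "A \<in> sets (urn_history M X J n (Suc n))" "\<And>w. w \<in> A \<Longrightarrow> J (Suc n) w = i"
    and f [measurable]: "f \<in> borel_measurable borel" and fi: "integrable N (\<lambda>v. f (\<xi> i v))"
  shows "integrable M (\<lambda>w. indicator A w * f (X (Suc n) w - X n w))" (is ?I)
    and "(\<integral>w. indicator A w * f (X (Suc n) w - X n w) \<partial>M) = measure M A * (\<integral>v. f (\<xi> i v) \<partial>N)" (is ?E)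
proof -
  have AM [measurable]: "A \<in> sets M" using A(1) subalgebra_history by (auto simp: subalgebra_def)
  let ?Y = "\<lambda>w. X (Suc n) w - X n w"
  let ?R = "density (distr N borel (\<xi> i)) (\<lambda>_. ennreal (measure M A))"
  note D = increment_distr[OF A]
  have "integrable (distr N borel (\<xi> i)) f" using fi by (simp add: integrable_distr_eq)
  then have "integrable ?R f" by (subst integrable_density) auto
  then have "integrable (distr (density M (\<lambda>w. ennreal (indicator A w))) borel ?Y) f"
    by (simp only: D)
  then have "integrable (density M (\<lambda>w. ennreal (indicator A w))) (\<lambda>w. f (?Y w))"
    by (simp add: integrable_distr_eq)
  then show ?I by (simp add: integrable_density)
  have "(\<integral>w. indicator A w * f (?Y w) \<partial>M) = (\<integral>w. f (?Y w) \<partial>density M (\<lambda>w. ennreal (indicator A w)))"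
    by (subst integral_density) auto
  also have "\<dots> = (\<integral>x. f x \<partial>distr (density M (\<lambda>w. ennreal (indicator A w))) borel ?Y)"
    by (subst integral_distr) auto
  also have "\<dots> = (\<integral>x. f x \<partial>?R)" by (simp only: D)
  also have "\<dots> = measure M A * (\<integral>x. f x \<partial>distr N borel (\<xi> i))"
    by (subst integral_density) auto
  also have "\<dots> = measure M A * (\<integral>v. f (\<xi> i v) \<partial>N)"
    by (subst integral_distr) auto
  finally show ?E .
qed

text \<open>An event is split by the drawn colour; the pieces are still events of the past enlarged
  by that colour.\<close>

lemma increment_integral:
  fixes f :: "real ^ 'q \<Rightarrow> real"
  assumes A: "A \<in> sets (urn_history M X J n (Suc n))"
    and f: "f \<in> borel_measurable borel" and fi: "\<And>i. integrable N (\<lambda>v. f (\<xi> i v))"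
  shows "integrable M (\<lambda>w. indicator A w * f (X (Suc n) w - X n w))" (is ?I)
    and "(\<integral>w. indicator A w * f (X (Suc n) w - X n w) \<partial>M)
      = (\<Sum>i\<in>UNIV. measure M (A \<inter> {w \<in> space M. J (Suc n) w = i}) * (\<integral>v. f (\<xi> i v) \<partial>N))" (is ?E)
proof -
  let ?Y = "\<lambda>w. X (Suc n) w - X n w"
  define A' where "A' i = A \<inter> {w \<in> space M. J (Suc n) w = i}" for i
  have A': "A' i \<in> sets (urn_history M X J n (Suc n))" for i
    unfolding A'_def using A J_history by (rule sets.Int)
  have J': "w \<in> A' i \<Longrightarrow> J (Suc n) w = i" for w i by (simp add: A'_def)
  note on = increment_integral_on[OF A' J' f fi]
  have "A \<subseteq> space M" using sets.sets_into_space[OF A] by simp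
  then have split: "indicator A w * f (?Y w) = (\<Sum>i\<in>UNIV. indicator (A' i) w * f (?Y w))" for w
    unfolding sum_distrib_right[symmetric] A'_def
    by (cases "w \<in> A") (auto simp: indicator_def if_distrib cong: if_cong)
  show ?I unfolding split by (intro Bochner_Integration.integrable_sum on)
  show ?E unfolding split by (subst Bochner_Integration.integral_sum) (simp_all add: on A'_def[symmetric])
qed

lemma increment_integrable:
  fixes f :: "real ^ 'q \<Rightarrow> real"
  assumes f: "f \<in> borel_measurable borel" and fi: "\<And>i. integrable N (\<lambda>v. f (\<xi> i v))"
  shows "integrable M (\<lambda>w. f (X (Suc n) w - X n w))"
    and "(\<integral>w. f (X (Suc n) w - X n w) \<partial>M)
      = (\<Sum>i\<in>UNIV. measure M {w \<in> space M. J (Suc n) w = i} * (\<integral>v. f (\<xi> i v) \<partial>N))"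
proof -
  have S: "space M \<in> sets (urn_history M X J n (Suc n))"
    using sets.top[of "urn_history M X J n (Suc n)"] by simp
  have *: "space M \<inter> {w \<in> space M. P w} = {w \<in> space M. P w}" for P by auto
  show "integrable M (\<lambda>w. f (X (Suc n) w - X n w))"
    using increment_integral(1)[OF S f fi]
    by (rule Bochner_Integration.integrable_cong[THEN iffD1, rotated 2]) auto
  have "(\<integral>w. f (X (Suc n) w - X n w) \<partial>M) = (\<integral>w. indicator (space M) w * f (X (Suc n) w - X n w) \<partial>M)"
    by (rule Bochner_Integration.integral_cong) auto
  then show "(\<integral>w. f (X (Suc n) w - X n w) \<partial>M)
      = (\<Sum>i\<in>UNIV. measure M {w \<in> space M. J (Suc n) w = i} * (\<integral>v. f (\<xi> i v) \<partial>N))"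
    using increment_integral(2)[OF S f fi] by (simp add: *)
qed

text \<open>The case of a constant function in the preceding formula.\<close>

lemma sum_colour_prob: "(\<Sum>i\<in>UNIV. measure M {w \<in> space M. J (Suc n) w = i}) = 1"
proof -
  have "(\<integral>w. 1 \<partial>M) = (\<Sum>i\<in>UNIV. measure M {w \<in> space M. J (Suc n) w = i} * (\<integral>v. 1 \<partial>N))"
    by (rule increment_integrable(2)) simp_all
  then show ?thesis by (simp only: lebesgue_integral_const prob_space N.prob_space scaleR_one mult_1_right)
qed

text \<open>Tower property: conditioning on the past together with the drawn colour gives the mean
  of \<open>f\<close> for that colour, and conditioning this on the past alone brings in the drawing
  probabilities.\<close>

lemma cond_increment:
  fixes f :: "real ^ 'q \<Rightarrow> real"
  assumes f: "f \<in> borel_measurable borel" and fi: "\<And>i. integrable N (\<lambda>v. f (\<xi> i v))"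
  shows "AE w in M. real_cond_exp M (urn_history M X J n n) (\<lambda>w. f (X (Suc n) w - X n w)) w
    = (\<Sum>i\<in>UNIV. (a $ i * X n w $ i / (\<Sum>j\<in>UNIV. a $ j * X n w $ j)) * (\<integral>v. f (\<xi> i v) \<partial>N))"
proof -
  let ?F = "urn_history M X J n n" and ?G = "urn_history M X J n (Suc n)"
  let ?Y = "\<lambda>w. f (X (Suc n) w - X n w)"
  interpret F: sigma_finite_subalgebra M ?F by (rule sigma_finite_history)
  interpret G: sigma_finite_subalgebra M ?G by (rule sigma_finite_history)
  define h where "h i = (\<integral>v. f (\<xi> i v) \<partial>N)" for i
  define E where "E i = {w \<in> space M. J (Suc n) w = i}" for i
  have E [measurable]: "E i \<in> sets M" for i unfolding E_def by measurable
  have iE: "integrable M (indicator (E i) :: _ \<Rightarrow> real)" for i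
    by (simp add: integrable_indicator_iff less_top[symmetric])
  define H where "H w = (\<Sum>i\<in>UNIV. h i * indicator (E i) w)" for w
  have iH: "integrable M H" unfolding H_def using iE by (intro Bochner_Integration.integrable_sum integrable_mult_right)
  note iY = increment_integrable(1)[OF f fi, of n]
  have "AE w in M. real_cond_exp M ?G ?Y w = H w"
  proof (rule G.real_cond_exp_charact[OF _ iY iH])
    show "H \<in> borel_measurable ?G" unfolding H_def E_def using J_history[of n]
      by (intro borel_measurable_sum borel_measurable_times borel_measurable_indicator) auto
    fix A assume A: "A \<in> sets ?G"
    then have [measurable]: "A \<in> sets M" using subalgebra_history by (auto simp: subalgebra_def)
    have "(\<integral>w\<in>A. H w \<partial>M) = (\<integral>w. (\<Sum>i\<in>UNIV. h i * indicator (A \<inter> E i) w) \<partial>M)"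
      unfolding set_lebesgue_integral_def H_def
      by (intro Bochner_Integration.integral_cong) (auto simp: indicator_def sum_distrib_left)
    also have "\<dots> = (\<Sum>i\<in>UNIV. measure M (A \<inter> E i) * h i)"
      by (subst Bochner_Integration.integral_sum) (auto simp: integrable_indicator_iff less_top[symmetric] mult.commute)
    finally show "(\<integral>w\<in>A. ?Y w \<partial>M) = (\<integral>w\<in>A. H w \<partial>M)"
      using increment_integral(2)[OF A f fi] by (simp add: set_lebesgue_integral_def E_def h_def)
  qed
  then have "AE w in M. real_cond_exp M ?F (real_cond_exp M ?G ?Y) w = real_cond_exp M ?F H w"
    by (rule F.real_cond_exp_cong) (use iH in auto)
  moreover have "AE w in M. real_cond_exp M ?F (real_cond_exp M ?G ?Y) w = real_cond_exp M ?F ?Y w"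
    by (rule F.real_cond_exp_nested_subalg[OF subalgebra_history history_mono iY]) simp
  moreover have "AE w in M. real_cond_exp M ?F H w = (\<Sum>i\<in>UNIV. real_cond_exp M ?F (\<lambda>w. h i * indicator (E i) w) w)"
    unfolding H_def by (rule F.real_cond_exp_sum) (intro integrable_mult_right iE)
  moreover have "AE w in M. \<forall>i\<in>UNIV. real_cond_exp M ?F (\<lambda>w. h i * indicator (E i) w) w
      = h i * real_cond_exp M ?F (indicator (E i)) w"
    by (rule AE_finite_allI) (auto intro!: F.real_cond_exp_cmult iE)
  moreover have "AE w in M. \<forall>i\<in>UNIV. real_cond_exp M ?F (indicator (E i)) w
      = a $ i * X n w $ i / (\<Sum>j\<in>UNIV. a $ j * X n w $ j)"
    unfolding E_def by (rule AE_finite_allI) (auto intro!: draw_law)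
  ultimately show ?thesis
    by eventually_elim (simp add: h_def mult.commute)
qed

end

lemma Lp_le_uniform:
  fixes U :: "'i::finite \<Rightarrow> 'w \<Rightarrow> 'b::euclidean_space"
  assumes "\<And>i. \<exists>u>0. Lp_le M p (U i) u" "0 \<le> p"
  obtains u where "0 < u" "\<And>i. Lp_le M p (U i) u"
proof -
  obtain u where u: "\<And>i. 0 < u i" "\<And>i. Lp_le M p (U i) (u i)" using assms(1) by metis
  have le: "u i \<le> (\<Sum>i\<in>UNIV. u i)" for i using u(1) by (intro member_le_sum) (auto intro: less_imp_le)
  have "0 < (\<Sum>i\<in>UNIV. u i)" using u(1) by (intro sum_pos) auto
  moreover have "Lp_le M p (U i) (\<Sum>i\<in>UNIV. u i)" for i
    using Lp_le_mono[OF u(2) assms(2) less_imp_le[OF u(1)] le] .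
  ultimately show thesis by (rule that)
qed

section \<open>Total activity, martingale noise and deviation from the mean\<close>

locale moment_urn = polya_urn a N \<xi> x0 M X J
  for a :: "real ^ 'q::finite" and N :: "'v measure" and \<xi> :: "'q \<Rightarrow> 'v \<Rightarrow> real ^ 'q" and x0 :: "real ^ 'q"
    and M :: "'w measure" and X :: "nat \<Rightarrow> 'w \<Rightarrow> real ^ 'q" and J :: "nat \<Rightarrow> 'w \<Rightarrow> 'q" +
  fixes b p :: real
  assumes tenable: "tenable a M X" and balanced: "balanced a N \<xi> b" and p: "2 \<le> p"
    and moment: "\<And>i j. integrable N (\<lambda>v. \<bar>\<xi> i v $ j\<bar> powr p)"
begin

definition weight :: "nat \<Rightarrow> real" where "weight n = a \<bullet> x0 + real n * b"

lemma sum_inner: "(\<Sum>j\<in>UNIV. a $ j * x $ j) = a \<bullet> x"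
  by (simp add: inner_vec_def)

lemma b_pos: "0 < b" using balanced by (simp add: balanced_def)

lemma replacement_Lp: obtains u where "0 < u" "\<And>i. Lp_le N p (\<xi> i) u"
proof -
  have "\<exists>u>0. Lp_le N p (\<xi> i) u" for i
    using N.Lp_le_vec[OF replacement_measurable[of i] moment[of i]] p by (metis order_trans one_le_numeral)
  then show thesis using Lp_le_uniform[of N p \<xi>] p that by (metis order_trans zero_le_numeral)
qed

lemma replacement_integrable: "integrable N (\<xi> i)"
proof -
  obtain u where "Lp_le N p (\<xi> i) u" using replacement_Lp by metis
  then show ?thesis using p by (intro N.Lp_le_integrable) auto
qed

text \<open>The p-th moment of an increment is an average of those of the replacement vectors over
  the drawn colour, hence bounded uniformly in \<open>n\<close>.\<close>

lemma increment_Lp: obtains u where "0 < u" "\<And>n. Lp_le M p (\<lambda>w. X (Suc n) w - X n w) u"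
proof -
  obtain u where u: "0 < u" "\<And>i. Lp_le N p (\<xi> i) u" using replacement_Lp by metis
  have "Lp_le M p (\<lambda>w. X (Suc n) w - X n w) u" for n
  proof -
    have f: "(\<lambda>x::real ^ 'q. norm x powr p) \<in> borel_measurable borel" by measurable
    have fi: "integrable N (\<lambda>v. norm (\<xi> i v) powr p)" for i using Lp_leD(2)[OF u(2)] .
    have "(\<integral>w. norm (X (Suc n) w - X n w) powr p \<partial>M)
      = (\<Sum>i\<in>UNIV. measure M {w \<in> space M. J (Suc n) w = i} * (\<integral>v. norm (\<xi> i v) powr p \<partial>N))"
      by (rule increment_integrable(2)[OF f fi])
    also have "\<dots> \<le> (\<Sum>i\<in>UNIV. measure M {w \<in> space M. J (Suc n) w = i} * u powr p)"
      using Lp_leD(3)[OF u(2)] by (intro sum_mono mult_left_mono) auto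
    also have "\<dots> = u powr p" unfolding sum_distrib_right[symmetric] sum_colour_prob by simp
    finally show ?thesis using increment_integrable(1)[OF f fi] by (simp add: Lp_le_def)
  qed
  with u(1) show thesis by (rule that)
qed

lemma state_Lp: "\<exists>u>0. Lp_le M p (X n) u"
proof (induction n)
  case 0
  have "Lp_le M p (\<lambda>_. x0) (1 + norm x0)" using p by (intro Lp_le_const) auto
  then have "Lp_le M p (X 0) (1 + norm x0)" by (rule Lp_le_cong_AE) (use initial_state in auto)
  then show ?case by (intro exI[of _ "1 + norm x0"]) (simp add: add_pos_nonneg)
next
  case (Suc n)
  then obtain u where u: "0 < u" "Lp_le M p (X n) u" by blast
  obtain v where v: "0 < v" "Lp_le M p (\<lambda>w. X (Suc n) w - X n w) v" using increment_Lp by metis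
  have "Lp_le M p (\<lambda>w. X n w + (X (Suc n) w - X n w)) (u + v)"
    using u v p by (intro Lp_le_add) auto
  then show ?case using u v by (intro exI[of _ "u + v"]) simp
qed

lemma state_integrable: "integrable M (X n)"
  using state_Lp[of n] p Lp_le_integrable[of p "X n"] by auto

text \<open>Balance passes from replacement vectors to increments through the indicator of its
  violation: a nonnegative function with integral 0.\<close>

lemma increment_weight: "AE w in M. a \<bullet> (X (Suc n) w - X n w) = b"
proof -
  define f :: "real ^ 'q \<Rightarrow> real" where "f = indicator {x. a \<bullet> x \<noteq> b}"
  have B: "{x. a \<bullet> x \<noteq> b} \<in> sets borel" by measurable
  have f: "f \<in> borel_measurable borel" unfolding f_def using B by measurable
  have 0: "AE v in N. f (\<xi> i v) = 0" for i
  proof -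
    have "AE v in N. (\<Sum>j\<in>UNIV. a $ j * \<xi> i v $ j) = b" using balanced by (simp add: balanced_def)
    then show ?thesis by eventually_elim (simp add: f_def inner_vec_def)
  qed
  have fi: "integrable N (\<lambda>v. f (\<xi> i v))" for i
    by (rule integrable_cong_AE_imp[of N "\<lambda>_. 0"]) (use 0[of i] f in auto)
  have "(\<integral>v. f (\<xi> i v) \<partial>N) = 0" for i
    by (rule integral_eq_zero_AE[OF 0])
  then have "(\<integral>w. f (X (Suc n) w - X n w) \<partial>M) = 0"
    using increment_integrable(2)[OF f fi, of n] by simp
  then have "AE w in M. f (X (Suc n) w - X n w) = 0"
    by (subst (asm) integral_nonneg_eq_0_iff_AE[OF increment_integrable(1)[OF f fi]]) (simp_all add: f_def)
  then show ?thesis by eventually_elim (auto simp: f_def indicator_def split: if_splits)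
qed

lemma state_weight: "AE w in M. a \<bullet> X n w = weight n"
proof (induction n)
  case 0
  show ?case using initial_state by eventually_elim (simp add: weight_def)
next
  case (Suc n)
  with increment_weight[of n] show ?case
    by eventually_elim (simp add: weight_def inner_diff_right algebra_simps)
qed

lemma weight_pos: "0 < weight n"
proof -
  have "AE w in M. 0 < (\<Sum>i\<in>UNIV. a $ i * X n w $ i)" using tenable by (auto simp: tenable_def)
  with state_weight[of n] have "AE w in M. 0 < weight n" by eventually_elim (simp add: sum_inner)
  then show ?thesis by simp
qed

abbreviation "A \<equiv> intensity_matrix a N \<xi>"

lemma integral_nth: "integrable N (f :: 'v \<Rightarrow> real ^ 'q) \<Longrightarrow> (\<integral>v. f v \<partial>N) $ j = (\<integral>v. f v $ j \<partial>N)"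
  unfolding cart_eq_inner_axis by simp

lemma replacement_nth_integrable: "integrable N (\<lambda>v. \<xi> i v $ j)"
  using replacement_integrable[of i] unfolding cart_eq_inner_axis by simp

lemma intensity_mult: "A *v x = (\<Sum>i\<in>UNIV. (a $ i * x $ i) *\<^sub>R (\<integral>v. \<xi> i v \<partial>N))"
  by (simp add: Finite_Cartesian_Product.vec_eq_iff matrix_vector_mult_def intensity_matrix_def integral_nth replacement_integrable mult_ac)

lemma left_eigenvector: "(\<Sum>i\<in>UNIV. a $ i * A $ i $ j) = b * a $ j"
proof -
  have "(\<Sum>i\<in>UNIV. a $ i * A $ i $ j) = a $ j * (\<Sum>i\<in>UNIV. a $ i * (\<integral>v. \<xi> j v $ i \<partial>N))"
    by (simp add: intensity_matrix_def sum_distrib_left mult_ac)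
  also have "(\<Sum>i\<in>UNIV. a $ i * (\<integral>v. \<xi> j v $ i \<partial>N)) = (\<integral>v. (\<Sum>i\<in>UNIV. a $ i * \<xi> j v $ i) \<partial>N)"
    using replacement_nth_integrable by (subst Bochner_Integration.integral_sum) auto
  also have "\<dots> = (\<integral>v. b \<partial>N)"
    by (rule integral_cong_AE) (use balanced replacement_nth_integrable in \<open>auto simp: balanced_def intro!: borel_measurable_sum borel_measurable_times borel_measurable_integrable\<close>)
  finally show ?thesis by (simp add: N.prob_space)
qed

text \<open>The normalising sum in the drawing probabilities is almost surely the constant
  \<open>weight n\<close>, so the conditional mean is linear in the state. The direction
  \<open>g\<close> reduces the vector identity to real conditional expectations.\<close>

lemma cond_increment_inner:
  "AE w in M. real_cond_exp M (urn_history M X J n n) (\<lambda>w. g \<bullet> (X (Suc n) w - X n w)) w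
    = g \<bullet> (A *v X n w) / weight n"
proof -
  have "AE w in M. real_cond_exp M (urn_history M X J n n) (\<lambda>w. g \<bullet> (X (Suc n) w - X n w)) w
    = (\<Sum>i\<in>UNIV. (a $ i * X n w $ i / (\<Sum>j\<in>UNIV. a $ j * X n w $ j)) * (\<integral>v. g \<bullet> \<xi> i v \<partial>N))"
    using replacement_integrable by (intro cond_increment) auto
  with state_weight[of n] show ?thesis
  proof eventually_elim
    case (elim w)
    have "(\<Sum>i\<in>UNIV. (a $ i * X n w $ i / weight n) * (\<integral>v. g \<bullet> \<xi> i v \<partial>N)) = g \<bullet> (A *v X n w) / weight n"
      unfolding intensity_mult inner_sum_right sum_divide_distrib
      by (intro sum.cong refl) (simp add: replacement_integrable)
    then show ?case using elim by (simp only: sum_inner)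
  qed
qed

definition noise :: "nat \<Rightarrow> 'w \<Rightarrow> real ^ 'q" where
  "noise n w = (X (Suc n) w - X n w) - (1 / weight n) *\<^sub>R (A *v X n w)"

lemma intensity_mult_measurable [measurable]: "(\<lambda>w. A *v X n w) \<in> borel_measurable M"
proof -
  have "(\<lambda>w. X n w $ i) \<in> borel_measurable M" for i
    unfolding cart_eq_inner_axis by measurable
  then show ?thesis unfolding intensity_mult
    by (intro borel_measurable_sum borel_measurable_scaleR borel_measurable_times borel_measurable_const)
qed

lemma noise_measurable [measurable]: "noise n \<in> borel_measurable M"
  unfolding noise_def[abs_def]
  by (intro borel_measurable_diff borel_measurable_scaleR borel_measurable_const X_measurable intensity_mult_measurable)

text \<open>The factors \<open>a $ i * X n w $ i / weight n\<close> lie in [0, 1] by tenability,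
  even where the state itself is large in colours of activity 0.\<close>

lemma drift_bounded:
  "AE w in M. norm ((1 / weight n) *\<^sub>R (A *v X n w)) \<le> (\<Sum>i\<in>UNIV. norm (\<integral>v. \<xi> i v \<partial>N))"
proof -
  have "AE w in M. \<forall>i. 0 \<le> X n w $ i" using tenable by (auto simp: tenable_def)
  with state_weight[of n] show ?thesis
  proof eventually_elim
    case (elim w)
    have "norm ((1 / weight n) *\<^sub>R (A *v X n w)) \<le> (\<Sum>i\<in>UNIV. norm ((1 / weight n) *\<^sub>R (a $ i * X n w $ i) *\<^sub>R (\<integral>v. \<xi> i v \<partial>N)))"
      unfolding intensity_mult scaleR_sum_right by (rule norm_sum)
    also have "\<dots> \<le> (\<Sum>i\<in>UNIV. norm (\<integral>v. \<xi> i v \<partial>N))"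
    proof (rule sum_mono)
      fix i
      have "a $ i * X n w $ i \<le> (\<Sum>j\<in>UNIV. a $ j * X n w $ j)"
        using elim activity_nonneg by (intro member_le_sum) auto
      then have "a $ i * X n w $ i \<le> weight n" using elim by (simp add: sum_inner)
      moreover have "0 \<le> a $ i * X n w $ i" using elim activity_nonneg by simp
      ultimately have "\<bar>1 / weight n * (a $ i * X n w $ i)\<bar> \<le> 1"
        using weight_pos[of n] by (simp add: abs_mult)
      then have "\<bar>1 / weight n * (a $ i * X n w $ i)\<bar> * norm (\<integral>v. \<xi> i v \<partial>N) \<le> 1 * norm (\<integral>v. \<xi> i v \<partial>N)"
        by (intro mult_right_mono) auto
      then show "norm ((1 / weight n) *\<^sub>R (a $ i * X n w $ i) *\<^sub>R (\<integral>v. \<xi> i v \<partial>N)) \<le> norm (\<integral>v. \<xi> i v \<partial>N)"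
        by simp
    qed
    finally show ?case .
  qed
qed

lemma noise_Lp: obtains u where "0 < u" "\<And>n. Lp_le M p (noise n) u"
proof -
  obtain u where u: "0 < u" "\<And>n. Lp_le M p (\<lambda>w. X (Suc n) w - X n w) u" using increment_Lp by metis
  define k where "k = 1 + (\<Sum>i\<in>UNIV. norm (\<integral>v. \<xi> i v \<partial>N))"
  have k: "0 < k" unfolding k_def by (intro add_pos_nonneg sum_nonneg) auto
  have "Lp_le M p (noise n) (u + k)" for n
  proof -
    have c: "Lp_le M p (\<lambda>_. k) k" using p k by (intro Lp_le_const) auto
    have "Lp_le M p (\<lambda>w. - ((1 / weight n) *\<^sub>R (A *v X n w))) k"
    proof (rule Lp_le_bound[OF c, of _ 1])
      show "(\<lambda>w. - ((1 / weight n) *\<^sub>R (A *v X n w))) \<in> borel_measurable M"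
        by (intro borel_measurable_uminus borel_measurable_scaleR borel_measurable_const intensity_mult_measurable)
      show "AE w in M. norm (- ((1 / weight n) *\<^sub>R (A *v X n w))) \<le> 1 * norm k"
        using drift_bounded[of n] by eventually_elim (use k in \<open>simp add: k_def\<close>)
    qed (use p k in auto)
    from Lp_le_add[OF u(2)[of n] this] show ?thesis
      using u(1) k p by (simp add: noise_def[abs_def])
  qed
  then show thesis using u(1) k by (intro that[of "u + k"]) auto
qed

text \<open>The factor \<open>\<psi> (X n w)\<close> is known at time \<open>n\<close> and can be
  moved through the conditional expectation. Integrability of the product is assumed, since
  \<open>\<psi>\<close> may be unbounded.\<close>

lemma noise_orthogonal:
  fixes \<psi> :: "real ^ 'q \<Rightarrow> real"
  assumes \<psi> [measurable]: "\<psi> \<in> borel_measurable borel"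
    and i: "integrable M (\<lambda>w. \<psi> (X n w) * (g \<bullet> (X (Suc n) w - X n w)))"
  shows "integrable M (\<lambda>w. \<psi> (X n w) * (g \<bullet> noise n w))" "(\<integral>w. \<psi> (X n w) * (g \<bullet> noise n w) \<partial>M) = 0"
proof -
  let ?F = "urn_history M X J n n"
  let ?C = "real_cond_exp M ?F (\<lambda>w. g \<bullet> (X (Suc n) w - X n w))"
  interpret F: sigma_finite_subalgebra M ?F by (rule sigma_finite_history)
  have m: "(\<lambda>w. \<psi> (X n w)) \<in> borel_measurable ?F"
    using X_history by measurable
  have [measurable]: "?C \<in> borel_measurable M" by (rule borel_measurable_cond_exp2)
  note c = F.real_cond_exp_intg[OF i m]
  have ae: "AE w in M. \<psi> (X n w) * (g \<bullet> noise n w) = \<psi> (X n w) * (g \<bullet> (X (Suc n) w - X n w)) - \<psi> (X n w) * ?C w"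
    using cond_increment_inner[of n g]
    by eventually_elim (simp add: noise_def inner_diff_right algebra_simps)
  have i': "integrable M (\<lambda>w. \<psi> (X n w) * (g \<bullet> (X (Suc n) w - X n w)) - \<psi> (X n w) * ?C w)"
    using i c(1) by (intro Bochner_Integration.integrable_diff) auto
  show "integrable M (\<lambda>w. \<psi> (X n w) * (g \<bullet> noise n w))"
    by (rule integrable_cong_AE_imp[OF i']) (use ae in auto)
  have "(\<integral>w. \<psi> (X n w) * (g \<bullet> noise n w) \<partial>M)
      = (\<integral>w. \<psi> (X n w) * (g \<bullet> (X (Suc n) w - X n w)) - \<psi> (X n w) * ?C w \<partial>M)"
    by (rule integral_cong_AE) (use ae in auto)
  also have "\<dots> = 0" using i c by (subst Bochner_Integration.integral_diff) auto
  finally show "(\<integral>w. \<psi> (X n w) * (g \<bullet> noise n w) \<partial>M) = 0" .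
qed

text \<open>Orthogonality to the constant 1 in every direction \<open>g\<close> says that the noise
  has mean 0.\<close>

lemma mean_step: "(\<integral>w. X (Suc n) w \<partial>M) = (\<integral>w. X n w \<partial>M) + (1 / weight n) *\<^sub>R (A *v (\<integral>w. X n w \<partial>M))"
proof -
  have iD: "integrable M (\<lambda>w. X (Suc n) w - X n w)" by (intro Bochner_Integration.integrable_diff state_integrable)
  have bl: "bounded_linear (\<lambda>x. A *v x)" by (rule matrix_vector_mul_bounded_linear)
  have iA: "integrable M (\<lambda>w. A *v X n w)" by (rule integrable_bounded_linear[OF bl state_integrable])
  have iN: "integrable M (noise n)" unfolding noise_def[abs_def]
    by (intro Bochner_Integration.integrable_diff integrable_scaleR_right state_integrable iA)
  have "(\<integral>w. noise n w \<partial>M) = 0"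
  proof (rule vector_eq_rdot[THEN iffD1, rule_format])
    fix g
    show "(\<integral>w. noise n w \<partial>M) \<bullet> g = 0 \<bullet> g"
      using noise_orthogonal(2)[of "\<lambda>_. 1" n g] iD iN by (simp add: inner_commute)
  qed
  moreover have "(\<integral>w. noise n w \<partial>M) = ((\<integral>w. X (Suc n) w \<partial>M) - (\<integral>w. X n w \<partial>M)) - (1 / weight n) *\<^sub>R (A *v (\<integral>w. X n w \<partial>M))"
    unfolding noise_def using iD iA state_integrable integral_bounded_linear[OF bl state_integrable[of n]] by simp
  ultimately show ?thesis by (simp add: algebra_simps)
qed

definition dev :: "nat \<Rightarrow> 'w \<Rightarrow> real ^ 'q" where "dev n w = X n w - (\<integral>u. X n u \<partial>M)"

lemma dev_measurable [measurable]: "dev n \<in> borel_measurable M"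
  unfolding dev_def by measurable

lemma dev_0: "AE w in M. dev 0 w = 0"
proof -
  have "(\<integral>u. X 0 u \<partial>M) = (\<integral>u. x0 \<partial>M)" by (rule integral_cong_AE) (use initial_state in auto)
  then have "(\<integral>u. X 0 u \<partial>M) = x0" by (simp add: prob_space)
  then show ?thesis using initial_state by (simp add: dev_def)
qed

lemma dev_step: "dev (Suc n) w = dev n w + (1 / weight n) *\<^sub>R (A *v dev n w) + noise n w"
  unfolding dev_def noise_def mean_step
  by (simp add: matrix_vector_mult_diff_distrib scaleR_diff_right)

lemma inner_dev: "AE w in M. a \<bullet> dev n w = 0"
proof -
  have "a \<bullet> (\<integral>u. X n u \<partial>M) = (\<integral>u. a \<bullet> X n u \<partial>M)" using state_integrable by simp
  also have "\<dots> = (\<integral>u. weight n \<partial>M)" by (rule integral_cong_AE) (use state_weight in auto)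
  finally have "a \<bullet> (\<integral>u. X n u \<partial>M) = weight n" by (simp add: prob_space)
  with state_weight[of n] show ?thesis by (simp add: dev_def inner_diff_right)
qed

end

section \<open>Growth of the Jordan coordinates\<close>

lemma norm_lin_le: "norm (lin c x) \<le> (1 + (\<Sum>j\<in>UNIV. norm (c j))) * norm x"
proof -
  have "norm (lin c x) \<le> (\<Sum>j\<in>UNIV. norm (c j) * norm x)"
    unfolding lin_def
    by (rule order_trans[OF norm_sum]) (intro sum_mono, simp add: norm_mult mult_left_mono component_le_norm_cart)
  also have "\<dots> \<le> (1 + (\<Sum>j\<in>UNIV. norm (c j))) * norm x"
    by (simp add: sum_distrib_right[symmetric] distrib_right)
  finally show ?thesis .
qed

lemma lin_add: "lin c (x + y) = lin c x + lin c y"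
  by (simp add: lin_def distrib_left sum.distrib)

lemma lin_scaleR: "lin c (r *\<^sub>R x) = of_real r * lin c x"
  by (simp add: lin_def sum_distrib_left mult_ac)

lemma lin_zero [simp]: "lin c 0 = 0" "lin (\<lambda>_. 0) x = 0"
  by (simp_all add: lin_def)

lemma Re_lin: "Re (lin c x) = (\<chi> j. Re (c j)) \<bullet> x"
  by (simp add: lin_def inner_vec_def)

lemma Im_lin: "Im (lin c x) = (\<chi> j. Im (c j)) \<bullet> x"
  by (simp add: lin_def inner_vec_def)

lemma lin_measurable: "lin c \<in> borel_measurable borel"
  unfolding lin_def[abs_def] cart_eq_inner_axis by measurable

lemma Lp_norm_le:
  assumes U: "Lp_le M p U u" and u: "0 \<le> u" and p: "0 < p"
  shows "Lp_norm M p U \<le> ennreal u"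
proof -
  define I where "I = (\<integral>w. norm (U w) powr p \<partial>M)"
  have "(\<integral>\<^sup>+ w. ennreal (norm (U w) powr p) \<partial>M) = ennreal I"
    unfolding I_def using Lp_leD(2)[OF U] by (intro nn_integral_eq_integral) auto
  moreover have I: "0 \<le> I" "I \<le> u powr p" using Lp_leD(3)[OF U] by (auto simp: I_def)
  ultimately have "Lp_norm M p U = ennreal (I powr (1 / p))" by (simp add: Lp_norm_def Let_def)
  also have "I powr (1 / p) \<le> (u powr p) powr (1 / p)" using I p by (intro powr_mono2) auto
  also have "\<dots> = u" using u p by (simp add: powr_powr)
  finally show ?thesis by (simp add: ennreal_leI)
qed

context moment_urn
begin

lemma lin_dev_measurable [measurable]: "(\<lambda>w. lin c (dev n w)) \<in> borel_measurable M"
  by (rule measurable_compose[OF dev_measurable lin_measurable])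

lemma lin_noise_measurable [measurable]: "(\<lambda>w. lin c (noise n w)) \<in> borel_measurable M"
  by (rule measurable_compose[OF noise_measurable lin_measurable])

text \<open>The real inner product on the complex plane splits into real and imaginary parts, in
  each of which the noise enters through a real direction.\<close>

lemma noise_orthogonal_complex:
  fixes \<phi> :: "real ^ 'q \<Rightarrow> complex"
  assumes \<phi> [measurable]: "\<phi> \<in> borel_measurable borel" and V: "Lp_le M p (\<lambda>w. \<phi> (X n w)) m"
  shows "(\<integral>w. norm (\<phi> (X n w)) powr (p - 2) * (\<phi> (X n w) \<bullet> lin c (noise n w)) \<partial>M) = 0"
proof -
  obtain u where u: "0 < u" "Lp_le M p (\<lambda>w. X (Suc n) w - X n w) u" using increment_Lp by metis
  \<comment> \<open>Multiples of 1 and of the imaginary unit select the real and the imaginary part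
    of \<phi>; their norm bounds yield the integrability that \<open>noise_orthogonal\<close> asks
    for.\<close>
  have D: "Lp_le M p (\<lambda>w. z * of_real (g \<bullet> (X (Suc n) w - X n w))) (norm z * norm g * u)" for z :: complex and g
  proof (rule Lp_le_bound[OF u(2), of _ "norm z * norm g"])
    show "(\<lambda>w. z * of_real (g \<bullet> (X (Suc n) w - X n w))) \<in> borel_measurable M" by measurable
    show "AE w in M. norm (z * of_real (g \<bullet> (X (Suc n) w - X n w))) \<le> norm z * norm g * norm (X (Suc n) w - X n w)"
      by (intro AE_I2) (simp add: norm_mult mult.assoc mult_left_mono Cauchy_Schwarz_ineq2)
  qed (use u p in auto)
  define \<psi>1 where "\<psi>1 x = norm (\<phi> x) powr (p - 2) * Re (\<phi> x)" for x
  define \<psi>2 where "\<psi>2 x = norm (\<phi> x) powr (p - 2) * Im (\<phi> x)" for x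
  define g1 where "g1 = (\<chi> j. Re (c j))"
  define g2 where "g2 = (\<chi> j. Im (c j))"
  have m: "\<psi>1 \<in> borel_measurable borel" "\<psi>2 \<in> borel_measurable borel"
    unfolding \<psi>1_def[abs_def] \<psi>2_def[abs_def] by measurable
  have "integrable M (\<lambda>w. \<psi>1 (X n w) * (g1 \<bullet> (X (Suc n) w - X n w)))"
    using Lp_le_orthogonal_integrable[OF V D[of 1 g1] p] by (simp add: \<psi>1_def inner_complex_def mult.assoc)
  note 1 = noise_orthogonal[OF m(1) this]
  have "integrable M (\<lambda>w. \<psi>2 (X n w) * (g2 \<bullet> (X (Suc n) w - X n w)))"
    using Lp_le_orthogonal_integrable[OF V D[of \<i> g2] p] by (simp add: \<psi>2_def inner_complex_def mult.assoc)
  note 2 = noise_orthogonal[OF m(2) this]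
  have "(\<integral>w. norm (\<phi> (X n w)) powr (p - 2) * (\<phi> (X n w) \<bullet> lin c (noise n w)) \<partial>M)
    = (\<integral>w. \<psi>1 (X n w) * (g1 \<bullet> noise n w) + \<psi>2 (X n w) * (g2 \<bullet> noise n w) \<partial>M)"
    by (simp add: \<psi>1_def \<psi>2_def g1_def g2_def inner_complex_def Re_lin Im_lin algebra_simps)
  also have "\<dots> = 0" using 1 2 by simp
  finally show ?thesis .
qed

text \<open>The functional \<open>c'\<close> stands for the next coordinate in the block, or for 0
  at its end. The norm of the noise coordinate and the smoothness constant together form
  \<open>\<kappa>\<close>.\<close>

lemma lin_dev_recursion:
  assumes eigen: "\<And>x. lin c (A *v x) = z * lin c x + lin c' x"
    and r: "\<And>n. 0 < r n" and L: "\<And>n. Lp_le M p (\<lambda>w. lin c' (dev n w)) (r n)"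
  shows "\<exists>\<kappa>. norm_recursion (\<lambda>n m. Lp_le M p (\<lambda>w. lin c (dev n w)) m) z (a \<bullet> x0) b \<kappa> (\<lambda>n. r n / weight n)"
proof -
  obtain K where K: "0 < K"
    and smooth: "\<And>(M :: 'w measure) (V :: 'w \<Rightarrow> complex) D m d. \<lbrakk>Lp_le M p V m; Lp_le M p D d; 0 < m; 0 < d;
      (\<integral>w. norm (V w) powr (p - 2) * (V w \<bullet> D w) \<partial>M) = 0\<rbrakk>
      \<Longrightarrow> Lp_le M p (\<lambda>w. V w + D w) (sqrt (m\<^sup>2 + K * d\<^sup>2))"
    by (rule Lp_le_orthogonal_add[OF p]) (rule that)
  obtain u where u: "0 < u" "\<And>n. Lp_le M p (noise n) u" using noise_Lp by metis
  define k where "k = 1 + (\<Sum>j\<in>UNIV. norm (c j))"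
  have k: "0 < k" unfolding k_def by (intro add_pos_nonneg sum_nonneg) auto
  have D: "Lp_le M p (\<lambda>w. lin c (noise n w)) (k * u)" for n
    by (rule Lp_le_bound[OF u(2) lin_noise_measurable, of k])
      (use norm_lin_le[of c] u k p in \<open>auto simp: k_def\<close>)
  have ku: "0 < k * u" using k u by simp
  have step: "Lp_le M p (\<lambda>w. lin c (dev (Suc n) w))
      (sqrt ((norm (1 + z / of_real (weight n)) * m + r n / weight n)\<^sup>2 + K * (k * u)\<^sup>2))"
    if P: "Lp_le M p (\<lambda>w. lin c (dev n w)) m" and m: "0 < m" for n m
  proof -
    define s where "s = 1 + z / of_real (weight n)"
    define t where "t = 1 / complex_of_real (weight n)"
    have w: "0 < weight n" by (rule weight_pos)
    have nt: "norm t = 1 / weight n" using w by (simp add: t_def norm_divide)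
    have V2: "Lp_le M p (\<lambda>w. t * lin c' (dev n w)) (r n / weight n)"
      by (rule Lp_le_bound[OF L, of _ "norm t"]) (use p r[of n] w in \<open>auto simp: norm_mult nt\<close>)
    have rw: "0 < r n / weight n" using r[of n] w by simp
    \<comment> \<open>A vanishing multiplier is separate because the triangle inequality is
      available for positive bounds only.\<close>
    have V: "Lp_le M p (\<lambda>w. s * lin c (dev n w) + t * lin c' (dev n w)) (norm s * m + r n / weight n)"
    proof (cases "s = 0")
      case False
      have "Lp_le M p (\<lambda>w. s * lin c (dev n w)) (norm s * m)"
        by (rule Lp_le_bound[OF P, of _ "norm s"]) (use p m in \<open>auto simp: norm_mult\<close>)
      then show ?thesis using V2 p rw m False by (intro Lp_le_add) auto
    qed (use V2 in simp)
    have pos: "0 < norm s * m + r n / weight n" using rw m by (intro add_nonneg_pos) auto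
    \<comment> \<open>The predictable part is written as a function of the current state, the form
      in which the noise is orthogonal to it.\<close>
    define \<phi> where "\<phi> x = s * lin c (x - (\<integral>u. X n u \<partial>M)) + t * lin c' (x - (\<integral>u. X n u \<partial>M))" for x
    have \<phi>: "\<phi> \<in> borel_measurable borel"
      unfolding \<phi>_def[abs_def] using lin_measurable by (intro borel_measurable_add borel_measurable_times borel_measurable_const
        measurable_compose[OF _ lin_measurable] borel_measurable_diff) auto
    have V_eq: "(\<lambda>w. s * lin c (dev n w) + t * lin c' (dev n w)) = (\<lambda>w. \<phi> (X n w))"
      by (simp add: \<phi>_def dev_def)
    have "Lp_le M p (\<lambda>w. \<phi> (X n w) + lin c (noise n w)) (sqrt ((norm s * m + r n / weight n)\<^sup>2 + K * (k * u)\<^sup>2))"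
      by (rule smooth[OF V[unfolded V_eq] D pos ku noise_orthogonal_complex[OF \<phi> V[unfolded V_eq]]])
    moreover have "\<phi> (X n w) + lin c (noise n w) = lin c (dev (Suc n) w)" for w
      unfolding dev_step[of n w] V_eq[THEN fun_cong, of w, symmetric] lin_add lin_scaleR eigen
      by (simp add: s_def t_def algebra_simps add_divide_distrib)
    ultimately show ?thesis by (simp add: s_def)
  qed
  have w0: "0 < a \<bullet> x0" using weight_pos[of 0] by (simp add: weight_def)
  have "norm_recursion (\<lambda>n m. Lp_le M p (\<lambda>w. lin c (dev n w)) m) z (a \<bullet> x0) b (K * (k * u)\<^sup>2) (\<lambda>n. r n / weight n)"
  proof
    show "0 < a \<bullet> x0" "0 < b" "0 \<le> K * (k * u)\<^sup>2" using w0 b_pos K by auto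
    show "0 < r n / weight n" for n using r weight_pos by simp
    show "Lp_le M p (\<lambda>w. lin c (dev 0 w)) m" if "0 < m" for m
    proof (rule Lp_le_cong_AE)
      show "Lp_le M p (\<lambda>_. 0 :: complex) m" using that p by (intro Lp_le_const) auto
      show "AE w in M. lin c (dev 0 w) = 0" using dev_0 by eventually_elim simp
    qed simp
    show "Lp_le M p (\<lambda>w. lin c (dev n w)) m'" if "Lp_le M p (\<lambda>w. lin c (dev n w)) m" "0 < m" "m \<le> m'" for n m m'
      using that p by (intro Lp_le_mono[OF that(1)]) auto
    show "Lp_le M p (\<lambda>w. lin c (dev (Suc n) w))
      (sqrt ((norm (1 + z / of_real (a \<bullet> x0 + real n * b)) * m + r n / weight n)\<^sup>2 + K * (k * u)\<^sup>2))"
      if "Lp_le M p (\<lambda>w. lin c (dev n w)) m" "0 < m" for n m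
      using step[OF that] by (simp add: weight_def)
  qed
  then show ?thesis by blast
qed

lemma weight_ge: obtains lo where "0 < lo" "\<And>n. lo * real (Suc n) \<le> weight n"
proof (rule that[of "min (a \<bullet> x0) b"])
  show "0 < min (a \<bullet> x0) b" using weight_pos[of 0] b_pos by (simp add: weight_def)
  fix n
  have "min (a \<bullet> x0) b * real n \<le> b * real n" by (intro mult_right_mono) auto
  then show "min (a \<bullet> x0) b * real (Suc n) \<le> weight n" by (simp add: weight_def algebra_simps)
qed

lemma lin_dev_zero: "0 < m \<Longrightarrow> Lp_le M p (\<lambda>w. lin (\<lambda>_. 0) (dev n w)) m"
  using Lp_le_const[of "0 :: complex" m p] p by simp

lemma lin_dev_subdominant:
  fixes \<gamma> :: real
  assumes eigen: "\<And>x. lin c (A *v x) = z * lin c x + lin c' x"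
    and \<gamma>: "1/2 \<le> \<gamma>" "Re z < \<gamma> * b"
    and L: "\<exists>C>0. \<forall>n. Lp_le M p (\<lambda>w. lin c' (dev n w)) (C * real (Suc n) powr \<gamma>)"
  shows "\<exists>C>0. \<forall>n. Lp_le M p (\<lambda>w. lin c (dev n w)) (C * real (Suc n) powr \<gamma>)"
proof -
  obtain C where C: "0 < C" "\<And>n. Lp_le M p (\<lambda>w. lin c' (dev n w)) (C * real (Suc n) powr \<gamma>)"
    using L by blast
  have Cp: "0 < C * real (Suc n) powr \<gamma>" for n using C(1) by simp
  obtain \<kappa> where "norm_recursion (\<lambda>n m. Lp_le M p (\<lambda>w. lin c (dev n w)) m) z (a \<bullet> x0) b \<kappa>
      (\<lambda>n. C * real (Suc n) powr \<gamma> / weight n)"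
    using lin_dev_recursion[OF eigen Cp C(2)] by blast
  then interpret R: norm_recursion "\<lambda>n m. Lp_le M p (\<lambda>w. lin c (dev n w)) m" z "a \<bullet> x0" b \<kappa>
      "\<lambda>n. C * real (Suc n) powr \<gamma> / weight n" .
  obtain lo where lo: "0 < lo" "\<And>n. lo * real (Suc n) \<le> weight n" using weight_ge by blast
  show ?thesis
  proof (rule R.growth_subdominant[OF \<gamma>, of "C / lo"])
    show "0 < C / lo" using C(1) lo(1) by simp
    fix k
    have "C * real (Suc k) powr \<gamma> / weight k \<le> C * real (Suc k) powr \<gamma> / (lo * real (Suc k))"
      using Cp[of k] lo weight_pos[of k] by (intro divide_left_mono) auto
    also have "\<dots> = C / lo * real (Suc k) powr (\<gamma> - 1)"
      by (simp add: powr_diff)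
    finally show "C * real (Suc k) powr \<gamma> / weight k \<le> C / lo * real (Suc k) powr (\<gamma> - 1)" .
  qed
qed

lemma lin_dev_dominant_base:
  fixes \<alpha> \<eta> :: real
  assumes eigen: "\<And>x. lin c (A *v x) = z * lin c x"
    and \<alpha>: "1/2 \<le> \<alpha>" "Re z \<le> \<alpha> * b" and \<eta>: "0 \<le> \<eta>" "\<alpha> = 1/2 \<Longrightarrow> 1/2 \<le> \<eta>"
  shows "\<exists>C>0. \<forall>n. Lp_le M p (\<lambda>w. lin c (dev n w)) (C * (real (Suc n) powr \<alpha> * (1 + ln (real (Suc n))) powr \<eta>))"
proof -
  \<comment> \<open>The weight cancels in \<open>r n / weight n\<close>, leaving the artificial
    summable forcing; the zero functional satisfies any positive bound.\<close>
  define r where "r n = weight n * real (Suc n) powr (\<alpha> - 2)" for n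
  have r: "0 < r n" for n using weight_pos[of n] by (simp add: r_def)
  obtain \<kappa> where "norm_recursion (\<lambda>n m. Lp_le M p (\<lambda>w. lin c (dev n w)) m) z (a \<bullet> x0) b \<kappa> (\<lambda>n. r n / weight n)"
  proof -
    have "lin c (A *v x) = z * lin c x + lin (\<lambda>_. 0) x" for x by (simp add: eigen)
    then show thesis using that lin_dev_recursion[where r = r, OF _ r lin_dev_zero[OF r]] by blast
  qed
  then interpret R: norm_recursion "\<lambda>n m. Lp_le M p (\<lambda>w. lin c (dev n w)) m" z "a \<bullet> x0" b \<kappa> "\<lambda>n. r n / weight n" .
  show ?thesis
  proof (rule R.growth_dominant_base[OF \<alpha> \<eta>])
    show "r k / weight k \<le> real (Suc k) powr (\<alpha> - 2)" for k
      using weight_pos[of k] by (simp add: r_def)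
  qed
qed

lemma lin_dev_dominant_step:
  fixes \<alpha> \<eta> :: real
  assumes eigen: "\<And>x. lin c (A *v x) = z * lin c x + lin c' x"
    and \<alpha>: "1/2 \<le> \<alpha>" "Re z \<le> \<alpha> * b" and \<eta>: "0 \<le> \<eta>" "\<alpha> = 1/2 \<Longrightarrow> 1/2 \<le> \<eta>"
    and L: "\<exists>C>0. \<forall>n. Lp_le M p (\<lambda>w. lin c' (dev n w)) (C * (real (Suc n) powr \<alpha> * (1 + ln (real (Suc n))) powr \<eta>))"
  shows "\<exists>C>0. \<forall>n. Lp_le M p (\<lambda>w. lin c (dev n w)) (C * (real (Suc n) powr \<alpha> * (1 + ln (real (Suc n))) powr (\<eta> + 1)))"
proof -
  define r where "r C n = C * (real (Suc n) powr \<alpha> * (1 + ln (real (Suc n))) powr \<eta>)" for C n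
  obtain C where C: "0 < C" "\<And>n. Lp_le M p (\<lambda>w. lin c' (dev n w)) (r C n)"
    using L unfolding r_def by blast
  have r: "0 < r C n" for n
  proof -
    have "0 < 1 + ln (real (Suc n))" by (intro add_pos_nonneg) auto
    then show ?thesis using C(1) unfolding r_def by (intro mult_pos_pos) auto
  qed
  obtain \<kappa> where "norm_recursion (\<lambda>n m. Lp_le M p (\<lambda>w. lin c (dev n w)) m) z (a \<bullet> x0) b \<kappa> (\<lambda>n. r C n / weight n)"
    using lin_dev_recursion[OF eigen r C(2)] by blast
  then interpret R: norm_recursion "\<lambda>n m. Lp_le M p (\<lambda>w. lin c (dev n w)) m" z "a \<bullet> x0" b \<kappa> "\<lambda>n. r C n / weight n" .
  obtain lo where lo: "0 < lo" "\<And>n. lo * real (Suc n) \<le> weight n" using weight_ge by blast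
  show ?thesis
  proof (rule R.growth_dominant_step[OF \<alpha> \<eta>(1), of "C / lo"])
    show "0 < C / lo" using C(1) lo(1) by simp
    fix k
    have "r C k / weight k \<le> r C k / (lo * real (Suc k))"
      using r[of k] lo weight_pos[of k] by (intro divide_left_mono) auto
    also have "\<dots> = C / lo * real (Suc k) powr (\<alpha> - 1) * (1 + ln (real (Suc k))) powr \<eta>"
      by (simp add: powr_diff r_def)
    finally show "r C k / weight k \<le> C / lo * real (Suc k) powr (\<alpha> - 1) * (1 + ln (real (Suc k))) powr \<eta>" .
  qed
qed

section \<open>Induction along Jordan chains and assembly of the coordinates\<close>

lemma jordan_chain_subdominant:
  fixes \<gamma> :: real and q :: nat
  assumes eigen: "\<And>i x. i < q \<Longrightarrow>
      lin (c i) (A *v x) = lam i * lin (c i) x + (if 0 < d i then lin (c (Suc i)) x else 0)"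
    and chain: "\<And>i. i < q \<Longrightarrow> 0 < d i \<Longrightarrow> Suc i < q \<and> lam (Suc i) = lam i \<and> d i = Suc (d (Suc i))"
    and \<gamma>: "1/2 \<le> \<gamma>" and i: "i < q" "Re (lam i) < \<gamma> * b"
  shows "\<exists>C>0. \<forall>n. Lp_le M p (\<lambda>w. lin (c i) (dev n w)) (C * real (Suc n) powr \<gamma>)"
  using i
proof (induction "d i" arbitrary: i)
  case 0
  show ?case
  proof (rule lin_dev_subdominant[OF _ \<gamma> 0(3)])
    show "lin (c i) (A *v x) = lam i * lin (c i) x + lin (\<lambda>_. 0) x" for x
      using eigen[OF 0(2)] 0(1) by simp
    show "\<exists>C>0. \<forall>n. Lp_le M p (\<lambda>w. lin (\<lambda>_. 0) (dev n w)) (C * real (Suc n) powr \<gamma>)"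
      by (intro exI[of _ 1] conjI allI lin_dev_zero) auto
  qed
next
  case (Suc k)
  have ch: "Suc i < q" "lam (Suc i) = lam i" "k = d (Suc i)" using chain[OF Suc(3)] Suc(2) by auto
  show ?case
  proof (rule lin_dev_subdominant[OF _ \<gamma> Suc(4)])
    show "lin (c i) (A *v x) = lam i * lin (c i) x + lin (c (Suc i)) x" for x
      using eigen[OF Suc(3)] Suc(2) by simp
    show "\<exists>C>0. \<forall>n. Lp_le M p (\<lambda>w. lin (c (Suc i)) (dev n w)) (C * real (Suc n) powr \<gamma>)"
      by (rule Suc(1)) (use ch Suc in auto)
  qed
qed

text \<open>The induction runs from the end of the block, and \<open>d i\<close> counts the steps
  up. The offset \<open>\<theta>\<close> is the logarithmic exponent of the last coordinate, 1/2 in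
  the critical case because of the noise.\<close>

lemma jordan_chain_dominant:
  fixes \<alpha> \<theta> :: real and q :: nat
  assumes eigen: "\<And>i x. i < q \<Longrightarrow>
      lin (c i) (A *v x) = lam i * lin (c i) x + (if 0 < d i then lin (c (Suc i)) x else 0)"
    and chain: "\<And>i. i < q \<Longrightarrow> 0 < d i \<Longrightarrow> Suc i < q \<and> lam (Suc i) = lam i \<and> d i = Suc (d (Suc i))"
    and \<alpha>: "1/2 \<le> \<alpha>" and \<theta>: "0 \<le> \<theta>" "\<alpha> = 1/2 \<Longrightarrow> 1/2 \<le> \<theta>" and i: "i < q" "Re (lam i) \<le> \<alpha> * b"
  shows "\<exists>C>0. \<forall>n. Lp_le M p (\<lambda>w. lin (c i) (dev n w))
    (C * (real (Suc n) powr \<alpha> * (1 + ln (real (Suc n))) powr (\<theta> + real (d i))))"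
  using i
proof (induction "d i" arbitrary: i)
  case 0
  have "\<exists>C>0. \<forall>n. Lp_le M p (\<lambda>w. lin (c i) (dev n w))
    (C * (real (Suc n) powr \<alpha> * (1 + ln (real (Suc n))) powr \<theta>))"
  proof (rule lin_dev_dominant_base[OF _ \<alpha> 0(3) \<theta>])
    show "lin (c i) (A *v x) = lam i * lin (c i) x" for x
      using eigen[OF 0(2)] 0(1) by simp
  qed
  then show ?case using 0(1) by simp
next
  case (Suc k)
  have ch: "Suc i < q" "lam (Suc i) = lam i" "k = d (Suc i)" using chain[OF Suc(3)] Suc(2) by auto
  have "\<exists>C>0. \<forall>n. Lp_le M p (\<lambda>w. lin (c i) (dev n w))
    (C * (real (Suc n) powr \<alpha> * (1 + ln (real (Suc n))) powr (\<theta> + real k + 1)))"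
  proof (rule lin_dev_dominant_step[OF _ \<alpha> Suc(4)])
    show "lin (c i) (A *v x) = lam i * lin (c i) x + lin (c (Suc i)) x" for x
      using eigen[OF Suc(3)] Suc(2) by simp
    show "\<exists>C>0. \<forall>n. Lp_le M p (\<lambda>w. lin (c (Suc i)) (dev n w))
        (C * (real (Suc n) powr \<alpha> * (1 + ln (real (Suc n))) powr (\<theta> + real k)))"
      unfolding ch(3) by (rule Suc(1)) (use ch Suc in auto)
  qed (use \<theta> in auto)
  moreover have "\<theta> + real (d i) = \<theta> + real k + 1" unfolding Suc(2)[symmetric] by simp
  ultimately show ?case by (simp only:)
qed

lemma activity_nonzero: "a \<noteq> 0"
proof
  assume "a = 0"
  have "AE w in M. False"
    using state_weight[of 0] by eventually_elim (use \<open>a = 0\<close> weight_pos[of 0] in simp)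
  then show False by simp
qed

lemma dev_Lp:
  fixes ls :: "complex list" and \<gamma> \<eta> :: real
  defines "\<nu> \<equiv> jordan_nu (complex_mat_of A) (ls ! 1)"
  assumes ls: "eigenvalue_listing (complex_mat_of A) ls" "ls ! 0 = complex_of_real b"
    and \<gamma>: "\<gamma> = max (1/2) (Re (ls ! 1) / b)"
    and \<eta>: "\<eta> = (if Re (ls ! 1) < b / 2 then 0 else if Re (ls ! 1) = b / 2 then real \<nu> + 1/2 else real \<nu>)"
  shows "\<exists>C>0. \<forall>n. Lp_le M p (dev n) (C * (real (Suc n) powr \<gamma> * (1 + ln (real (Suc n))) powr \<eta>))"
proof -
  define T where "T n = real (Suc n) powr \<gamma> * (1 + ln (real (Suc n))) powr \<eta>" for n
  obtain c :: "nat \<Rightarrow> 'q \<Rightarrow> complex" and lam :: "nat \<Rightarrow> complex" and d :: "nat \<Rightarrow> nat" and K :: real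
    where eigen: "\<And>i x. i < CARD('q) \<Longrightarrow>
      lin (c i) (A *v x) = lam i * lin (c i) x + (if 0 < d i then lin (c (Suc i)) x else 0)"
    and chain: "\<And>i. i < CARD('q) \<Longrightarrow> 0 < d i \<Longrightarrow> Suc i < CARD('q) \<and> lam (Suc i) = lam i \<and> d i = Suc (d (Suc i))"
    and K: "0 < K" "\<And>x. norm x \<le> (\<Sum>i<CARD('q). K * norm (lin (c i) x))"
    and kinds: "\<And>i. i < CARD('q) \<Longrightarrow> (\<exists>r. \<forall>j. c i j = r * of_real (a $ j)) \<or> Re (lam i) < Re (ls ! 1) \<or>
      Re (lam i) = Re (ls ! 1) \<and> d i \<le> \<nu>"
    by (rule jordan_coordinates[OF ls activity_nonzero left_eigenvector, folded \<nu>_def]) (rule that)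
  have \<gamma>2: "1/2 \<le> \<gamma>" "Re (ls ! 1) \<le> \<gamma> * b" using b_pos by (auto simp: \<gamma> max_def field_simps)
  have \<eta>0: "0 \<le> \<eta>" by (simp add: \<eta>)
  have L1: "1 \<le> 1 + ln (real (Suc n))" for n by simp
  have Tpos: "0 < T n" for n
  proof -
    have "0 < 1 + ln (real (Suc n))" using L1[of n] by linarith
    then show ?thesis by (simp add: T_def)
  qed
  have T_ge: "real (Suc n) powr \<gamma> \<le> T n" for n
  proof -
    have "real (Suc n) powr \<gamma> * 1 \<le> T n"
      unfolding T_def using L1 \<eta>0 by (intro mult_left_mono ge_one_powr_ge_zero) auto
    then show ?thesis by simp
  qed
  have "\<exists>C>0. \<forall>n. Lp_le M p (\<lambda>w. lin (c i) (dev n w)) (C * T n)" if i: "i < CARD('q)" for i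
  proof -
    have mono: ?thesis if "\<exists>C>0. \<forall>n. Lp_le M p (\<lambda>w. lin (c i) (dev n w)) (C * t n)" "\<And>n. 0 < t n" "\<And>n. t n \<le> T n"
      for t :: "nat \<Rightarrow> real"
    proof -
      obtain C where C: "0 < C" "\<And>n. Lp_le M p (\<lambda>w. lin (c i) (dev n w)) (C * t n)" using \<open>\<exists>C>0. _ C\<close> by blast
      have "Lp_le M p (\<lambda>w. lin (c i) (dev n w)) (C * T n)" for n
        by (rule Lp_le_mono[OF C(2)]) (use p C(1) that(2,3)[of n] in \<open>auto intro: mult_left_mono less_imp_le\<close>)
      then show ?thesis using C(1) by blast
    qed
    \<comment> \<open>Real parts strictly below \<open>\<gamma> * b\<close> need no control of the
      block size.\<close>
    have sub: ?thesis if "Re (lam i) < \<gamma> * b"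
      by (rule mono[OF jordan_chain_subdominant[OF eigen chain \<gamma>2(1) i that]]) (use T_ge in auto)
    from kinds[OF i] consider (left) r where "\<And>j. c i j = r * of_real (a $ j)"
      | (less) "Re (lam i) < Re (ls ! 1)" | (eq) "Re (lam i) = Re (ls ! 1)" "d i \<le> \<nu>" by blast
    then show ?thesis
    proof cases
      case left
      have lin_eq: "lin (c i) x = r * of_real (a \<bullet> x)" for x
        by (simp add: lin_def left inner_vec_def sum_distrib_left mult_ac)
      have 0: "AE w in M. lin (c i) (dev n w) = 0" for n
        using inner_dev[of n] by eventually_elim (simp add: lin_eq)
      have "Lp_le M p (\<lambda>w. lin (c i) (dev n w)) (1 * T n)" for n
      proof (rule Lp_le_cong_AE)
        show "Lp_le M p (\<lambda>_. 0 :: complex) (1 * T n)" using Tpos[of n] p by (intro Lp_le_const) auto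
      qed (use 0 in auto)
      then show ?thesis by (intro exI[of _ 1]) simp
    next
      case less
      then show ?thesis using \<gamma>2(2) by (intro sub) simp
    next
      case eq
      show ?thesis
      proof (cases "Re (ls ! 1) < b / 2")
        case True
        moreover have "1/2 * b \<le> \<gamma> * b" using \<gamma>2(1) b_pos by (intro mult_right_mono) auto
        ultimately show ?thesis using eq(1) by (intro sub) linarith
      next
        case False
        define \<theta> :: real where "\<theta> = (if Re (ls ! 1) = b / 2 then 1/2 else 0)"
        \<comment> \<open>Outside the first case, \<open>\<gamma> = 1/2\<close> means that the real
          part of the second eigenvalue is exactly \<open>b / 2\<close>.\<close>
        have half: "\<gamma> = 1/2 \<Longrightarrow> 1/2 \<le> \<theta>"
          using False b_pos by (auto simp: \<theta>_def \<gamma> max_def field_simps split: if_splits)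
        have "\<theta> + real (d i) \<le> \<eta>" using False eq(2) by (auto simp: \<theta>_def \<eta>)
        then have le: "real (Suc n) powr \<gamma> * (1 + ln (real (Suc n))) powr (\<theta> + real (d i)) \<le> T n" for n
          unfolding T_def using L1 by (intro mult_left_mono powr_mono) auto
        have pos: "0 < real (Suc n) powr \<gamma> * (1 + ln (real (Suc n))) powr (\<theta> + real (d i))" for n
        proof -
          have "0 < 1 + ln (real (Suc n))" using L1[of n] by linarith
          then show ?thesis by simp
        qed
        show ?thesis
          by (rule mono[OF jordan_chain_dominant[OF eigen chain \<gamma>2(1) _ half i] pos le])
            (use \<gamma>2(2) eq in \<open>auto simp: \<theta>_def\<close>)
      qed
    qed
  qed
  then obtain C where C: "\<And>i. i < CARD('q) \<Longrightarrow> 0 < C i"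
    "\<And>i n. i < CARD('q) \<Longrightarrow> Lp_le M p (\<lambda>w. lin (c i) (dev n w)) (C i * T n)" by metis
  \<comment> \<open>The summand 1 accounts for the slack of \<open>Lp_le_sum\<close>, chosen here as
    \<open>T n\<close>.\<close>
  define D where "D = 1 + (\<Sum>i<CARD('q). K * C i)"
  have D: "0 < D" unfolding D_def using K C(1) by (intro add_pos_nonneg sum_nonneg) (auto intro: less_imp_le)
  have "Lp_le M p (dev n) (D * T n)" for n
  proof -
    have "Lp_le M p (\<lambda>w. \<Sum>i<CARD('q). K * norm (lin (c i) (dev n w))) (T n + (\<Sum>i<CARD('q). K * (C i * T n)))"
    proof (rule Lp_le_sum)
      fix i assume "i \<in> {..<CARD('q)}"
      then have i: "i < CARD('q)" by simp
      show "0 < K * (C i * T n)" using K(1) C(1)[OF i] Tpos[of n] by simp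
      show "Lp_le M p (\<lambda>w. K * norm (lin (c i) (dev n w))) (K * (C i * T n))"
        by (rule Lp_le_bound[OF C(2)[OF i], of _ K]) (use K(1) C(1)[OF i] Tpos[of n] p in \<open>auto simp: abs_mult\<close>)
    qed (use p Tpos in auto)
    then have S: "Lp_le M p (\<lambda>w. \<Sum>i<CARD('q). K * norm (lin (c i) (dev n w))) (D * T n)"
      by (simp add: D_def distrib_right sum_distrib_right mult.assoc)
    show ?thesis
      by (rule Lp_le_bound[OF S dev_measurable, of 1])
        (use K(2) p D Tpos[of n] in \<open>auto intro!: AE_I2 order_trans[OF _ abs_ge_self] simp: less_imp_le\<close>)
  qed
  then show ?thesis using D unfolding T_def by blast
qed

end

text \<open>Passes from the shifted quantities, which are harmless at 0, to those of the theorem.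
  From \<open>n = 2\<close> on, ln n is at least 2/3, so 1 is at most 3/2 ln n and the logarithmic
  base at most 4 ln n.\<close>

lemma Suc_powr_ln_powr_le:
  fixes \<gamma> \<eta> :: real
  assumes n: "2 \<le> n" and \<gamma>: "0 \<le> \<gamma>" and \<eta>: "0 \<le> \<eta>"
  shows "real (Suc n) powr \<gamma> * (1 + ln (real (Suc n))) powr \<eta> \<le> 2 powr \<gamma> * 4 powr \<eta> * (real n powr \<gamma> * ln (real n) powr \<eta>)"
proof -
  have "2 / 3 \<le> ln (2::real)" by (rule ln2_ge_two_thirds)
  also have "\<dots> \<le> ln (real n)" using n by simp
  finally have l: "2 / 3 \<le> ln (real n)" .
  have "real (Suc n) \<le> 2 * real n" using n by simp
  then have 1: "real (Suc n) powr \<gamma> \<le> 2 powr \<gamma> * real n powr \<gamma>"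
    using \<gamma> by (subst powr_mult[symmetric]) (auto intro: powr_mono2)
  have "ln (real (Suc n)) \<le> ln (2 * real n)" using n by simp
  also have "\<dots> = ln 2 + ln (real n)" using n by (simp add: ln_mult)
  also have "\<dots> \<le> 2 * ln (real n)" using n by simp
  finally have "1 + ln (real (Suc n)) \<le> 4 * ln (real n)" using l by linarith
  then have 2: "(1 + ln (real (Suc n))) powr \<eta> \<le> 4 powr \<eta> * ln (real n) powr \<eta>"
    using \<eta> l by (subst powr_mult[symmetric]) (auto intro!: powr_mono2 add_nonneg_nonneg)
  from mult_mono[OF 1 2] show ?thesis by (simp add: mult_ac)
qed

theorem theorem3p1:
  fixes a x0 :: "real ^ 'q::finite"
    and N :: "'v measure" and \<xi> :: "'q \<Rightarrow> 'v \<Rightarrow> real ^ 'q"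
    and M :: "'w measure" and X :: "nat \<Rightarrow> 'w \<Rightarrow> real ^ 'q" and J :: "nat \<Rightarrow> 'w \<Rightarrow> 'q"
    and b p :: real and ls :: "complex list"
  defines "A \<equiv> complex_mat_of (intensity_matrix a N \<xi>)"
  defines "l1 \<equiv> ls ! 0" and "l2 \<equiv> ls ! 1"
  defines "nu2 \<equiv> jordan_nu A l2"
  assumes "CARD('q) \<ge> 2"
    and "polya_urn a N \<xi> x0 M X J"
    and "tenable a M X"
    and "balanced a N \<xi> b"
    and "eigenvalue_listing A ls"
    and "l1 = complex_of_real b"
    and "p \<ge> 2"
    and "\<And>i j. integrable N (\<lambda>v. \<bar>\<xi> i v $ j\<bar> powr p)"
  shows "\<exists>C::real. \<forall>n\<ge>2.
    Lp_norm M p (\<lambda>w. X n w - (\<integral>u. X n u \<partial>M)) \<le> ennreal (C *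
      (if Re l2 < Re l1 / 2 then real n powr (1/2)
       else if Re l2 = Re l1 / 2 then real n powr (1/2) * ln (real n) powr (real nu2 + 1/2)
       else real n powr (Re l2 / Re l1) * ln (real n) ^ nu2))"
proof -
  interpret polya_urn a N \<xi> x0 M X J by fact
  interpret U: moment_urn a N \<xi> x0 M X J b p
    by unfold_locales fact+
  \<comment> \<open>With these exponents the three cases become a single bound.\<close>
  define \<gamma> where "\<gamma> = max (1/2) (Re l2 / b)"
  define \<eta> where "\<eta> = (if Re l2 < b / 2 then 0 else if Re l2 = b / 2 then real nu2 + 1/2 else real nu2)"
  have \<gamma>\<eta>: "0 \<le> \<gamma>" "0 \<le> \<eta>" by (auto simp: \<gamma>_def \<eta>_def)
  have "\<exists>C>0. \<forall>n. Lp_le M p (U.dev n) (C * (real (Suc n) powr \<gamma> * (1 + ln (real (Suc n))) powr \<eta>))"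
  proof (rule U.dev_Lp)
    show "eigenvalue_listing (complex_mat_of U.A) ls"
      using \<open>eigenvalue_listing A ls\<close> by (simp only: A_def)
    show "ls ! 0 = complex_of_real b" using \<open>l1 = complex_of_real b\<close> by (simp only: l1_def)
    show "\<gamma> = max (1/2) (Re (ls ! 1) / b)" by (simp only: \<gamma>_def l2_def)
    show "\<eta> = (if Re (ls ! 1) < b / 2 then 0
        else if Re (ls ! 1) = b / 2 then real (jordan_nu (complex_mat_of U.A) (ls ! 1)) + 1/2
        else real (jordan_nu (complex_mat_of U.A) (ls ! 1)))"
      by (simp only: \<eta>_def l2_def nu2_def A_def)
  qed
  then obtain C where C: "0 < C"
    "\<And>n. Lp_le M p (U.dev n) (C * (real (Suc n) powr \<gamma> * (1 + ln (real (Suc n))) powr \<eta>))"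
    by blast
  have Re: "Re l1 = b" using \<open>l1 = complex_of_real b\<close> by simp
  have "Lp_norm M p (\<lambda>w. X n w - (\<integral>u. X n u \<partial>M)) \<le> ennreal (C * 2 powr \<gamma> * 4 powr \<eta> *
      (if Re l2 < Re l1 / 2 then real n powr (1/2)
       else if Re l2 = Re l1 / 2 then real n powr (1/2) * ln (real n) powr (real nu2 + 1/2)
       else real n powr (Re l2 / Re l1) * ln (real n) ^ nu2))" if n: "2 \<le> n" for n
  proof -
    \<comment> \<open>Positivity gives \<open>ln (real n) powr 0 = 1\<close> in the first case, as
      \<open>0 powr 0\<close> is 0, and turns \<open>powr\<close> into a natural power in the
      third.\<close>
    have ln: "0 < ln (real n)" using n by simp
    have "Lp_norm M p (U.dev n) \<le> ennreal (C * (real (Suc n) powr \<gamma> * (1 + ln (real (Suc n))) powr \<eta>))"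
      using C U.p by (intro Lp_norm_le[OF C(2)]) auto
    also have "\<dots> \<le> ennreal (C * (2 powr \<gamma> * 4 powr \<eta> * (real n powr \<gamma> * ln (real n) powr \<eta>)))"
      using C(1) by (intro ennreal_leI mult_left_mono Suc_powr_ln_powr_le n \<gamma>\<eta>) auto
    also have "real n powr \<gamma> * ln (real n) powr \<eta> =
      (if Re l2 < Re l1 / 2 then real n powr (1/2)
       else if Re l2 = Re l1 / 2 then real n powr (1/2) * ln (real n) powr (real nu2 + 1/2)
       else real n powr (Re l2 / Re l1) * ln (real n) ^ nu2)"
    proof -
      consider "Re l2 < b / 2" | "Re l2 = b / 2" | "b / 2 < Re l2" by linarith
      then show ?thesis
      proof cases
        case 1
        then have ge: "\<gamma> = 1/2" "\<eta> = 0" using U.b_pos by (auto simp: \<gamma>_def \<eta>_def max_def field_simps)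
        then show ?thesis unfolding ge using 1 ln by (simp add: Re)
      next
        case 2
        then have ge: "\<gamma> = 1/2" "\<eta> = real nu2 + 1/2" using U.b_pos by (auto simp: \<gamma>_def \<eta>_def)
        then show ?thesis unfolding ge using 2 by (simp add: Re)
      next
        case 3
        then have ge: "\<gamma> = Re l2 / b" "\<eta> = real nu2" using U.b_pos by (auto simp: \<gamma>_def \<eta>_def max_def field_simps)
        then show ?thesis unfolding ge using 3 ln by (simp add: Re powr_realpow)
      qed
    qed
    finally show ?thesis by (simp add: U.dev_def[abs_def] mult.assoc)
  qed
  then show ?thesis by blast
qed

end
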